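(* Let $K$ be a field with $\mathrm{char}(K)\neq2$, let $\mathcal{G}=\mathrm{GA}_2(K)$ and let $f\in\mathcal{G}$ be a CR element. Then $f$ has a symmetry in $\mathcal{G}$ that is an involution if and only if any cyclically reduced element $\tilde f$ to which $f$ is conjugate in $\mathcal{G}$ commutes with a map of the form $x'=-x+u,\ y'=-y+v$ for some $u,v\in K$. If $\tilde f$ is given by $x'=P(x,y),\ y'=Q(x,y)$ with $P,Q\in K[x,y]$, this commutation means that $P(-x+u,-y+v)+P(x,y)=u$ and $Q(-x+u,-y+v)+Q(x,y)=v$.
   Context: $\mathcal{G}=\mathrm{GA}_2(K)$ is the group, under composition, of polynomial automorphisms of the affine plane over $K$: maps $x'=P(x,y),\ y'=Q(x,y)$ with $P,Q\in K[x,y]$ that have a polynomial inverse; elements are formal polynomial maps, i.e. distinguished by their polynomials. A symmetry of $f$ is an element of $\mathcal{G}$ commuting with $f$. An involution is an element $s$ with $s^2=1\neq s$. Let $\mathcal{A}\subset\mathcal{G}$ be the subgroup of affine maps $\boldsymbol{x}\mapsto M\boldsymbol{x}+\boldsymbol{a}$ ($M\in\mathrm{GL}(2,K)$, $\boldsymbol{a}\in K^2$), $\mathcal{E}\subset\mathcal{G}$ the subgroup of elementary maps $x'=\alpha x+P(y),\ y'=\beta y+v$ ($P\in K[y]$, $\alpha,\beta,v\in K$, $\alpha\beta\neq0$), and $\mathcal{B}=\mathcal{A}\cap\mathcal{E}$. Every $g\in\mathcal{G}\setminus\mathcal{B}$ can be written as $g=g_n\circ\cdots\circ g_1$ with $n\ge1$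 and factors alternating between $\mathcal{A}\setminus\mathcal{B}$ and $\mathcal{E}\setminus\mathcal{B}$; $n$ depends only on $g$ and is called the length $\mathrm{len}(g)$; put $\mathrm{len}(g)=0$ for $g\in\mathcal{B}$. An element is cyclically reduced if its length is even and $>0$. A CR element is an element of $\mathcal{G}$ that is conjugate in $\mathcal{G}$ to a cyclically reduced element. In the claim, "any" means "every" (with $u,v$ allowed to depend on $\tilde f$). *)

theory Defs
  imports "HOL-Computational_Algebra.Polynomial" "HOL-Algebra.Group"
begin

section \<open>Polynomials in two variables\<close>

text \<open>
  \<open>K[x,y]\<close> is rendered as \<open>K[x][y]\<close>: the outer variable is \<open>y\<close>, and the
  coefficients are polynomials in \<open>x\<close>.
\<close>

type_synonym 'a poly2 = "'a poly poly"

definition cst :: "'a::field \<Rightarrow> 'a poly2" where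
  "cst k = [:[:k:]:]"

definition X :: "'a::field poly2" where
  "X = [:[:0, 1:]:]"

definition Y :: "'a::field poly2" where
  "Y = [:0, 1:]"

definition in_x :: "'a::field poly \<Rightarrow> 'a poly2 \<Rightarrow> 'a poly2" where
  "in_x p a = poly (map_poly cst p) a"

text \<open>\<open>subst2 p a b\<close> is \<open>p(a, b)\<close>, for polynomials \<open>a\<close> and \<open>b\<close>.\<close>

definition subst2 :: "'a::field poly2 \<Rightarrow> 'a poly2 \<Rightarrow> 'a poly2 \<Rightarrow> 'a poly2" where
  "subst2 p a b = poly (map_poly (\<lambda>c. in_x c a) p) b"

lemma cst_0 [simp]: "cst 0 = 0"
  and cst_1 [simp]: "cst 1 = 1"
  and cst_add: "cst (k + l) = cst k + cst l"
  and cst_mult: "cst (k * l) = cst k * cst l"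
  by (simp_all add: cst_def one_pCons)

lemma in_x_0 [simp]: "in_x 0 a = 0"
  by (simp add: in_x_def)

lemma in_x_1 [simp]: "in_x 1 a = 1"
  by (simp add: in_x_def)

lemma in_x_pCons [simp]: "in_x (pCons k p) a = cst k + a * in_x p a"
  by (simp add: in_x_def map_poly_pCons)

lemma in_x_add: "in_x (p + q) a = in_x p a + in_x q a"
  by (induction p q rule: poly_induct2) (simp_all add: cst_add algebra_simps)

lemma in_x_smult: "in_x (smult k p) a = cst k * in_x p a"
  by (induction p) (simp_all add: cst_mult algebra_simps)

lemma in_x_mult: "in_x (p * q) a = in_x p a * in_x q a"
  by (induction p) (simp_all add: in_x_add in_x_smult algebra_simps)

lemma subst2_0 [simp]: "subst2 0 a b = 0"
  by (simp add: subst2_def)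

lemma subst2_1 [simp]: "subst2 1 a b = 1"
  by (simp add: subst2_def)

lemma subst2_pCons [simp]: "subst2 (pCons c p) a b = in_x c a + b * subst2 p a b"
  by (simp add: subst2_def map_poly_pCons)

lemma subst2_cst [simp]: "subst2 (cst k) a b = cst k"
  by (simp add: cst_def[of k])

lemma subst2_X [simp]: "subst2 X a b = a"
  by (simp add: X_def)

lemma subst2_Y [simp]: "subst2 Y a b = b"
  by (simp add: Y_def)

lemma subst2_add: "subst2 (p + q) a b = subst2 p a b + subst2 q a b"
  by (induction p q rule: poly_induct2) (simp_all add: in_x_add algebra_simps)

lemma subst2_smult: "subst2 (smult c p) a b = in_x c a * subst2 p a b"
  by (induction p) (simp_all add: in_x_mult algebra_simps)

lemma subst2_mult: "subst2 (p * q) a b = subst2 p a b * subst2 q a b"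
  by (induction p) (simp_all add: subst2_add subst2_smult algebra_simps)

lemma subst2_in_x: "subst2 (in_x p a) c d = in_x p (subst2 a c d)"
  by (induction p) (simp_all add: subst2_add subst2_mult)

lemma subst2_subst2: "subst2 (subst2 p a b) c d = subst2 p (subst2 a c d) (subst2 b c d)"
  by (induction p) (simp_all add: subst2_add subst2_mult subst2_in_x)

lemma in_x_X: "in_x p X = [:p:]"
  by (induction p) (simp_all add: cst_def X_def)

lemma subst2_X_Y [simp]: "subst2 p X Y = p"
  by (induction p) (simp_all add: in_x_X Y_def)


section \<open>Polynomial automorphisms of the affine plane\<close>

text \<open>The pair \<open>(P, Q)\<close> is the formal map \<open>x' = P(x,y), y' = Q(x,y)\<close>.\<close>

type_synonym 'a pmap = "'a poly2 \<times> 'a poly2"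

definition pmap_comp :: "'a::field pmap \<Rightarrow> 'a pmap \<Rightarrow> 'a pmap" where
  "pmap_comp f g = (subst2 (fst f) (fst g) (snd g), subst2 (snd f) (fst g) (snd g))"

definition polynomial_maps :: "'a::field pmap monoid" where
  "polynomial_maps = \<lparr>carrier = UNIV, mult = pmap_comp, one = (X, Y)\<rparr>"

definition GA2 :: "'a::field pmap monoid" where
  "GA2 = units_of polynomial_maps"

lemma monoid_polynomial_maps: "monoid polynomial_maps"
  by (rule monoidI) (auto simp: polynomial_maps_def pmap_comp_def subst2_subst2)

lemma group_GA2: "group GA2"
  unfolding GA2_def by (rule monoid.units_group[OF monoid_polynomial_maps])

lemma mult_GA2: "f \<otimes>\<^bsub>GA2\<^esub> g = pmap_comp f g"
  by (simp add: GA2_def units_of_def polynomial_maps_def)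

lemma one_GA2: "\<one>\<^bsub>GA2\<^esub> = (X, Y)"
  by (simp add: GA2_def units_of_def polynomial_maps_def)

lemma carrier_GA2:
  "carrier GA2 = {f. \<exists>g. pmap_comp g f = (X, Y) \<and> pmap_comp f g = (X, Y)}"
  by (simp add: GA2_def units_of_def Units_def polynomial_maps_def)

definition commutes :: "'a::field pmap \<Rightarrow> 'a pmap \<Rightarrow> bool" where
  "commutes f g \<longleftrightarrow> f \<otimes>\<^bsub>GA2\<^esub> g = g \<otimes>\<^bsub>GA2\<^esub> f"

definition symmetry :: "'a::field pmap \<Rightarrow> 'a pmap \<Rightarrow> bool" where
  "symmetry f s \<longleftrightarrow> s \<in> carrier GA2 \<and> commutes s f"

definition involution :: "'a::field pmap \<Rightarrow> bool" where
  "involution s \<longleftrightarrow> s \<in> carrier GA2 \<and> s \<otimes>\<^bsub>GA2\<^esub> s = \<one>\<^bsub>GA2\<^esub> \<and> s \<noteq> \<one>\<^bsub>GA2\<^esub>"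

definition conjugate :: "'a::field pmap \<Rightarrow> 'a pmap \<Rightarrow> bool" where
  "conjugate f g \<longleftrightarrow> (\<exists>h\<in>carrier GA2. g = h \<otimes>\<^bsub>GA2\<^esub> f \<otimes>\<^bsub>GA2\<^esub> inv\<^bsub>GA2\<^esub> h)"


section \<open>Affine and elementary maps, length\<close>

definition affine_maps :: "'a::field pmap set" where
  "affine_maps = {(cst m11 * X + cst m12 * Y + cst a1, cst m21 * X + cst m22 * Y + cst a2)
     | m11 m12 m21 m22 a1 a2. m11 * m22 - m12 * m21 \<noteq> 0}"

text \<open>
  \<open>map_poly (\<lambda>k. [:k:]) p\<close> is \<open>p(y)\<close>, as only the outer variable occurs in it.
\<close>

definition elementary_maps :: "'a::field pmap set" where
  "elementary_maps = {(cst \<alpha> * X + map_poly (\<lambda>k. [:k:]) p, cst \<beta> * Y + cst v)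
     | \<alpha> \<beta> v p. \<alpha> * \<beta> \<noteq> 0}"

abbreviation base_maps :: "'a::field pmap set" where
  "base_maps \<equiv> affine_maps \<inter> elementary_maps"

text \<open>
  The list \<open>[g\<^sub>n, \<dots>, g\<^sub>1]\<close> stands for \<open>g\<^sub>n \<circ> \<dots> \<circ> g\<^sub>1\<close>.
\<close>

definition alternating :: "'a::field pmap list \<Rightarrow> bool" where
  "alternating gs \<longleftrightarrow>
     gs \<noteq> [] \<and>
     set gs \<subseteq> (affine_maps - base_maps) \<union> (elementary_maps - base_maps) \<and>
     successively (\<lambda>g h.
       g \<in> affine_maps - base_maps \<and> h \<in> elementary_maps - base_maps \<or>
       g \<in> elementary_maps - base_maps \<and> h \<in> affine_maps - base_maps) gs"

definition pmap_prod :: "'a::field pmap list \<Rightarrow> 'a pmap" where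
  "pmap_prod gs = foldr (mult GA2) gs \<one>\<^bsub>GA2\<^esub>"

definition len :: "'a::field pmap \<Rightarrow> nat" where
  "len g = (if g \<in> base_maps then 0
            else THE n. \<exists>gs. alternating gs \<and> pmap_prod gs = g \<and> length gs = n)"

definition cyclically_reduced :: "'a::field pmap \<Rightarrow> bool" where
  "cyclically_reduced g \<longleftrightarrow> g \<in> carrier GA2 \<and> even (len g) \<and> len g > 0"

definition CR :: "'a::field pmap \<Rightarrow> bool" where
  "CR f \<longleftrightarrow> f \<in> carrier GA2 \<and> (\<exists>g. cyclically_reduced g \<and> conjugate f g)"

definition point_reflection :: "'a::field \<Rightarrow> 'a \<Rightarrow> 'a pmap" where
  "point_reflection u v = (- X + cst u, - Y + cst v)"

end

theory Submission
  imports Defs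
begin

text \<open>
  The group is generated by the affine and the elementary maps (Jung--van der Kulk). For an
  automorphism \<open>(P, Q)\<close>, rewriting \<open>(P, Q + t)\<close> in the coordinates \<open>P, Q\<close> deforms the identity of
  \<open>K[x,y]\<close> and fixes \<open>P\<close>; its weighted leading part is a non-trivial pair \<open>x(t), y(t)\<close> fixing the
  leading form of \<open>P\<close>. Additivity of the degree in \<open>t\<close> forces that form to be \<open>c x\<^sup>r\<close>, \<open>c y\<^sup>r\<close> or
  \<open>c (x\<^sup>b - l y\<^sup>a)\<^sup>r\<close> with \<open>l\<close> in \<open>K\<close>, and differentiating \<open>x(t)\<^sup>b - l y(t)\<^sup>a = x\<^sup>b - l y\<^sup>a\<close> (in
  \<open>t\<close>, or in \<open>y\<close> or \<open>x\<close> if the characteristic divides \<open>b\<close> or \<open>a\<close>) yields \<open>a = 1\<close> or \<open>b = 1\<close>.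
  So an elementary map lowers the total degree of \<open>P\<close>.

  By counting lengths in the amalgamated product, an involution commuting with a cyclically
  reduced element lies in the intersection of the two subgroups, and so do its conjugates along the
  cyclic word. An elementary letter rules out the diagonal \<open>(-1, 1)\<close> of the linear part and an affine letter exchanges \<open>(-1, 1)\<close> and
  \<open>(1, -1)\<close>; as both kinds of letters occur, the linear part is \<open>-1\<close>.
\<close>

section \<open>Weighted degrees\<close>

text \<open>The obstacle is positive characteristic. The translation of Q to Q + t serves instead:
  in characteristic 0 it is the exponential of the locally nilpotent derivation that kills P, and it
  keeps its meaning over every field. K may also fail to be algebraically closed; the l of the
  binomial is found in K by passing to top coefficients in t, y and x in turn.

  Since \<open>len\<close> is a description operator, the theorem needs uniqueness of word lengths
  as well as generation: generation gives every automorphism a word, uniqueness makes its number of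
  letters the value of \<open>len\<close>. Uniqueness rests on one fact, read off from total
  degrees: an alternating product of positive length never falls into
  \<open>base_maps\<close>.\<close>

type_synonym 'a poly3 = "'a poly2 poly"

text \<open>The deformation parameter t is the outermost variable of \<open>poly3\<close>, over
  K[x,y]. Hence \<open>degree\<close> is the degree in t and \<open>coeff _ 0\<close> is the value
  at t = 0.\<close>

definition in_x3 :: "'a::field poly \<Rightarrow> 'a poly3 \<Rightarrow> 'a poly3" where
  "in_x3 p a = poly (map_poly (\<lambda>c. [:cst c:]) p) a"

definition subst3 :: "'a::field poly2 \<Rightarrow> 'a poly3 \<Rightarrow> 'a poly3 \<Rightarrow> 'a poly3" where
  "subst3 p a b = poly (map_poly (\<lambda>c. in_x3 c a) p) b"

lemma in_x3_0 [simp]: "in_x3 0 a = 0"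
  by (simp add: in_x3_def)

lemma in_x3_1 [simp]: "in_x3 1 a = 1"
  by (simp add: in_x3_def one_pCons[symmetric])

lemma in_x3_pCons [simp]: "in_x3 (pCons k p) a = [:cst k:] + a * in_x3 p a"
  by (simp add: in_x3_def map_poly_pCons)

lemma in_x3_add: "in_x3 (p + q) a = in_x3 p a + in_x3 q a"
  by (induction p q rule: poly_induct2) (simp_all add: cst_add algebra_simps)

lemma in_x3_smult: "in_x3 (smult k p) a = [:cst k:] * in_x3 p a"
  by (induction p) (simp_all add: cst_mult algebra_simps)

lemma in_x3_mult: "in_x3 (p * q) a = in_x3 p a * in_x3 q a"
  by (induction p) (simp_all add: in_x3_add in_x3_smult algebra_simps)

lemma subst3_0 [simp]: "subst3 0 a b = 0"
  by (simp add: subst3_def)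

lemma subst3_pCons [simp]: "subst3 (pCons c p) a b = in_x3 c a + b * subst3 p a b"
  by (simp add: subst3_def map_poly_pCons)

lemma subst3_cst [simp]: "subst3 (cst k) a b = [:cst k:]"
  by (simp add: cst_def[of k])

lemma subst3_1 [simp]: "subst3 1 a b = 1"
  using subst3_cst[of 1 a b] by (simp add: one_pCons)

lemma subst3_X [simp]: "subst3 X a b = a"
  by (simp add: X_def)

lemma subst3_Y [simp]: "subst3 Y a b = b"
  by (simp add: Y_def)

lemma subst3_add: "subst3 (p + q) a b = subst3 p a b + subst3 q a b"
  by (induction p q rule: poly_induct2) (simp_all add: in_x3_add algebra_simps)

lemma subst3_minus: "subst3 (- p) a b = - subst3 p a b"
  using subst3_add[of p "- p" a b] by (simp add: eq_neg_iff_add_eq_0 add.commute)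

lemma subst3_diff: "subst3 (p - q) a b = subst3 p a b - subst3 q a b"
  using subst3_add[of p "- q" a b] by (simp add: subst3_minus)

lemma subst3_smult: "subst3 (smult c p) a b = in_x3 c a * subst3 p a b"
  by (induction p) (simp_all add: in_x3_mult algebra_simps)

lemma subst3_mult: "subst3 (p * q) a b = subst3 p a b * subst3 q a b"
  by (induction p) (simp_all add: subst3_add subst3_smult algebra_simps)

lemma subst3_power: "subst3 (p ^ n) a b = subst3 p a b ^ n"
  by (induction n) (simp_all add: subst3_mult)

lemma subst3_sum: "subst3 (sum f A) a b = (\<Sum>i\<in>A. subst3 (f i) a b)"
  by (induction A rule: infinite_finite_induct) (simp_all add: subst3_add)

lemma subst3_in_x: "subst3 (in_x p a) c d = in_x3 p (subst3 a c d)"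
  by (induction p) (simp_all add: subst3_add subst3_mult)

lemma subst3_subst2:
  "subst3 (subst2 p a b) c d = subst3 p (subst3 a c d) (subst3 b c d)"
  by (induction p) (simp_all add: subst3_add subst3_mult subst3_in_x)

lemma in_x3_const: "in_x3 p [:a:] = [:in_x p a:]"
  by (induction p) simp_all

lemma subst3_const: "subst3 p [:a:] [:b:] = [:subst2 p a b:]"
  by (induction p) (simp_all add: in_x3_const)

lemma coeff_0_in_x3: "coeff (in_x3 p a) 0 = in_x p (coeff a 0)"
  by (induction p) (simp_all add: coeff_mult)

lemma coeff_0_subst3: "coeff (subst3 p a b) 0 = subst2 p (coeff a 0) (coeff b 0)"
  by (induction p) (simp_all add: coeff_0_in_x3 coeff_mult)

lemma subst2_minus: "subst2 (- p) a b = - subst2 p a b"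
  using subst2_add[of p "- p" a b] by (simp add: eq_neg_iff_add_eq_0 add.commute)

lemma subst2_diff: "subst2 (p - q) a b = subst2 p a b - subst2 q a b"
  using subst2_add[of p "- q" a b] by (simp add: subst2_minus)

lemma subst2_power: "subst2 (p ^ n) a b = subst2 p a b ^ n"
  by (induction n) (simp_all add: subst2_mult)

text \<open>The arguments i, j, l are the exponents of x, y, t.\<close>

definition coeff3 :: "'a::field poly3 \<Rightarrow> nat \<Rightarrow> nat \<Rightarrow> nat \<Rightarrow> 'a" where
  "coeff3 f i j l = coeff (coeff (coeff f l) j) i"

lemma coeff3_add [simp]: "coeff3 (f + g) i j l = coeff3 f i j l + coeff3 g i j l"
  and coeff3_diff [simp]: "coeff3 (f - g) i j l = coeff3 f i j l - coeff3 g i j l"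
  and coeff3_0 [simp]: "coeff3 0 i j l = 0"
  by (simp_all add: coeff3_def)

lemma poly3_eqI: "(\<And>i j l. coeff3 f i j l = coeff3 g i j l) \<Longrightarrow> f = g"
  by (simp add: coeff3_def poly_eq_iff)

lemma coeff_mult_neq_0E:
  assumes "coeff (p * q) n \<noteq> 0"
  obtains k l where "n = k + l" "coeff p k * coeff q l \<noteq> 0"
proof -
  from assms have "(\<Sum>i\<le>n. coeff p i * coeff q (n - i)) \<noteq> 0"
    by (simp add: coeff_mult)
  then obtain k where "k \<le> n" "coeff p k * coeff q (n - k) \<noteq> 0"
    by (meson atMost_iff sum.not_neutral_contains_not_neutral)
  with that[of k "n - k"] show thesis
    by simp
qed

lemma coeff3_mult_neq_0E:
  assumes "coeff3 (f * g) i j l \<noteq> 0"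
  obtains i1 j1 l1 i2 j2 l2 where "i = i1 + i2" "j = j1 + j2" "l = l1 + l2"
    "coeff3 f i1 j1 l1 \<noteq> 0" "coeff3 g i2 j2 l2 \<noteq> 0"
proof -
  from assms have "coeff (f * g) l \<noteq> 0"
    by (auto simp: coeff3_def)
  have "\<exists>l1 l2. l = l1 + l2 \<and> coeff (coeff (coeff f l1 * coeff g l2) j) i \<noteq> 0"
  proof (rule ccontr)
    assume "\<not> ?thesis"
    then have "coeff (coeff (\<Sum>k\<le>l. coeff f k * coeff g (l - k)) j) i = 0"
      by (simp add: coeff_sum)
    with assms show False
      by (simp add: coeff3_def coeff_mult)
  qed
  then obtain l1 l2 where l: "l = l1 + l2" "coeff (coeff (coeff f l1 * coeff g l2) j) i \<noteq> 0"
    by blast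
  have "\<exists>j1 j2. j = j1 + j2 \<and> coeff (coeff (coeff f l1) j1 * coeff (coeff g l2) j2) i \<noteq> 0"
  proof (rule ccontr)
    assume "\<not> ?thesis"
    then have "coeff (\<Sum>k\<le>j. coeff (coeff f l1) k * coeff (coeff g l2) (j - k)) i = 0"
      by (simp add: coeff_sum)
    with l show False
      by (simp add: coeff_mult)
  qed
  then obtain j1 j2 where j: "j = j1 + j2"
      "coeff (coeff (coeff f l1) j1 * coeff (coeff g l2) j2) i \<noteq> 0"
    by blast
  from j(2) obtain i1 i2 where "i = i1 + i2"
      "coeff (coeff (coeff f l1) j1) i1 * coeff (coeff (coeff g l2) j2) i2 \<noteq> 0"
    by (rule coeff_mult_neq_0E)
  with l j that show thesis
    by (simp add: coeff3_def)
qed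

text \<open>With \<open>R\<close> being \<open>(\<le>)\<close> this is the filtration by weighted degree, with \<open>(=)\<close> the grading.\<close>

definition weight3 :: "(int \<Rightarrow> int \<Rightarrow> bool) \<Rightarrow> int \<Rightarrow> int \<Rightarrow> int \<Rightarrow> int \<Rightarrow> 'a::field poly3 \<Rightarrow> bool" where
  "weight3 R a b c n f \<longleftrightarrow>
     (\<forall>i j l. coeff3 f i j l \<noteq> 0 \<longrightarrow> R (a * int i + b * int j + c * int l) n)"

definition weight2 :: "(int \<Rightarrow> int \<Rightarrow> bool) \<Rightarrow> int \<Rightarrow> int \<Rightarrow> int \<Rightarrow> 'a::field poly2 \<Rightarrow> bool" where
  "weight2 R a b n f \<longleftrightarrow> (\<forall>i j. coeff (coeff f j) i \<noteq> 0 \<longrightarrow> R (a * int i + b * int j) n)"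

lemma weight3_0 [simp]: "weight3 R a b c n 0"
  by (simp add: weight3_def)

lemma weight3_add: "weight3 R a b c n f \<Longrightarrow> weight3 R a b c n g \<Longrightarrow> weight3 R a b c n (f + g)"
  unfolding weight3_def by (metis add.right_neutral add_0 coeff3_add)

lemma weight3_diff: "weight3 R a b c n f \<Longrightarrow> weight3 R a b c n g \<Longrightarrow> weight3 R a b c n (f - g)"
  unfolding weight3_def by (metis diff_self coeff3_diff diff_0_right)

lemma weight3_mult:
  assumes R: "\<And>k l m n. R k m \<Longrightarrow> R l n \<Longrightarrow> R (k + l) (m + n)"
    and f: "weight3 R a b c m f" and g: "weight3 R a b c n g"
  shows "weight3 R a b c (m + n) (f * g)"
  unfolding weight3_def
proof (intro allI impI)
  fix i j l
  assume "coeff3 (f * g) i j l \<noteq> 0"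
  then obtain i1 j1 l1 i2 j2 l2 where e: "i = i1 + i2" "j = j1 + j2" "l = l1 + l2"
    "coeff3 f i1 j1 l1 \<noteq> 0" "coeff3 g i2 j2 l2 \<noteq> 0"
    by (rule coeff3_mult_neq_0E)
  then have "R ((a * int i1 + b * int j1 + c * int l1) + (a * int i2 + b * int j2 + c * int l2)) (m + n)"
    using R f g by (auto simp: weight3_def)
  then show "R (a * int i + b * int j + c * int l) (m + n)"
    by (simp add: e algebra_simps)
qed

lemma weight3_const: "weight3 R a b c n [:f:] \<longleftrightarrow> weight2 R a b n f"
  by (auto simp: weight3_def weight2_def coeff3_def coeff_pCons split: nat.splits)

lemma weight2_cst: "R 0 n \<Longrightarrow> weight2 R a b n (cst k)"
  by (auto simp: weight2_def cst_def coeff_pCons split: nat.splits)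

lemma weight3_mono: "weight3 (\<le>) a b c m f \<Longrightarrow> m \<le> n \<Longrightarrow> weight3 (\<le>) a b c n f"
  by (force simp: weight3_def)

lemma weight2_mono: "weight2 (\<le>) a b m f \<Longrightarrow> m \<le> n \<Longrightarrow> weight2 (\<le>) a b n f"
  by (force simp: weight2_def)

lemma weight3_eq_imp_le: "weight3 (=) a b c n f \<Longrightarrow> weight3 (\<le>) a b c n f"
  by (auto simp: weight3_def)

lemma weight3_eq_0: "weight3 (=) a b c n f \<Longrightarrow> weight3 (\<le>) a b c (n - 1) f \<Longrightarrow> f = 0"
  by (rule poly3_eqI) (force simp: weight3_def)

lemma weight2_pConsD:
  assumes "weight2 R a b n (pCons c p)" and R: "\<And>k l m. R (k + l) m \<longleftrightarrow> R k (m - l)"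
  shows "weight2 R a b n [:c:]" "weight2 R a b (n - b) p"
proof -
  have "R (a * int i + b * int j) n" if "coeff (coeff [:c:] j) i \<noteq> 0" for i j
    using assms(1)[unfolded weight2_def, rule_format, of j i] that
    by (cases j) auto
  then show "weight2 R a b n [:c:]"
    by (simp add: weight2_def)
  have "R (a * int i + b * int j) (n - b)" if "coeff (coeff p j) i \<noteq> 0" for i j
    using assms(1)[unfolded weight2_def, rule_format, of "Suc j" i] that
    by (simp add: R[symmetric] algebra_simps)
  then show "weight2 R a b (n - b) p"
    by (simp add: weight2_def)
qed

lemma weight2_const_pConsD:
  assumes "weight2 R a b n [:pCons k c:]" and R: "\<And>k l m. R (k + l) m \<longleftrightarrow> R k (m - l)"
  shows "k \<noteq> 0 \<Longrightarrow> R 0 n" "weight2 R a b (n - a) [:c:]"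
proof -
  show "R 0 n" if "k \<noteq> 0"
    using assms(1)[unfolded weight2_def, rule_format, of 0 0] that by simp
  have "R (a * int i + b * int j) (n - a)" if "coeff (coeff [:c:] j) i \<noteq> 0" for i j
    using assms(1)[unfolded weight2_def, rule_format, of j "Suc i"] that
    by (cases j) (simp_all add: R[symmetric] algebra_simps)
  then show "weight2 R a b (n - a) [:c:]"
    by (simp add: weight2_def)
qed

text \<open>The conditions on R, additivity and shift, hold for both \<le> and =, so one induction
  serves the filtration and the grading.\<close>

lemma weight3_subst3:
  assumes R: "\<And>k l m n. R k m \<Longrightarrow> R l n \<Longrightarrow> R (k + l) (m + n)" "\<And>k l m. R (k + l) m \<longleftrightarrow> R k (m - l)"
    and u: "weight3 R a b c d u" and v: "weight3 R a b c e v"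
    and p: "weight2 R d e n p"
  shows "weight3 R a b c n (subst3 p u v)"
proof -
  have *: "weight3 R a b c n (in_x3 q u)" if "weight2 R d e n [:q:]" for q n
    using that
  proof (induction q arbitrary: n)
    case (pCons k q)
    have "weight3 R a b c n [:cst k:]"
      using weight2_const_pConsD(1)[OF pCons.prems R(2)]
      by (cases "k = 0") (simp_all add: weight3_const weight2_cst)
    moreover have "weight3 R a b c (d + (n - d)) (u * in_x3 q u)"
      by (rule weight3_mult[OF R(1) u pCons.IH[OF weight2_const_pConsD(2)[OF pCons.prems R(2)]]])
    ultimately show ?case
      by (simp add: weight3_add)
  qed simp
  from p show ?thesis
  proof (induction p arbitrary: n)
    case (pCons q p)
    have "weight3 R a b c n (in_x3 q u)"
      by (rule *[OF weight2_pConsD(1)[OF pCons.prems R(2)]])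
    moreover have "weight3 R a b c (e + (n - e)) (v * subst3 p u v)"
      by (rule weight3_mult[OF R(1) v pCons.IH[OF weight2_pConsD(2)[OF pCons.prems R(2)]]])
    ultimately show ?case
      by (simp add: weight3_add)
  qed simp
qed

lemma weight3_subst3_le:
  "weight3 (\<le>) a b c d u \<Longrightarrow> weight3 (\<le>) a b c e v \<Longrightarrow> weight2 (\<le>) d e n p
    \<Longrightarrow> weight3 (\<le>) a b c n (subst3 p u v)"
  by (rule weight3_subst3) auto

lemma weight3_subst3_eq:
  "weight3 (=) a b c d u \<Longrightarrow> weight3 (=) a b c e v \<Longrightarrow> weight2 (=) d e n p
    \<Longrightarrow> weight3 (=) a b c n (subst3 p u v)"
  by (rule weight3_subst3) auto

text \<open>f g - f' g' = (f - f') g + f' (g - g'): errors below the leading weight stay below it in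
  products.\<close>

lemma weight3_mult_cong:
  assumes "weight3 (\<le>) a b c m f'" "weight3 (\<le>) a b c n g"
    and "weight3 (\<le>) a b c (m - 1) (f - f')" "weight3 (\<le>) a b c (n - 1) (g - g')"
  shows "weight3 (\<le>) a b c (m + n - 1) (f * g - f' * g')"
proof -
  have "weight3 (\<le>) a b c ((m - 1) + n) ((f - f') * g)" "weight3 (\<le>) a b c (m + (n - 1)) (f' * (g - g'))"
    using assms by (intro weight3_mult; simp)+
  from weight3_add[OF this[THEN weight3_mono[where n = "m + n - 1"]]] show ?thesis
    by (simp add: algebra_simps)
qed

text \<open>With leading parts of u and v as u' and v', a substitution is known up to lower weight
  from the leading parts alone.\<close>

lemma weight3_subst3_cong:
  assumes u: "weight3 (\<le>) a b c d u" "weight3 (\<le>) a b c d u'" "weight3 (\<le>) a b c (d - 1) (u - u')"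
    and v: "weight3 (\<le>) a b c e v" "weight3 (\<le>) a b c e v'" "weight3 (\<le>) a b c (e - 1) (v - v')"
    and p: "weight2 (\<le>) d e n p"
  shows "weight3 (\<le>) a b c (n - 1) (subst3 p u v - subst3 p u' v')"
proof -
  have R: "k + l \<le> m \<longleftrightarrow> k \<le> m - l" for k l m :: int
    by linarith
  have sub: "weight3 (\<le>) a b c n (in_x3 q u)" if "weight2 (\<le>) d e n [:q:]" for q n
    using weight3_subst3_le[OF u(1) v(1) that] by simp
  have *: "weight3 (\<le>) a b c (n - 1) (in_x3 q u - in_x3 q u')" if "weight2 (\<le>) d e n [:q:]" for q n
    using that
  proof (induction q arbitrary: n)
    case (pCons k q)
    note q = weight2_const_pConsD(2)[OF pCons.prems R]
    have "weight3 (\<le>) a b c (d + (n - d) - 1) (u * in_x3 q u - u' * in_x3 q u')"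
      by (rule weight3_mult_cong[OF u(2) sub[OF q] u(3) pCons.IH[OF q]])
    then show ?case
      by simp
  qed simp
  from p show ?thesis
  proof (induction p arbitrary: n)
    case (pCons q p)
    note p = weight2_pConsD(2)[OF pCons.prems R]
    have "weight3 (\<le>) a b c (n - 1) (in_x3 q u - in_x3 q u')"
      by (rule *[OF weight2_pConsD(1)[OF pCons.prems R]])
    moreover have "weight3 (\<le>) a b c (e + (n - e) - 1) (v * subst3 p u v - v' * subst3 p u' v')"
      by (rule weight3_mult_cong[OF v(2) weight3_subst3_le[OF u(1) v(1) p] v(3) pCons.IH[OF p]])
    ultimately have "weight3 (\<le>) a b c (n - 1) ((in_x3 q u - in_x3 q u') + (v * subst3 p u v - v' * subst3 p u' v'))"
      by (simp add: weight3_add)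
    then show ?case
      by (simp add: algebra_simps)
  qed simp
qed

text \<open>Unlike \<open>map_poly\<close>, it lets the new coefficient depend on the exponent.
  Nested three times it cuts a homogeneous component out of K[x,y,t].\<close>

definition pfilter :: "(nat \<Rightarrow> 'a \<Rightarrow> 'b) \<Rightarrow> 'a::zero poly \<Rightarrow> 'b::comm_monoid_add poly" where
  "pfilter g p = (\<Sum>i\<le>degree p. monom (g i (coeff p i)) i)"

lemma coeff_pfilter:
  assumes "\<And>i. g i 0 = 0"
  shows "coeff (pfilter g p) i = g i (coeff p i)"
  by (simp add: pfilter_def coeff_sum sum.delta' coeff_eq_0 assms)

definition top3 :: "int \<Rightarrow> int \<Rightarrow> int \<Rightarrow> int \<Rightarrow> 'a::field poly3 \<Rightarrow> 'a poly3" where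
  "top3 a b c n = pfilter (\<lambda>l. pfilter (\<lambda>j. pfilter (\<lambda>i k.
     if a * int i + b * int j + c * int l = n then k else 0)))"

lemma coeff3_top3:
  "coeff3 (top3 a b c n f) i j l = (if a * int i + b * int j + c * int l = n then coeff3 f i j l else 0)"
proof -
  have z: "pfilter g 0 = 0" if "\<And>i. g i 0 = 0" for g :: "nat \<Rightarrow> 'x::zero \<Rightarrow> 'y::comm_monoid_add"
    by (simp add: poly_eq_iff coeff_pfilter that)
  show ?thesis
    by (simp add: coeff3_def top3_def coeff_pfilter z)
qed

lemma weight3_top3: "weight3 (=) a b c n (top3 a b c n f)"
  by (simp add: weight3_def coeff3_top3)

lemma weight3_diff_top3: "weight3 (\<le>) a b c n f \<Longrightarrow> weight3 (\<le>) a b c (n - 1) (f - top3 a b c n f)"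
  by (auto simp: weight3_def coeff3_top3 order_less_le)

definition top2 :: "int \<Rightarrow> int \<Rightarrow> int \<Rightarrow> 'a::field poly2 \<Rightarrow> 'a poly2" where
  "top2 a b n f = coeff (top3 a b 0 n [:f:]) 0"

lemma coeff_top2:
  "coeff (coeff (top2 a b n f) j) i = (if a * int i + b * int j = n then coeff (coeff f j) i else 0)"
  using coeff3_top3[of a b 0 n "[:f:]" i j 0] by (simp add: coeff3_def top2_def)

lemma weight2_top2: "weight2 (=) a b n (top2 a b n f)"
  by (simp add: weight2_def coeff_top2)

lemma weight2_diff_top2: "weight2 (\<le>) a b n f \<Longrightarrow> weight2 (\<le>) a b (n - 1) (f - top2 a b n f)"
  by (auto simp: weight2_def coeff_top2 order_less_le)

section \<open>Binary forms and a degree inequality\<close>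

text \<open>The homogenisation of g to degree n, evaluated at (u, v); \<kappa> carries the
  coefficients into the ring of u and v.\<close>

definition binary_form :: "('a::zero \<Rightarrow> 'b::comm_semiring_1) \<Rightarrow> nat \<Rightarrow> 'a poly \<Rightarrow> 'b \<Rightarrow> 'b \<Rightarrow> 'b" where
  "binary_form \<kappa> n g u v = (\<Sum>i\<le>n. \<kappa> (coeff g i) * (u ^ i * v ^ (n - i)))"

lemma binary_form_linear_mult:
  fixes \<kappa> :: "'a::comm_ring_1 \<Rightarrow> 'b::comm_ring_1"
  assumes add: "\<And>a b. \<kappa> (a - b) = \<kappa> a - \<kappa> b" and mult: "\<And>a b. \<kappa> (a * b) = \<kappa> a * \<kappa> b"
    and g: "degree g \<le> n"
  shows "binary_form \<kappa> (Suc n) ([:- r, 1:] * g) u v = (u - \<kappa> r * v) * binary_form \<kappa> n g u v"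
proof -
  have 0: "\<kappa> 0 = 0"
    using add[of 0 0] by simp
  have "\<kappa> (coeff ([:- r, 1:] * g) i) = \<kappa> (coeff (pCons 0 g) i) - \<kappa> r * \<kappa> (coeff g i)" for i
    by (simp add: mult[symmetric] add[symmetric])
  then have "binary_form \<kappa> (Suc n) ([:- r, 1:] * g) u v =
      (\<Sum>i\<le>Suc n. \<kappa> (coeff (pCons 0 g) i) * (u ^ i * v ^ (Suc n - i)))
      - (\<Sum>i\<le>Suc n. \<kappa> r * \<kappa> (coeff g i) * (u ^ i * v ^ (Suc n - i)))"
    by (simp only: binary_form_def left_diff_distrib sum_subtractf)
  also have "(\<Sum>i\<le>Suc n. \<kappa> (coeff (pCons 0 g) i) * (u ^ i * v ^ (Suc n - i))) = u * binary_form \<kappa> n g u v"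
    unfolding sum.atMost_Suc_shift
    by (simp add: 0 binary_form_def sum_distrib_left mult_ac)
  also have "(\<Sum>i\<le>Suc n. \<kappa> r * \<kappa> (coeff g i) * (u ^ i * v ^ (Suc n - i))) = \<kappa> r * v * binary_form \<kappa> n g u v"
    using g by (simp add: 0 coeff_eq_0 binary_form_def sum_distrib_left)
      (intro sum.cong; simp add: Suc_diff_le mult_ac)
  finally show ?thesis
    by (simp add: algebra_simps)
qed

text \<open>As m and n are only bounds, u and v of different degrees can be read off at one common
  degree.\<close>

lemma coeff_mult_bound:
  fixes p q :: "'a::comm_ring_1 poly"
  assumes "degree p \<le> m" "degree q \<le> n"
  shows "coeff (p * q) (m + n) = coeff p m * coeff q n"
proof -
  have "coeff p i * coeff q (m + n - i) = (if i = m then coeff p m * coeff q n else 0)" for i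
    using assms by (cases i m rule: linorder_cases) (simp_all add: coeff_eq_0)
  then show ?thesis
    by (simp add: coeff_mult)
qed

lemma coeff_power_bound:
  fixes p :: "'a::idom poly"
  assumes "degree p \<le> m"
  shows "coeff (p ^ k) (k * m) = coeff p m ^ k \<and> degree (p ^ k) \<le> k * m"
proof (induction k)
  case (Suc k)
  then show ?case
    using coeff_mult_bound[OF assms, of "p ^ k" "k * m"] degree_mult_le[of p "p ^ k"] assms
    by simp
qed simp

lemma coeff_binary_form:
  fixes u v :: "'b::idom poly"
  assumes "degree u \<le> m" "degree v \<le> m"
  shows "coeff (binary_form (\<lambda>c. [:\<kappa> c:]) n g u v) (n * m) = binary_form \<kappa> n g (coeff u m) (coeff v m)"
proof -
  have "coeff (u ^ i * v ^ (n - i)) (n * m) = coeff u m ^ i * coeff v m ^ (n - i)" if "i \<le> n" for i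
    using coeff_mult_bound[of "u ^ i" "i * m" "v ^ (n - i)" "(n - i) * m"]
      coeff_power_bound[OF assms(1), of i] coeff_power_bound[OF assms(2), of "n - i"] that
    by (simp add: add_mult_distrib[symmetric])
  then show ?thesis
    by (simp add: binary_form_def coeff_sum)
qed

text \<open>The coefficient in the hypothesis is the form at the coefficients of u and v at the
  larger of the two degrees, and one of these is nonzero because the maximum is attained. This peels
  off one polynomial variable.\<close>

lemma binary_form_lead_coeffs:
  fixes u v :: "'b::idom poly"
  assumes "coeff (binary_form (\<lambda>c. [:\<kappa> c:]) n g u v) (n * max (degree u) (degree v)) = 0"
    and "u \<noteq> 0 \<or> v \<noteq> 0"
  shows "\<exists>u' v'. (u' \<noteq> 0 \<or> v' \<noteq> 0) \<and> binary_form \<kappa> n g u' v' = 0"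
proof (intro exI conjI)
  let ?m = "max (degree u) (degree v)"
  show "binary_form \<kappa> n g (coeff u ?m) (coeff v ?m) = 0"
    using assms(1) coeff_binary_form[of u ?m v \<kappa> n g] by simp
  show "coeff u ?m \<noteq> 0 \<or> coeff v ?m \<noteq> 0"
    using assms(2) by (metis degree_0 leading_coeff_neq_0 max_0L max_0R max_def)
qed

text \<open>Peeling off t, y and x leads to a nontrivial zero of the form in K itself. As the end
  coefficients of g are nonzero, neither coordinate of that zero vanishes, and their quotient is the
  root.\<close>

lemma binary_form_root:
  fixes u v :: "'a::field poly3"
  assumes g: "degree g = n" "n > 0" "coeff g 0 \<noteq> 0"
    and deg: "degree (binary_form (\<lambda>c. [:cst c:]) n g u v) = 0"
    and uv: "degree u > 0 \<or> degree v > 0"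
  shows "\<exists>r. r \<noteq> 0 \<and> poly g r = 0"
proof -
  \<comment> \<open>The form is constant in t while n times the maximal degree is positive. The two
    later peelings start from a form that is 0 outright.\<close>
  have "coeff (binary_form (\<lambda>c. [:cst c:]) n g u v) (n * max (degree u) (degree v)) = 0"
    using deg uv g by (intro coeff_eq_0) auto
  moreover have "u \<noteq> 0 \<or> v \<noteq> 0"
    using uv by auto
  ultimately have "\<exists>u v. (u \<noteq> 0 \<or> v \<noteq> 0) \<and> binary_form cst n g u v = 0"
    by (rule binary_form_lead_coeffs)
  then obtain u2 v2 where 2: "u2 \<noteq> 0 \<or> v2 \<noteq> 0" "binary_form (\<lambda>c. [:[:c:]:]) n g u2 v2 = 0"
    by (auto simp: cst_def[abs_def])
  have "\<exists>u v. (u \<noteq> 0 \<or> v \<noteq> 0) \<and> binary_form (\<lambda>c. [:c:]) n g u v = 0"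
    by (rule binary_form_lead_coeffs[OF _ 2(1)]) (simp add: 2)
  then obtain u1 v1 where 1: "u1 \<noteq> 0 \<or> v1 \<noteq> 0" "binary_form (\<lambda>c. [:c:]) n g u1 v1 = 0"
    by blast
  have "\<exists>u v. (u \<noteq> 0 \<or> v \<noteq> 0) \<and> binary_form (\<lambda>c. c) n g u v = 0"
    by (rule binary_form_lead_coeffs[OF _ 1(1)]) (simp add: 1)
  then obtain u0 v0 where 0: "u0 \<noteq> 0 \<or> v0 \<noteq> 0" "binary_form (\<lambda>c. c) n g u0 v0 = 0"
    by blast
  have g': "coeff g n \<noteq> 0"
    using g by auto
  have v0: "v0 \<noteq> 0"
  proof
    assume "v0 = 0"
    then have "binary_form (\<lambda>c. c) n g u0 v0 = (\<Sum>i\<le>n. if i = n then coeff g n * u0 ^ n else 0)"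
      unfolding binary_form_def by (intro sum.cong) auto
    with 0 \<open>v0 = 0\<close> g' show False
      by simp
  qed
  have u0: "u0 \<noteq> 0"
  proof
    assume "u0 = 0"
    then have "binary_form (\<lambda>c. c) n g u0 v0 = (\<Sum>i\<le>n. if i = 0 then coeff g 0 * v0 ^ n else 0)"
      unfolding binary_form_def by (intro sum.cong) auto
    with 0 \<open>u0 = 0\<close> g(3) show False
      by simp
  qed
  have "poly g (u0 / v0) * v0 ^ n = binary_form (\<lambda>c. c) n g u0 v0"
    unfolding binary_form_def poly_altdef g(1) sum_distrib_right
    by (intro sum.cong) (simp_all add: v0 power_divide power_diff)
  with 0 u0 v0 show ?thesis
    by (intro exI[of _ "u0 / v0"]) simp
qed

text \<open>Degrees in t add up, so every factor u - r v split off by a root is constant in t. Two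
  different roots would make both u and v constant in t.\<close>

lemma binary_form_const_imp_power:
  fixes u v :: "'a::field poly3"
  assumes "degree g = n" "n > 0" "coeff g 0 \<noteq> 0"
    and "binary_form (\<lambda>c. [:cst c:]) n g u v \<noteq> 0" "degree (binary_form (\<lambda>c. [:cst c:]) n g u v) = 0"
    and "degree u > 0 \<or> degree v > 0"
  shows "\<exists>c r. r \<noteq> 0 \<and> g = smult c ([:- r, 1:] ^ n) \<and> degree (u - [:cst r:] * v) = 0"
  using assms
proof (induction n arbitrary: g)
  case (Suc n)
  obtain r where r: "r \<noteq> 0" "poly g r = 0"
    using binary_form_root[OF Suc.prems(1-3,5,6)] by blast
  then obtain h where h: "g = [:- r, 1:] * h"
    by (auto simp: poly_eq_0_iff_dvd)
  have "h \<noteq> 0"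
    using h Suc.prems by auto
  then have dh: "degree h = n"
    using Suc.prems(1) degree_mult_eq[of "[:- r, 1:]" h] by (simp add: h del: mult_pCons_left)
  have ch: "coeff h 0 \<noteq> 0"
    using Suc.prems(3) h by auto
  have eq: "binary_form (\<lambda>c. [:cst c:]) (Suc n) g u v
      = (u - [:cst r:] * v) * binary_form (\<lambda>c. [:cst c:]) n h u v"
    unfolding h by (rule binary_form_linear_mult) (simp_all add: cst_mult dh, simp add: cst_def)
  then have nz: "u - [:cst r:] * v \<noteq> 0" "binary_form (\<lambda>c. [:cst c:]) n h u v \<noteq> 0"
    using Suc.prems(4) by auto
  then have d: "degree (u - [:cst r:] * v) = 0" "degree (binary_form (\<lambda>c. [:cst c:]) n h u v) = 0"
    using degree_mult_eq[OF nz] Suc.prems(5) eq by (metis add_is_0)+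
  show ?case
  proof (cases "n = 0")
    case True
    then obtain c where "h = [:c:]"
      using dh degree_eq_zeroE by blast
    then show ?thesis
      using r d True by (intro exI[of _ c] exI[of _ r]) (simp add: h)
  next
    case False
    then obtain c s where s: "h = smult c ([:- s, 1:] ^ n)" "degree (u - [:cst s:] * v) = 0"
      using Suc.IH[OF dh _ ch nz(2) d(2) Suc.prems(6)] by blast
    have "s = r"
    proof (rule ccontr)
      assume ne: "s \<noteq> r"
      have "degree ((u - [:cst s:] * v) - (u - [:cst r:] * v)) = 0"
        using degree_diff_le_max[of "u - [:cst s:] * v" "u - [:cst r:] * v"] s d by simp
      moreover have "(u - [:cst s:] * v) - (u - [:cst r:] * v) = [:cst (r - s):] * v"
        by (simp add: cst_def flip: smult_diff_left)
      ultimately have "degree v = 0"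
        using ne by (simp add: cst_def)
      moreover have "degree ((u - [:cst r:] * v) + [:cst r:] * v) = 0"
        using degree_add_le_max[of "u - [:cst r:] * v" "[:cst r:] * v"] d \<open>degree v = 0\<close>
          degree_smult_le[of "cst r" v] by simp
      ultimately show False
        using Suc.prems(6) by simp
    qed
    with s r d h show ?thesis
      by (intro exI[of _ c] exI[of _ r]) (simp del: mult_pCons_left)
  qed
qed simp

section \<open>Degree bounds of Davenport type in any characteristic\<close>

lemma pcompose_power: "pcompose (p ^ n) q = pcompose p q ^ n"
  for p q :: "'a::comm_semiring_1 poly"
  by (induction n) (simp_all add: pcompose_1 pcompose_mult)

text \<open>Only exponents divisible by the characteristic survive the hypothesis. In characteristic
  0 the inner monomial is 1, and the conclusion says that p is constant.\<close>

lemma pderiv_eq_0_imp_pcompose: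
  fixes p :: "'a::idom poly"
  assumes "pderiv p = 0"
  shows "\<exists>q. p = pcompose q (monom 1 CHAR('a))"
proof -
  have "\<exists>q. monom (coeff p j) j = pcompose q (monom 1 CHAR('a))" for j
  proof (cases "coeff p j = 0 \<or> j = 0")
    case True
    then show ?thesis
      by (intro exI[of _ "[:coeff p j:]"]) (auto simp: monom_0)
  next
    case False
    then obtain i where i: "j = Suc i"
      by (cases j) auto
    have "of_nat (Suc i) * coeff p (Suc i) = 0"
      using assms coeff_pderiv[of p i] by simp
    with False i have "CHAR('a) dvd j"
      by (simp only: mult_eq_0_iff of_nat_eq_0_iff_char_dvd) simp
    then obtain k where k: "j = CHAR('a) * k" ..
    have "monom (coeff p j) j = smult (coeff p j) (monom 1 CHAR('a) ^ k)"
      by (simp add: k monom_power smult_monom)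
    also have "\<dots> = pcompose (monom (coeff p j) k) (monom 1 CHAR('a))"
      by (simp add: monom_altdef[of _ k] pcompose_smult pcompose_power pcompose_pCons)
    finally show ?thesis ..
  qed
  then obtain f where f: "\<And>j. monom (coeff p j) j = pcompose (f j) (monom 1 CHAR('a))"
    by metis
  have "p = (\<Sum>j\<le>degree p. monom (coeff p j) j)"
    by (simp add: poly_as_sum_of_monoms)
  also have "\<dots> = pcompose (\<Sum>j\<le>degree p. f j) (monom 1 CHAR('a))"
    by (simp add: f pcompose_sum)
  finally show ?thesis ..
qed

lemma degree_pderiv_less:
  fixes p :: "'a::idom poly"
  assumes "pderiv p \<noteq> 0"
  shows "degree (pderiv p) < degree p"
proof -
  have "coeff p (Suc (degree (pderiv p))) \<noteq> 0"
    using assms coeff_pderiv[of p "degree (pderiv p)"] by auto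
  then show ?thesis
    using le_degree by fastforce
qed

text \<open>As in the Mason--Stothers theorem, eliminating x^b between the equation and its
  derivative gives h b x' = y^(a-1) (m b y x' - m a y' x). So y^(a-1) divides a nonzero multiple of
  x', whose degree is below that of x.\<close>

lemma davenport_degree:
  fixes x y :: "'a::idom poly"
  assumes eq: "smult l (x ^ b) + smult m (y ^ a) = [:h:]" and "h \<noteq> 0" "b > 0" "pderiv x \<noteq> 0"
    and char: "of_nat b \<noteq> (0::'a)" and l: "l \<noteq> 0"
  shows "(a - 1) * degree y < degree x"
proof (cases "a = 0 \<or> y = 0")
  case True
  have "degree x > 0"
    using degree_pderiv_less[OF \<open>pderiv x \<noteq> 0\<close>] by simp
  with True show ?thesis
    by auto
next
  case False
  then obtain k where k: "a = Suc k"
    by (cases a) auto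
  obtain j where j: "b = Suc j"
    using \<open>b > 0\<close> by (cases b) auto
  define x' y' where "x' = pderiv x" and "y' = pderiv y"
  have "pderiv (smult l (x ^ b) + smult m (y ^ a)) = 0"
    unfolding eq by (simp add: pderiv_pCons)
  then have "smult (l * of_nat b) (x ^ j * x') = - smult (m * of_nat a) (y ^ k * y')"
    by (simp add: pderiv_add pderiv_smult pderiv_power j k x'_def y'_def eq_neg_iff_add_eq_0
        del: of_nat_Suc power_Suc)
  then have *: "smult (l * of_nat b) (x ^ j * x') * x = - smult (m * of_nat a) (y ^ k * y') * x"
    by simp
  have "smult (h * of_nat b) x' = smult (of_nat b) ([:h:] * x')"
    by (simp add: mult.commute)
  also have "\<dots> = smult (l * of_nat b) (x ^ j * x') * x + smult (m * of_nat b) (y ^ a * x')"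
    unfolding eq[symmetric] j by (simp add: algebra_simps smult_add_right)
  also have "\<dots> = y ^ k * (smult (m * of_nat b) (y * x') - smult (m * of_nat a) (y' * x))"
    unfolding * k by (simp add: algebra_simps del: of_nat_Suc)
  finally have dvd: "smult (h * of_nat b) x' = y ^ k * (smult (m * of_nat b) (y * x') - smult (m * of_nat a) (y' * x))" .
  have nz: "smult (h * of_nat b) x' \<noteq> 0"
    using assms by (simp add: x'_def)
  have "k * degree y = degree (y ^ k)"
    using False by (simp add: degree_power_eq)
  also have "\<dots> \<le> degree (smult (h * of_nat b) x')"
    using nz unfolding dvd by (subst degree_mult_eq) auto
  also have "\<dots> \<le> degree x'"
    by (rule degree_smult_le)
  also have "\<dots> < degree x"
    unfolding x'_def by (rule degree_pderiv_less[OF \<open>pderiv x \<noteq> 0\<close>])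
  finally show ?thesis
    by (simp add: k)
qed

text \<open>The degree bound and its mirror image would give deg y < deg x < deg y. They need
  nonzero derivatives; if both vanish, x and y are polynomials in t^p, and replacing t^p by t gives
  a solution of smaller degrees.\<close>

lemma davenport:
  fixes x y :: "'a::idom poly"
  assumes "smult l (x ^ b) + smult m (y ^ a) = [:h:]" and h: "h \<noteq> 0"
    and ab: "a \<ge> 2" "b \<ge> 2" and char: "of_nat a \<noteq> (0::'a)" "of_nat b \<noteq> (0::'a)" and lm: "l \<noteq> 0" "m \<noteq> 0"
  shows "degree x = 0 \<and> degree y = 0"
  using assms(1)
proof (induction "degree x + degree y" arbitrary: x y rule: less_induct)
  case less
  have eq': "smult m (y ^ a) + smult l (x ^ b) = [:h:]"
    using less.prems by (simp add: add.commute)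
  have le: "k \<le> (n - 1) * k" if "n \<ge> 2" for n k :: nat
    using that by (cases n) auto
  show ?case
  proof (cases "pderiv x = 0 \<and> pderiv y = 0")
    case True
    show ?thesis
    proof (rule ccontr)
      assume nt: "\<not> ?thesis"
      obtain x1 y1 where 1: "x = pcompose x1 (monom 1 CHAR('a))" "y = pcompose y1 (monom 1 CHAR('a))"
        using True pderiv_eq_0_imp_pcompose by blast
      have deg: "degree x = degree x1 * CHAR('a)" "degree y = degree y1 * CHAR('a)"
        by (simp_all add: 1 degree_pcompose degree_monom_eq)
      with nt have c0: "CHAR('a) > 0"
        by (cases "CHAR('a) = 0") auto
      then have c1: "CHAR('a) \<ge> 2"
        using prime_CHAR_semidom[where ?'a = 'a] prime_ge_2_nat by auto
      \<comment> \<open>Composition with t^p is injective, as p > 0, so the equation passes to x1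
        and y1.\<close>
      have "pcompose (smult l (x1 ^ b) + smult m (y1 ^ a) - [:h:]) (monom 1 CHAR('a)) = 0"
        using less.prems by (simp add: 1 pcompose_add pcompose_diff pcompose_smult pcompose_power)
      then have "smult l (x1 ^ b) + smult m (y1 ^ a) - [:h:] = 0"
        by (rule pcompose_eq_0) (simp add: degree_monom_eq c0)
      then have e: "smult l (x1 ^ b) + smult m (y1 ^ a) = [:h:]"
        by simp
      have "degree x1 + degree y1 < degree x + degree y"
        using nt c1 unfolding deg by (cases "degree x1"; cases "degree y1"; cases "CHAR('a)") (auto simp: add_mult_distrib)
      from less.hyps[OF this e] nt deg show False
        by simp
    qed
  next
    case False
    \<comment> \<open>With these factors nonzero, the differentiated equation lets neither
      derivative vanish without the other.\<close>
    have "l * of_nat b \<noteq> 0" "m * of_nat a \<noteq> 0"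
      using lm char by auto
    moreover have "pderiv (smult l (x ^ b) + smult m (y ^ a)) = 0"
      unfolding less.prems by (simp add: pderiv_pCons)
    then have "smult (l * of_nat b) (x ^ (b - 1) * pderiv x) + smult (m * of_nat a) (y ^ (a - 1) * pderiv y) = 0"
      by (simp add: pderiv_add pderiv_smult pderiv_power)
    ultimately have "pderiv x \<noteq> 0 \<and> pderiv y \<noteq> 0"
      using False by auto
    then have "(a - 1) * degree y < degree x" "(b - 1) * degree x < degree y"
      using davenport_degree[OF less.prems h _ _ char(2) lm(1)] davenport_degree[OF eq' h _ _ char(1) lm(2)] ab
      by auto
    with le[OF ab(1), of "degree y"] le[OF ab(2), of "degree x"] show ?thesis
      by linarith
  qed
qed

section \<open>Leading forms fixed by a deformation\<close>

lemma derivation_power: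
  fixes d :: "'a::comm_ring_1 \<Rightarrow> 'a"
  assumes "\<And>p q. d (p * q) = d p * q + p * d q"
  shows "d (p ^ n) = of_nat n * p ^ (n - 1) * d p"
proof (induction n)
  case 0
  show ?case
    using assms[of 1 1] by simp
next
  case (Suc n)
  then show ?case
    by (cases n) (simp_all add: assms algebra_simps)
qed

text \<open>Coefficientwise extension to one more variable. It yields the x-derivative on K[x][y],
  and then derivations of K[x,y] acting on K[x,y][t] with t as a constant.\<close>

lemma map_poly_derivation:
  fixes d :: "'a::comm_ring_1 \<Rightarrow> 'a"
  assumes add: "\<And>p q. d (p + q) = d p + d q" and mult: "\<And>p q. d (p * q) = d p * q + p * d q"
  shows "map_poly d (p + q) = map_poly d p + map_poly d q"
    and "map_poly d (p * q) = map_poly d p * q + p * map_poly d q"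
proof -
  have d0: "d 0 = 0"
    using mult[of 0 0] by simp
  have d_sum: "d (sum f A) = (\<Sum>i\<in>A. d (f i))" for f :: "nat \<Rightarrow> 'a" and A
    by (induction A rule: infinite_finite_induct) (simp_all add: d0 add)
  show "map_poly d (p + q) = map_poly d p + map_poly d q"
    by (rule poly_eqI) (simp add: coeff_map_poly d0 add)
  show "map_poly d (p * q) = map_poly d p * q + p * map_poly d q"
    by (rule poly_eqI) (simp add: coeff_map_poly d0 coeff_mult d_sum mult sum.distrib)
qed

text \<open>A derivation of the coefficients kills x^b because b is 0 in the ring. What remains is m
  a y^(a-1) d(y) = d(h), nonzero and constant in t, so y and then x have degree 0.\<close>

lemma degree_eq_0_of_derivation:
  fixes x y :: "'a::idom poly"
  assumes add: "\<And>p q. d (p + q) = d p + d q" and mult: "\<And>p q. d (p * q) = d p * q + p * d q"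
    and eq: "smult l (x ^ b) + smult m (y ^ a) = [:h:]"
    and "d l = 0" "d m = 0" "d h \<noteq> 0" "of_nat b = (0::'a)" "a \<ge> 2" "b > 0" "l \<noteq> 0"
  shows "degree x = 0 \<and> degree y = 0"
proof -
  have d0: "d 0 = 0"
    using mult[of 0 0] by simp
  note D = map_poly_derivation[where d = d, OF add mult]
  have sm: "map_poly d (smult c p) = smult c (map_poly d p)" if "d c = 0" for c p
    by (rule poly_eqI) (simp add: coeff_map_poly d0 mult that)
  have "map_poly d (smult l (x ^ b) + smult m (y ^ a)) = [:d h:]"
    by (simp add: eq map_poly_pCons d0)
  moreover have "map_poly d (smult l (x ^ b) + smult m (y ^ a)) = smult (m * of_nat a) (y ^ (a - 1) * map_poly d y)"
    using \<open>d l = 0\<close> \<open>d m = 0\<close> \<open>of_nat b = 0\<close>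
    by (simp add: D(1) sm derivation_power[where d = "map_poly d", OF D(2)] of_nat_poly)
  ultimately have "smult (m * of_nat a) (y ^ (a - 1) * map_poly d y) = [:d h:]"
    by simp
  then have e: "y ^ (a - 1) * smult (m * of_nat a) (map_poly d y) = [:d h:]"
    by (simp add: mult_ac)
  then have "y ^ (a - 1) \<noteq> 0" "smult (m * of_nat a) (map_poly d y) \<noteq> 0"
    using \<open>d h \<noteq> 0\<close> by auto
  then have "degree (y ^ (a - 1)) = 0"
    using e degree_mult_eq by (metis add_is_0 degree_pCons_0)
  then have y: "degree y = 0"
    using \<open>a \<ge> 2\<close> \<open>y ^ (a - 1) \<noteq> 0\<close> by (subst (asm) degree_power_eq) auto
  have "smult l (x ^ b) = [:h:] - smult m (y ^ a)"
    using eq by (simp add: algebra_simps)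
  moreover have "degree ([:h:] - smult m (y ^ a)) = 0"
    using degree_diff_le_max[of "[:h:]" "smult m (y ^ a)"] degree_smult_le[of m "y ^ a"] degree_power_le[of y a] y
    by simp
  ultimately have "degree (x ^ b) = 0"
    using \<open>l \<noteq> 0\<close> by (metis degree_smult_eq)
  then have "degree x = 0"
    using \<open>b > 0\<close> by (cases "x = 0") (simp_all add: degree_power_eq)
  with y show ?thesis
    by simp
qed

lemma coeff_monomial2:
  "coeff (coeff (cst c * (X ^ i * Y ^ j)) j') i' = (if i' = i \<and> j' = j then c else 0)"
proof -
  have "X ^ i = [:monom (1::'a) i:]"
  proof (induction i)
    case (Suc i)
    have "[:0, 1:] * monom (1::'a) i = monom 1 (Suc i)"
      by (simp add: monom_Suc)
    with Suc show ?case
      by (simp add: X_def)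
  qed (simp add: one_pCons monom_0)
  moreover have "Y ^ j = monom (1 :: 'a poly) j"
    by (simp add: Y_def monom_altdef)
  ultimately have "cst c * (X ^ i * Y ^ j) = monom (monom c i) j"
    by (simp add: cst_def smult_monom)
  then show ?thesis
    by simp
qed

lemma cst_eq_0 [simp]: "cst c = 0 \<longleftrightarrow> c = 0"
  by (simp add: cst_def)

lemma cst_diff: "cst (a - b) = cst a - cst b"
  by (simp add: cst_def)

lemma cst_minus: "cst (- a) = - cst a"
  by (simp add: cst_def)

lemma X_neq_0 [simp]: "X \<noteq> 0" and Y_neq_0 [simp]: "Y \<noteq> 0"
  by (simp_all add: X_def Y_def)

text \<open>Coprimality keeps the characteristic from dividing both exponents. If it divides one,
  the partial derivative in the variable carrying the other exponent does not kill the right-hand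
  side.\<close>

lemma degree_eq_0_of_coprime:
  fixes x y :: "'a::field poly3"
  assumes eq: "smult (cst l) (x ^ b) + smult (cst m) (y ^ a) = [:cst l * X ^ b + cst m * Y ^ a:]"
    and lm: "l \<noteq> 0" "m \<noteq> 0" and ab: "coprime a b" "a \<ge> 2" "b \<ge> 2"
  shows "degree x = 0 \<and> degree y = 0"
proof -
  define h where "h = cst l * X ^ b + cst m * Y ^ a"
  have of_nat_0: "of_nat k = (0 :: 'a poly2) \<longleftrightarrow> of_nat k = (0 :: 'a)" for k
    by (simp add: of_nat_poly)
  \<comment> \<open>At (1, 0) the term with Y vanishes and l is left, so h \<noteq> 0.\<close>
  have "subst2 h 1 0 = cst l"
    using ab by (simp add: h_def subst2_add subst2_mult subst2_power power_0_left)
  then have h0: "h \<noteq> 0"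
    using lm by auto
  have not_both: "\<not> (CHAR('a) dvd a \<and> CHAR('a) dvd b)"
    using ab(1) CHAR_not_1[where ?'a = 'a] by (metis coprime_common_divisor_nat One_nat_def)
  have dY: "pderiv Y = 1" "pderiv X = 0" "pderiv (cst c) = 0" for c :: 'a
    by (simp_all add: X_def Y_def cst_def pderiv_pCons one_pCons)
  have dX: "map_poly pderiv Y = 0" "map_poly pderiv X = 1" "map_poly pderiv (cst c) = 0" for c :: 'a
    by (simp_all add: X_def Y_def cst_def pderiv_pCons one_pCons map_poly_pCons)
  have pm: "pderiv (p * q) = pderiv p * q + p * pderiv q" for p q :: "'b::idom poly"
    by (simp add: pderiv_mult algebra_simps)
  note D = map_poly_derivation[where d = "pderiv :: 'a poly \<Rightarrow> 'a poly", OF pderiv_add pm]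
  consider "of_nat a \<noteq> (0 :: 'a)" "of_nat b \<noteq> (0 :: 'a)" | "of_nat a \<noteq> (0 :: 'a)" "of_nat b = (0 :: 'a)"
    | "of_nat a = (0 :: 'a)" "of_nat b \<noteq> (0 :: 'a)"
    using not_both by (auto simp: of_nat_eq_0_iff_char_dvd)
  then show ?thesis
  proof cases
    case 1
    show ?thesis
      by (rule davenport[OF eq]) (use 1 h0 lm ab in \<open>simp_all add: h_def of_nat_0\<close>)
  next
    case 2
    have "pderiv h = cst m * (of_nat a * Y ^ (a - 1))"
      by (simp add: h_def pderiv_add pm pderiv_power dY of_nat_poly)
    then have "pderiv h \<noteq> 0"
      using 2 lm by (simp add: of_nat_0)
    then show ?thesis
      by (intro degree_eq_0_of_derivation[OF pderiv_add pm eq[folded h_def]])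
        (use 2 lm ab in \<open>simp_all add: dY of_nat_0\<close>)
  next
    case 3
    have "map_poly pderiv h = cst l * (of_nat b * X ^ (b - 1))"
      by (simp add: h_def D derivation_power[where d = "map_poly pderiv", OF D(2)] dX)
    then have "map_poly pderiv h \<noteq> 0"
      using 3 lm by (simp add: of_nat_0)
    moreover have eq': "smult (cst m) (y ^ a) + smult (cst l) (x ^ b) = [:h:]"
      using eq by (simp add: h_def add.commute)
    ultimately have "degree y = 0 \<and> degree x = 0"
      by (intro degree_eq_0_of_derivation[where d = "map_poly pderiv", OF D eq'])
        (use 3 lm ab in \<open>simp_all add: dX of_nat_0\<close>)
    then show ?thesis
      by simp
  qed
qed

text \<open>Exponent pairs on the line a i + b j = n with coprime a and b differ by multiples of (b,
  -a). Taking out the smallest powers of x and y leaves a form in X^b and Y^a; since the extreme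
  exponents occur, neither end coefficient of g vanishes.\<close>

lemma weight2_eq_decompose:
  assumes f: "weight2 (=) (int a) (int b) n f" "f \<noteq> 0" and ab: "coprime a b" "a > 0" "b > 0"
  shows "\<exists>i j k g. degree g = k \<and> coeff g 0 \<noteq> 0 \<and>
    f = X ^ i * Y ^ j * binary_form cst k g (X ^ b) (Y ^ a)"
proof -
  have w: "a * i + b * j = a * i' + b * j'"
    if "coeff (coeff f j) i \<noteq> 0" "coeff (coeff f j') i' \<noteq> 0" for i j i' j'
  proof -
    from f(1) that have "int a * int i + int b * int j = int a * int i' + int b * int j'"
      by (simp add: weight2_def)
    then show ?thesis
      by (simp flip: of_nat_mult of_nat_add)
  qed
  define S where "S = {i. \<exists>j. coeff (coeff f j) i \<noteq> 0}"
  have "S \<subseteq> (\<Union>j\<le>degree f. {..degree (coeff f j)})"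
    by (force simp: S_def intro: le_degree)
  then have finS: "finite S"
    by (rule finite_subset) auto
  obtain j i where "coeff (coeff f j) i \<noteq> 0"
    using f(2) by (metis coeff_0 poly_eqI)
  then have "S \<noteq> {}"
    by (auto simp: S_def)
  obtain jM where jM: "coeff (coeff f jM) (Min S) \<noteq> 0"
    using Min_in[OF finS \<open>S \<noteq> {}\<close>] by (auto simp: S_def)
  obtain jm where jm: "coeff (coeff f jm) (Max S) \<noteq> 0"
    using Max_in[OF finS \<open>S \<noteq> {}\<close>] by (auto simp: S_def)
  have param: "\<exists>k. i = Min S + b * k \<and> jM = j + a * k" if c: "coeff (coeff f j) i \<noteq> 0" for i j
  proof -
    have "Min S \<le> i"
      using c finS by (auto simp: S_def intro!: Min_le)
    then obtain d where d: "i = Min S + d"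
      using le_Suc_ex by blast
    with w[OF c jM] have e: "a * d + b * j = b * jM"
      by (simp add: algebra_simps)
    then have "b dvd a * d"
      by (metis dvd_add_left_iff dvd_triv_left)
    with ab(1) have "b dvd d"
      by (simp add: coprime_commute coprime_dvd_mult_right_iff)
    then obtain k where k: "d = b * k" ..
    with e have "b * (a * k + j) = b * jM"
      by (simp add: algebra_simps)
    with ab(3) have "a * k + j = jM"
      by simp
    with d k show ?thesis
      by auto
  qed
  obtain k where k: "Max S = Min S + b * k" "jM = jm + a * k"
    using param[OF jm] by blast
  \<comment> \<open>The index l counts steps of (b, -a) from the monomial with exponents (Min S,
    jM); its last value k leads to (Max S, jm).\<close>
  define g where "g = (\<Sum>l\<le>k. monom (coeff (coeff f (jm + a * (k - l))) (Min S + b * l)) l)"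
  have cg: "coeff g l = (if l \<le> k then coeff (coeff f (jm + a * (k - l))) (Min S + b * l) else 0)" for l
    by (simp add: g_def coeff_sum)
  have "degree g = k"
    using jm k by (intro antisym degree_le le_degree) (auto simp: cg)
  moreover have "coeff g 0 \<noteq> 0"
    using jM k by (simp add: cg)
  moreover have "f = X ^ Min S * Y ^ jm * binary_form cst k g (X ^ b) (Y ^ a)"
  proof (rule poly_eqI, rule poly_eqI)
    fix j i
    have "X ^ Min S * Y ^ jm * binary_form cst k g (X ^ b) (Y ^ a)
        = (\<Sum>l\<le>k. cst (coeff g l) * (X ^ (Min S + b * l) * Y ^ (jm + a * (k - l))))"
      by (simp add: binary_form_def sum_distrib_left power_add mult_ac flip: power_mult)
    then have r: "coeff (coeff (X ^ Min S * Y ^ jm * binary_form cst k g (X ^ b) (Y ^ a)) j) i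
        = (\<Sum>l\<le>k. if i = Min S + b * l \<and> j = jm + a * (k - l) then coeff g l else 0)"
      by (simp add: coeff_sum coeff_monomial2)
    show "coeff (coeff f j) i = coeff (coeff (X ^ Min S * Y ^ jm * binary_form cst k g (X ^ b) (Y ^ a)) j) i"
    proof (cases "\<exists>l\<le>k. i = Min S + b * l \<and> j = jm + a * (k - l)")
      case True
      then obtain l where l: "l \<le> k" "i = Min S + b * l" "j = jm + a * (k - l)"
        by blast
      have s: "(\<Sum>l'\<le>k. if i = Min S + b * l' \<and> j = jm + a * (k - l') then coeff g l' else 0)
          = (\<Sum>l'\<le>k. if l' = l then coeff g l else 0)"
        using l ab by (intro sum.cong) auto
      show ?thesis
        unfolding r s using l by (simp add: cg)
    next
      case False
      have "coeff (coeff f j) i = 0"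
      proof (rule ccontr)
        assume c: "coeff (coeff f j) i \<noteq> 0"
        then obtain l where l: "i = Min S + b * l" "jM = j + a * l"
          using param by blast
        have "i \<le> Max S"
          using c finS by (auto simp: S_def intro!: Max_ge)
        with l k ab have "l \<le> k"
          by simp
        moreover from this l k have "j = jm + a * (k - l)"
          by (simp add: diff_mult_distrib2)
        ultimately show False
          using False l by auto
      qed
      moreover have "(\<Sum>l\<le>k. if i = Min S + b * l \<and> j = jm + a * (k - l) then coeff g l else 0) = 0"
        using False by (intro sum.neutral) auto
      ultimately show ?thesis
        by (simp add: r)
    qed
  qed
  ultimately show ?thesis
    by blast
qed

lemma binary_form_power:
  "binary_form cst n (smult c ([:- r, 1:] ^ n)) u v = cst c * (u - cst r * v) ^ n"
proof (induction n)
  case 0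
  show ?case
    by (simp add: binary_form_def)
next
  case (Suc n)
  have "degree (smult c ([:- r, 1:] ^ n)) \<le> n"
    by (metis degree_smult_le degree_linear_power order_trans order_refl)
  from binary_form_linear_mult[of cst, OF cst_diff cst_mult this] Suc show ?case
    by (simp add: mult_ac del: mult_pCons_left mult_pCons_right)
qed

text \<open>After the decomposition of f, \<open>inv\<close> equates a product x^i y^j B with an
  element constant in t, so i > 0 makes x, and j > 0 makes y, constant in t. Not both are, which
  excludes mixed monomials; a binomial factor makes both depend on t, which excludes a monomial
  factor beside it.\<close>

lemma leading_form_shape:
  fixes f :: "'a::field poly2"
  assumes f: "f \<noteq> 0" "weight2 (=) (int a) (int b) n f" and ab: "coprime a b" "a > 0" "b > 0"
    and x: "coeff x 0 = X" and y: "coeff y 0 = Y" and xy: "degree x > 0 \<or> degree y > 0"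
    and inv: "subst3 f x y = [:f:]"
  shows "\<exists>c r. f = cst c * X ^ r \<or> f = cst c * Y ^ r \<or>
    r > 0 \<and> (a = 1 \<or> b = 1) \<and> (\<exists>l. l \<noteq> 0 \<and> f = cst c * (X ^ b - cst l * Y ^ a) ^ r)"
proof -
  obtain i j k g where g: "degree g = k" "coeff g 0 \<noteq> 0"
    and dec: "f = X ^ i * Y ^ j * binary_form cst k g (X ^ b) (Y ^ a)"
    using weight2_eq_decompose[OF f(2,1) ab] by blast
  define B where "B = binary_form (\<lambda>c. [:cst c:]) k g (x ^ b) (y ^ a)"
  have "subst3 f x y = x ^ i * y ^ j * B"
    by (simp add: B_def dec binary_form_def subst3_mult subst3_power subst3_sum)
  then have B: "x ^ i * y ^ j * B = [:f:]"
    using inv by simp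
  have nz: "x \<noteq> 0" "y \<noteq> 0" "B \<noteq> 0"
    using x y B f(1) by auto
  have "degree (x ^ i * y ^ j * B) = i * degree x + j * degree y + degree B"
    using nz by (simp add: degree_mult_eq degree_power_eq)
  then have deg: "i * degree x = 0" "j * degree y = 0" "degree B = 0"
    using B by simp_all
  show ?thesis
  proof (cases "k = 0")
    case True
    then have "f = cst (coeff g 0) * (X ^ i * Y ^ j)"
      by (simp add: dec binary_form_def mult_ac)
    moreover have "i = 0 \<or> j = 0"
      using deg xy by auto
    ultimately show ?thesis
      by (elim disjE) (rule exI[of _ "coeff g 0"], rule exI[of _ j], simp,
        rule exI[of _ "coeff g 0"], rule exI[of _ i], simp)
  next
    case False
    have uv: "degree (x ^ b) > 0 \<or> degree (y ^ a) > 0"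
      using xy nz ab by (auto simp: degree_power_eq)
    obtain c r where r: "r \<noteq> 0" "g = smult c ([:- r, 1:] ^ k)" "degree (x ^ b - [:cst r:] * y ^ a) = 0"
      using binary_form_const_imp_power[OF g(1) _ g(2) _ _ uv] False nz(3) deg(3) by (auto simp: B_def)
    have sm: "degree (smult (cst r) (y ^ a)) = a * degree y"
      using r nz by (simp add: degree_power_eq)
    \<comment> \<open>x^b and r y^a differ by a constant in t, and r \<noteq> 0, so x depends on t
      exactly when y does.\<close>
    have both: "degree x > 0 \<and> degree y > 0"
    proof (rule ccontr)
      assume n: "\<not> ?thesis"
      have "degree x = 0 \<longleftrightarrow> degree y = 0"
      proof
        assume "degree x = 0"
        then have "degree (x ^ b) = 0"
          using degree_power_le[of x b] by simp
        then have "degree (x ^ b - (x ^ b - [:cst r:] * y ^ a)) = 0"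
          using degree_diff_le_max[of "x ^ b" "x ^ b - [:cst r:] * y ^ a"] r(3) by simp
        then show "degree y = 0"
          using sm ab by simp
      next
        assume "degree y = 0"
        then have "degree ([:cst r:] * y ^ a) = 0"
          using sm by simp
        then have "degree ((x ^ b - [:cst r:] * y ^ a) + [:cst r:] * y ^ a) = 0"
          using degree_add_le_max[of "x ^ b - [:cst r:] * y ^ a" "[:cst r:] * y ^ a"] r(3) by simp
        then show "degree x = 0"
          using nz ab by (simp add: degree_power_eq)
      qed
      with n xy show False
        by auto
    qed
    with deg have "i = 0" "j = 0"
      by auto
    then have fr: "f = cst c * (X ^ b - cst r * Y ^ a) ^ k"
      by (simp add: dec r(2) binary_form_power)
    obtain h where h: "x ^ b - [:cst r:] * y ^ a = [:h:]"
      using r(3) degree_eq_zeroE by blast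
    \<comment> \<open>Setting t = 0 identifies the constant h as the undeformed binomial.\<close>
    have "coeff (x ^ b - [:cst r:] * y ^ a) 0 = X ^ b - cst r * Y ^ a"
      by (simp add: coeff_0_power x y)
    with h have "h = X ^ b - cst r * Y ^ a"
      by simp
    with h have "smult (cst 1) (x ^ b) + smult (cst (- r)) (y ^ a) = [:cst 1 * X ^ b + cst (- r) * Y ^ a:]"
      by (simp add: cst_minus)
    from degree_eq_0_of_coprime[OF this] r(1) ab both have "a = 1 \<or> b = 1"
      by (cases "a \<ge> 2"; cases "b \<ge> 2") auto
    with fr r(1) False show ?thesis
      by blast
  qed
qed

section \<open>Deforming the identity\<close>

text \<open>The largest quotient e / l, cross-multiplied to stay among the integers. It provides the
  weight of t below and later an edge of a Newton polygon.\<close>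

lemma finite_ratio_max:
  fixes S :: "(int \<times> nat) set"
  assumes "finite S" "S \<noteq> {}" "\<And>e l. (e, l) \<in> S \<Longrightarrow> l > 0"
  shows "\<exists>(e0, l0)\<in>S. \<forall>(e, l)\<in>S. e * int l0 \<le> e0 * int l"
proof -
  define q where "q = (\<lambda>(e, l). rat_of_int e / rat_of_nat l)"
  have "Max (q ` S) \<in> q ` S"
    using assms by (intro Max_in) auto
  then obtain e0 l0 where 0: "(e0, l0) \<in> S" "q (e0, l0) = Max (q ` S)"
    by auto
  have "e * int l0 \<le> e0 * int l" if "(e, l) \<in> S" for e l
  proof -
    have "q (e, l) \<le> q (e0, l0)"
      unfolding 0(2) using that assms(1) by (intro Max_ge) auto
    then have "rat_of_int (e * int l0) \<le> rat_of_int (e0 * int l)"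
      using assms(3)[OF 0(1)] assms(3)[OF that] by (simp add: q_def field_simps)
    then show ?thesis
      by (simp only: of_int_le_iff)
  qed
  with 0 show ?thesis
    by blast
qed

lemma coeff_X: "coeff (coeff X j) i = (if i = 1 \<and> j = 0 then 1 else 0)"
  and coeff_Y: "coeff (coeff Y j) i = (if i = 0 \<and> j = 1 then 1 else 0)"
  using coeff_monomial2[of 1 1 0 j i] coeff_monomial2[of 1 0 1 j i] by simp_all

lemma finite_coeff3: "finite {(i, j, l). coeff3 f i j l \<noteq> 0}"
proof (rule finite_subset)
  show "{(i, j, l). coeff3 f i j l \<noteq> 0} \<subseteq>
    (\<Union>l\<le>degree f. \<Union>j\<le>degree (coeff f l). {..degree (coeff (coeff f l) j)} \<times> {j} \<times> {l})"
    by (force simp: coeff3_def intro: le_degree)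
qed auto

text \<open>The automorphism \<open>(P, Q + t)\<close>, written in the coordinates \<open>P\<close>, \<open>Q\<close>, is a deformation of the
  identity that fixes \<open>P\<close>; giving \<open>t\<close> the least weight for which it respects weighted degrees, its
  leading part is still non-trivial and fixes the leading form of \<open>P\<close>.\<close>

lemma leading_form_deformation:
  fixes P Q p q :: "'a::field poly2"
  assumes inv: "subst2 p P Q = X" "subst2 q P Q = Y" "subst2 P p q = X" "subst2 Q p q = Y"
    and P: "weight2 (\<le>) (int a) (int b) n P"
  shows "\<exists>x y. coeff x 0 = X \<and> coeff y 0 = Y \<and> (degree x > 0 \<or> degree y > 0) \<and>
    subst3 (top2 (int a) (int b) n P) x y = [:top2 (int a) (int b) n P:]"
proof -
  define \<xi> where "\<xi> = subst3 p [:P:] [:Q, 1:]"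
  define \<eta> where "\<eta> = subst3 q [:P:] [:Q, 1:]"
  have c0: "coeff \<xi> 0 = X" "coeff \<eta> 0 = Y"
    by (simp_all add: \<xi>_def \<eta>_def coeff_0_subst3 inv)
  have fix_P: "subst3 P \<xi> \<eta> = [:P:]" and move_Q: "subst3 Q \<xi> \<eta> = [:Q, 1:]"
    by (simp_all add: \<xi>_def \<eta>_def inv flip: subst3_subst2)
  \<comment> \<open>For a monomial x^i y^j t^l of \<xi> (of \<eta>), e is the excess of its weight
    in x and y over the weight a of x (b of y).\<close>
  define S1 where "S1 = (\<lambda>(i, j, l). (int a * int i + int b * int j - int a, l)) ` {(i, j, l). coeff3 \<xi> i j l \<noteq> 0}"
  define S2 where "S2 = (\<lambda>(i, j, l). (int a * int i + int b * int j - int b, l)) ` {(i, j, l). coeff3 \<eta> i j l \<noteq> 0}"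
  have S1_mem: "(int a * int i + int b * int j - int a, l) \<in> S1" if "coeff3 \<xi> i j l \<noteq> 0" for i j l
    unfolding S1_def by (rule image_eqI[of _ _ "(i, j, l)"]) (use that in simp_all)
  have S2_mem: "(int a * int i + int b * int j - int b, l) \<in> S2" if "coeff3 \<eta> i j l \<noteq> 0" for i j l
    unfolding S2_def by (rule image_eqI[of _ _ "(i, j, l)"]) (use that in simp_all)
  define S where "S = {(e, l) \<in> S1 \<union> S2. l > 0}"
  have "finite S1" "finite S2"
    unfolding S1_def S2_def by (intro finite_imageI finite_coeff3)+
  then have "finite S"
    unfolding S_def by (rule finite_subset[rotated, OF finite_UnI]) auto
  \<comment> \<open>Otherwise the deformation would not depend on t, although it carries Q to Q +
    t.\<close>
  moreover have "S \<noteq> {}"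
  proof
    assume S: "S = {}"
    have "coeff \<xi> l = 0 \<and> coeff \<eta> l = 0" if "l > 0" for l
    proof -
      have "coeff3 \<xi> i j l = 0" for i j
        using S that S1_mem[of i j l] by (auto simp: S_def)
      moreover have "coeff3 \<eta> i j l = 0" for i j
        using S that S2_mem[of i j l] by (auto simp: S_def)
      ultimately show ?thesis
        by (simp add: coeff3_def poly_eq_iff[of "coeff _ _"] poly_eq_iff[of "coeff (coeff _ _) _"])
    qed
    then have "coeff \<xi> l = coeff [:X:] l" "coeff \<eta> l = coeff [:Y:] l" for l
      using c0 by (cases l; simp)+
    then have "\<xi> = [:X:]" "\<eta> = [:Y:]"
      by (simp_all add: poly_eqI)
    with move_Q show False
      by (simp add: subst3_const)
  qed
  moreover have "l > 0" if "(e, l) \<in> S" for e l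
    using that by (simp add: S_def)
  ultimately have "\<exists>(e0, l0)\<in>S. \<forall>(e, l)\<in>S. e * int l0 \<le> e0 * int l"
    by (rule finite_ratio_max)
  then obtain e0 l0 where el: "(e0, l0) \<in> S"
    and max: "\<And>e l. (e, l) \<in> S \<Longrightarrow> e * int l0 \<le> e0 * int l"
    by fast
  have l0: "l0 > 0"
    using el by (simp add: S_def)
  \<comment> \<open>With weight -e0 / l0 for t, no monomial of \<xi> exceeds the weight of x and
    none of \<eta> that of y, and equality is attained at t^l0 in one of them. All weights are
    multiplied by l0 to be integers.\<close>
  define A where "A = int a * int l0"
  define B where "B = int b * int l0"
  have w\<xi>: "weight3 (\<le>) A B (- e0) A \<xi>"
    unfolding weight3_def
  proof (intro allI impI)
    fix i j l
    assume *: "coeff3 \<xi> i j l \<noteq> 0"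
    show "A * int i + B * int j + - e0 * int l \<le> A"
    proof (cases "l = 0")
      case True
      with * c0 show ?thesis
        by (auto simp: coeff3_def coeff_X split: if_splits)
    next
      case False
      with * have "(int a * int i + int b * int j - int a, l) \<in> S"
        using S1_mem by (simp add: S_def)
      from max[OF this] show ?thesis
        by (simp add: A_def B_def algebra_simps)
    qed
  qed
  have w\<eta>: "weight3 (\<le>) A B (- e0) B \<eta>"
    unfolding weight3_def
  proof (intro allI impI)
    fix i j l
    assume *: "coeff3 \<eta> i j l \<noteq> 0"
    show "A * int i + B * int j + - e0 * int l \<le> B"
    proof (cases "l = 0")
      case True
      with * c0 show ?thesis
        by (auto simp: coeff3_def coeff_Y split: if_splits)
    next
      case False
      with * have "(int a * int i + int b * int j - int b, l) \<in> S"
        using S2_mem by (simp add: S_def)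
      from max[OF this] show ?thesis
        by (simp add: A_def B_def algebra_simps)
    qed
  qed
  define x where "x = top3 A B (- e0) A \<xi>"
  define y where "y = top3 A B (- e0) B \<eta>"
  define T where "T = top2 (int a) (int b) n P"
  define N where "N = n * int l0"
  note w_x = weight3_top3[of A B "- e0" A \<xi>, folded x_def]
  note w_y = weight3_top3[of A B "- e0" B \<eta>, folded y_def]
  have x0: "coeff x 0 = X"
  proof (rule poly_eqI, rule poly_eqI)
    fix j i
    show "coeff (coeff (coeff x 0) j) i = coeff (coeff X j) i"
      using coeff3_top3[of A B "- e0" A \<xi> i j 0] c0
      by (auto simp: x_def coeff3_def coeff_X)
  qed
  have y0: "coeff y 0 = Y"
  proof (rule poly_eqI, rule poly_eqI)
    fix j i
    show "coeff (coeff (coeff y 0) j) i = coeff (coeff Y j) i"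
      using coeff3_top3[of A B "- e0" B \<eta> i j 0] c0
      by (auto simp: y_def coeff3_def coeff_Y)
  qed
  have nontriv: "degree x > 0 \<or> degree y > 0"
  proof -
    have deg: "degree f > 0" if "coeff3 f i j l0 \<noteq> 0" for f :: "'a poly3" and i j
    proof -
      from that have "coeff f l0 \<noteq> 0"
        by (auto simp: coeff3_def)
      then have "l0 \<le> degree f"
        by (rule le_degree)
      with l0 show ?thesis
        by simp
    qed
    from el consider "(e0, l0) \<in> S1" | "(e0, l0) \<in> S2"
      by (auto simp: S_def)
    then show ?thesis
    proof cases
      case 1
      then obtain i j where ij: "coeff3 \<xi> i j l0 \<noteq> 0" "e0 = int a * int i + int b * int j - int a"
        by (auto simp: S1_def)
      have "A * int i + B * int j + - e0 * int l0 = A"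
        unfolding ij(2) by (simp add: A_def B_def algebra_simps)
      with ij(1) have "coeff3 x i j l0 \<noteq> 0"
        by (simp add: x_def coeff3_top3)
      with deg[of x i j] show ?thesis
        by simp
    next
      case 2
      then obtain i j where ij: "coeff3 \<eta> i j l0 \<noteq> 0" "e0 = int a * int i + int b * int j - int b"
        by (auto simp: S2_def)
      have "A * int i + B * int j + - e0 * int l0 = B"
        unfolding ij(2) by (simp add: A_def B_def algebra_simps)
      with ij(1) have "coeff3 y i j l0 \<noteq> 0"
        by (simp add: y_def coeff3_top3)
      with deg[of y i j] show ?thesis
        by simp
    qed
  qed
  have scale: "weight2 (\<le>) A B (m * int l0) f" if "weight2 (\<le>) (int a) (int b) m f" for m f
    unfolding weight2_def
  proof (intro allI impI)
    fix i j
    assume "coeff (coeff f j) i \<noteq> 0"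
    with that have "int a * int i + int b * int j \<le> m"
      by (simp add: weight2_def)
    then have "(int a * int i + int b * int j) * int l0 \<le> m * int l0"
      by (rule mult_right_mono) simp
    then show "A * int i + B * int j \<le> m * int l0"
      by (simp add: A_def B_def algebra_simps)
  qed
  have PT: "weight2 (\<le>) A B (N - 1) (P - T)"
  proof (rule weight2_mono)
    show "weight2 (\<le>) A B ((n - 1) * int l0) (P - T)"
      unfolding T_def by (intro scale weight2_diff_top2 P)
    show "(n - 1) * int l0 \<le> N - 1"
      using l0 by (simp add: N_def algebra_simps)
  qed
  have T_eq: "weight2 (=) A B N T"
    unfolding weight2_def
  proof (intro allI impI)
    fix i j
    assume "coeff (coeff T j) i \<noteq> 0"
    then have "int a * int i + int b * int j = n"
      by (auto simp: T_def coeff_top2 split: if_splits)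
    then show "A * int i + B * int j = N"
      by (auto simp: A_def B_def N_def algebra_simps)
  qed
  \<comment> \<open>P is fixed exactly. Replacing \<xi>, \<eta> by their leading parts and P by T
    changes the equation only below weight N, so the defect \<open>subst3 T x y - [:T:]\<close> has
    weight at most N - 1.\<close>
  have "weight3 (\<le>) A B (- e0) (N - 1) (subst3 P \<xi> \<eta> - subst3 P x y)"
    unfolding N_def x_def y_def
    by (rule weight3_subst3_cong[OF w\<xi> weight3_eq_imp_le[OF weight3_top3] weight3_diff_top3[OF w\<xi>]
          w\<eta> weight3_eq_imp_le[OF weight3_top3] weight3_diff_top3[OF w\<eta>] scale[OF P]])
  moreover have "weight3 (\<le>) A B (- e0) (N - 1) (subst3 (P - T) x y)"
    by (rule weight3_subst3_le[OF weight3_eq_imp_le[OF w_x] weight3_eq_imp_le[OF w_y] PT])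
  moreover have "weight3 (\<le>) A B (- e0) (N - 1) [:P - T:]"
    using PT by (simp add: weight3_const)
  ultimately have "weight3 (\<le>) A B (- e0) (N - 1)
      ([:P - T:] - ((subst3 P \<xi> \<eta> - subst3 P x y) + subst3 (P - T) x y))"
    by (blast intro: weight3_diff weight3_add)
  moreover have "[:P - T:] - ((subst3 P \<xi> \<eta> - subst3 P x y) + subst3 (P - T) x y) = subst3 T x y - [:T:]"
  proof -
    have "[:P - T:] = [:P:] - [:T:]"
      by simp
    then show ?thesis
      by (simp only: fix_P subst3_diff) (simp only: algebra_simps diff_self add_0 add_0_right)
  qed
  ultimately have "weight3 (\<le>) A B (- e0) (N - 1) (subst3 T x y - [:T:])"
    by simp
  \<comment> \<open>As T, x and y are homogeneous, the defect is also homogeneous of weight N, hence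
    0.\<close>
  moreover have "weight3 (=) A B (- e0) N (subst3 T x y - [:T:])"
    using T_eq by (intro weight3_diff weight3_subst3_eq[OF w_x w_y]) (simp_all add: weight3_const)
  ultimately have "subst3 T x y - [:T:] = 0"
    by (intro weight3_eq_0)
  then have "subst3 T x y = [:T:]"
    by simp
  with x0 y0 nontriv show ?thesis
    unfolding T_def by blast
qed

section \<open>Affine and elementary maps\<close>

lemma map_poly_const_eq_in_x: "map_poly (\<lambda>k. [:k:]) p = in_x p Y"
  by (induction p) (simp_all add: map_poly_pCons cst_def Y_def)

lemma in_x_pcompose: "in_x (pcompose p [:c, d:]) a = in_x p (cst c + cst d * a)"
  by (induction p) (simp_all add: pcompose_pCons in_x_add in_x_smult algebra_simps)

lemma degree_in_x: "degree (in_x p a) = degree p * degree a"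
proof (cases "degree a = 0")
  case True
  then obtain c where "a = [:c:]"
    by (rule degree_eq_zeroE)
  moreover have "\<exists>d. in_x p [:c:] = [:d:]" for c
    by (induction p) (auto simp: cst_def)
  ultimately show ?thesis
    using True by (metis degree_pCons_0 mult_0_right)
next
  case False
  show ?thesis
  proof (induction p)
    case (pCons k p)
    show ?case
    proof (cases "p = 0")
      case True
      then show ?thesis
        by (simp add: cst_def)
    next
      case nz: False
      have "in_x p a \<noteq> 0"
      proof (cases "degree p = 0")
        case True
        then obtain c where "p = [:c:]"
          by (rule degree_eq_zeroE)
        with nz show ?thesis
          by simp
      next
        case pos: False
        with pCons.IH False show ?thesis
          by auto
      qed
      then have "degree (a * in_x p a) = degree a + degree p * degree a"
        using False pCons.IH by (subst degree_mult_eq) auto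
      moreover from this False have "degree (cst k) < degree (a * in_x p a)"
        by (simp add: cst_def)
      ultimately show ?thesis
        using nz by (simp add: degree_add_eq_right)
    qed
  qed simp
qed

lemma weight2_subst2:
  assumes "weight2 R d e n p" "weight2 R d e d u" "weight2 R d e e v"
    and "\<And>k l m n. R k m \<Longrightarrow> R l n \<Longrightarrow> R (k + l) (m + n)" "\<And>k l m. R (k + l) m \<longleftrightarrow> R k (m - l)"
  shows "weight2 R d e n (subst2 p u v)"
  using weight3_subst3[of R d e 0 d "[:u:]" e "[:v:]" n p] assms
  by (simp add: weight3_const subst3_const)

lemma weight2_top2_subst2:
  assumes "weight2 (\<le>) d e n p" "weight2 (\<le>) d e d u" "weight2 (\<le>) d e e v"
  shows "weight2 (\<le>) d e (n - 1) (subst2 p u v - subst2 (top2 d e n p) u v)"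
  unfolding subst2_diff[symmetric]
  by (rule weight2_subst2[OF weight2_diff_top2]) (use assms in auto)

lemma weight2_top2_eq_0:
  assumes "weight2 (\<le>) d e n p" "top2 d e n p = 0"
  shows "weight2 (\<le>) d e (n - 1) p"
  using weight2_diff_top2[OF assms(1)] assms(2) by simp

section \<open>The subgroups of affine and elementary maps and what they generate\<close>

definition tame :: "'a::field pmap \<Rightarrow> bool" where
  "tame f \<longleftrightarrow> (\<exists>gs. set gs \<subseteq> affine_maps \<union> elementary_maps \<and> pmap_prod gs = f)"

interpretation GA2: group GA2
  by (rule group_GA2)

lemma elementaryI: "\<alpha> \<noteq> 0 \<Longrightarrow> \<beta> \<noteq> 0 \<Longrightarrow> (cst \<alpha> * X + in_x p Y, cst \<beta> * Y + cst v) \<in> elementary_maps"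
  unfolding elementary_maps_def map_poly_const_eq_in_x by auto

lemma elementaryE:
  assumes "f \<in> elementary_maps"
  obtains \<alpha> \<beta> p v where "\<alpha> \<noteq> 0" "\<beta> \<noteq> 0" "f = (cst \<alpha> * X + in_x p Y, cst \<beta> * Y + cst v)"
  using assms unfolding elementary_maps_def map_poly_const_eq_in_x by auto

lemma affineI:
  "m11 * m22 - m12 * m21 \<noteq> 0 \<Longrightarrow>
    (cst m11 * X + cst m12 * Y + cst a1, cst m21 * X + cst m22 * Y + cst a2) \<in> affine_maps"
  unfolding affine_maps_def by blast

lemma affineE:
  assumes "f \<in> affine_maps"
  obtains m11 m12 m21 m22 a1 a2 where "m11 * m22 - m12 * m21 \<noteq> 0"
    "f = (cst m11 * X + cst m12 * Y + cst a1, cst m21 * X + cst m22 * Y + cst a2)"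
  using assms unfolding affine_maps_def by blast

lemma pmap_comp_elementary:
  "pmap_comp (cst \<alpha> * X + in_x p Y, cst \<beta> * Y + cst v) (cst \<alpha>' * X + in_x p' Y, cst \<beta>' * Y + cst v')
    = (cst (\<alpha> * \<alpha>') * X + in_x (smult \<alpha> p' + pcompose p [:v', \<beta>':]) Y,
       cst (\<beta> * \<beta>') * Y + cst (\<beta> * v' + v))"
  by (simp add: pmap_comp_def subst2_add subst2_mult subst2_in_x in_x_pcompose in_x_add in_x_smult
      cst_add cst_mult algebra_simps)

lemma pmap_comp_affine:
  "pmap_comp (cst m11 * X + cst m12 * Y + cst a1, cst m21 * X + cst m22 * Y + cst a2)
     (cst n11 * X + cst n12 * Y + cst b1, cst n21 * X + cst n22 * Y + cst b2)
   = (cst (m11 * n11 + m12 * n21) * X + cst (m11 * n12 + m12 * n22) * Y + cst (m11 * b1 + m12 * b2 + a1),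
      cst (m21 * n11 + m22 * n21) * X + cst (m21 * n12 + m22 * n22) * Y + cst (m21 * b1 + m22 * b2 + a2))"
  by (simp add: pmap_comp_def subst2_add subst2_mult cst_add cst_mult algebra_simps)

lemma pmap_comp_assoc: "pmap_comp (pmap_comp f g) h = pmap_comp f (pmap_comp g h)"
  by (simp add: pmap_comp_def subst2_subst2)

lemma pmap_comp_one [simp]: "pmap_comp (X, Y) f = f" "pmap_comp f (X, Y) = f"
  by (simp_all add: pmap_comp_def)

text \<open>A right inverse in H has a right inverse itself and is therefore two-sided; this also
  places H inside the carrier.\<close>

lemma subgroup_GA2I:
  assumes "H \<noteq> {}" and mult: "\<And>f g. f \<in> H \<Longrightarrow> g \<in> H \<Longrightarrow> pmap_comp f g \<in> H"
    and inv: "\<And>f. f \<in> H \<Longrightarrow> \<exists>g\<in>H. pmap_comp f g = (X, Y)"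
  shows "subgroup H GA2"
proof -
  have inv': "\<exists>g\<in>H. pmap_comp f g = (X, Y) \<and> pmap_comp g f = (X, Y)" if f: "f \<in> H" for f
  proof -
    obtain g where g: "g \<in> H" "pmap_comp f g = (X, Y)"
      using inv[OF f] by blast
    obtain h where h: "pmap_comp g h = (X, Y)"
      using inv[OF g(1)] by blast
    have "f = pmap_comp (pmap_comp f g) h"
      by (simp only: pmap_comp_assoc h pmap_comp_one)
    with g h show ?thesis
      by auto
  qed
  have sub: "H \<subseteq> carrier GA2"
    unfolding carrier_GA2 using inv' by fast
  show ?thesis
  proof (rule GA2.subgroupI)
    show "inv\<^bsub>GA2\<^esub> f \<in> H" if f: "f \<in> H" for f
    proof -
      obtain g where g: "g \<in> H" "pmap_comp g f = (X, Y)"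
        using inv'[OF f] by blast
      then have "inv\<^bsub>GA2\<^esub> f = g"
        using sub f by (intro GA2.inv_equality) (auto simp: mult_GA2 one_GA2)
      with g show ?thesis
        by simp
    qed
  qed (use assms sub in \<open>auto simp: mult_GA2\<close>)
qed

lemma subgroup_elementary: "subgroup (elementary_maps :: 'a::field pmap set) GA2"
proof (rule subgroup_GA2I)
  show "(elementary_maps :: 'a pmap set) \<noteq> {}"
    using elementaryI[of "1 :: 'a" 1 0 0] by (intro notI) simp
next
  fix f g :: "'a pmap"
  assume "f \<in> elementary_maps" "g \<in> elementary_maps"
  then show "pmap_comp f g \<in> elementary_maps"
    by (elim elementaryE) (simp only: pmap_comp_elementary, rule elementaryI, simp_all)
next
  fix f :: "'a pmap"
  assume "f \<in> elementary_maps"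
  then obtain \<alpha> \<beta> p v where f: "\<alpha> \<noteq> 0" "\<beta> \<noteq> 0" "f = (cst \<alpha> * X + in_x p Y, cst \<beta> * Y + cst v)"
    by (rule elementaryE)
  let ?g = "(cst (1 / \<alpha>) * X + in_x (smult (- 1 / \<alpha>) (pcompose p [:- v / \<beta>, 1 / \<beta>:])) Y, cst (1 / \<beta>) * Y + cst (- v / \<beta>))"
  have "?g \<in> elementary_maps"
    using f by (intro elementaryI) simp_all
  moreover have "pmap_comp f ?g = (X, Y)"
    using f(1,2) unfolding f(3) pmap_comp_elementary by simp
  ultimately show "\<exists>g\<in>elementary_maps. pmap_comp f g = (X, Y)"
    by blast
qed

lemma subgroup_affine: "subgroup (affine_maps :: 'a::field pmap set) GA2"
proof (rule subgroup_GA2I)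
  show "(affine_maps :: 'a pmap set) \<noteq> {}"
    using affineI[of "1 :: 'a" 1 0 0 0 0] by (intro notI) simp
next
  fix f g :: "'a pmap"
  assume "f \<in> affine_maps" "g \<in> affine_maps"
  then obtain m11 m12 m21 m22 a1 a2 n11 n12 n21 n22 b1 b2
    where f: "m11 * m22 - m12 * m21 \<noteq> 0" "f = (cst m11 * X + cst m12 * Y + cst a1, cst m21 * X + cst m22 * Y + cst a2)"
      and g: "n11 * n22 - n12 * n21 \<noteq> 0" "g = (cst n11 * X + cst n12 * Y + cst b1, cst n21 * X + cst n22 * Y + cst b2)"
    by (elim affineE)
  have "(m11 * n11 + m12 * n21) * (m21 * n12 + m22 * n22) - (m11 * n12 + m12 * n22) * (m21 * n11 + m22 * n21)
    = (m11 * m22 - m12 * m21) * (n11 * n22 - n12 * n21)"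
    by (simp add: algebra_simps)
  with f g show "pmap_comp f g \<in> affine_maps"
    unfolding f(2) g(2) pmap_comp_affine by (intro affineI) simp
next
  fix f :: "'a pmap"
  assume "f \<in> affine_maps"
  then obtain m11 m12 m21 m22 a1 a2 where
    f: "m11 * m22 - m12 * m21 \<noteq> 0" "f = (cst m11 * X + cst m12 * Y + cst a1, cst m21 * X + cst m22 * Y + cst a2)"
    by (rule affineE)
  define d where "d = m11 * m22 - m12 * m21"
  have d: "d \<noteq> 0"
    using f by (simp add: d_def)
  let ?g = "(cst (m22 / d) * X + cst (- m12 / d) * Y + cst ((m12 * a2 - m22 * a1) / d),
    cst (- m21 / d) * X + cst (m11 / d) * Y + cst ((m21 * a1 - m11 * a2) / d))"
  have "m22 / d * (m11 / d) - (- m12 / d) * (- m21 / d) = 1 / d"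
    using d by (simp add: field_simps) (simp add: d_def algebra_simps)
  then have "?g \<in> affine_maps"
    using d by (intro affineI) simp
  moreover have "m11 * (m22 / d) + m12 * (- m21 / d) = 1" "m11 * (- m12 / d) + m12 * (m11 / d) = 0"
    "m21 * (m22 / d) + m22 * (- m21 / d) = 0" "m21 * (- m12 / d) + m22 * (m11 / d) = 1"
    "m11 * ((m12 * a2 - m22 * a1) / d) + m12 * ((m21 * a1 - m11 * a2) / d) + a1 = 0"
    "m21 * ((m12 * a2 - m22 * a1) / d) + m22 * ((m21 * a1 - m11 * a2) / d) + a2 = 0"
    using d by (simp_all add: field_simps) (simp_all add: d_def algebra_simps)
  then have "pmap_comp f ?g = (X, Y)"
    unfolding f(2) pmap_comp_affine by simp
  ultimately show "\<exists>g\<in>affine_maps. pmap_comp f g = (X, Y)"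
    by blast
qed

lemma pmap_prod_Nil [simp]: "pmap_prod [] = \<one>\<^bsub>GA2\<^esub>"
  and pmap_prod_Cons [simp]: "pmap_prod (g # gs) = g \<otimes>\<^bsub>GA2\<^esub> pmap_prod gs"
  by (simp_all add: pmap_prod_def)

lemma affine_carrier: "f \<in> affine_maps \<Longrightarrow> f \<in> carrier GA2"
  and elementary_carrier: "f \<in> elementary_maps \<Longrightarrow> f \<in> carrier GA2"
  using subgroup.subset[OF subgroup_affine] subgroup.subset[OF subgroup_elementary] by auto

lemma pmap_prod_carrier: "set gs \<subseteq> carrier GA2 \<Longrightarrow> pmap_prod gs \<in> carrier GA2"
  by (induction gs) auto

lemma pmap_prod_append:
  "set gs \<subseteq> carrier GA2 \<Longrightarrow> set hs \<subseteq> carrier GA2 \<Longrightarrow> pmap_prod (gs @ hs) = pmap_prod gs \<otimes>\<^bsub>GA2\<^esub> pmap_prod hs"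
  by (induction gs) (auto simp: GA2.m_assoc pmap_prod_carrier)

lemma tame_generator: "f \<in> affine_maps \<union> elementary_maps \<Longrightarrow> tame f"
  unfolding tame_def by (rule exI[of _ "[f]"]) (auto simp: affine_carrier elementary_carrier)

lemma tame_mult: "tame f \<Longrightarrow> tame g \<Longrightarrow> tame (f \<otimes>\<^bsub>GA2\<^esub> g)"
  unfolding tame_def
proof (elim exE conjE)
  fix fs gs :: "'a pmap list"
  assume fs: "set fs \<subseteq> affine_maps \<union> elementary_maps" "pmap_prod fs = f"
    and gs: "set gs \<subseteq> affine_maps \<union> elementary_maps" "pmap_prod gs = g"
  then have "pmap_prod (fs @ gs) = f \<otimes>\<^bsub>GA2\<^esub> g"
    by (subst pmap_prod_append) (auto intro: affine_carrier elementary_carrier)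
  with fs gs show "\<exists>gs. set gs \<subseteq> affine_maps \<union> elementary_maps \<and> pmap_prod gs = f \<otimes>\<^bsub>GA2\<^esub> g"
    by (intro exI[of _ "fs @ gs"]) simp
qed

lemma tame_cancel_right:
  assumes f: "f \<in> carrier GA2" and g: "g \<in> affine_maps \<union> elementary_maps"
    and fg: "tame (f \<otimes>\<^bsub>GA2\<^esub> g)"
  shows "tame f"
proof -
  have "inv\<^bsub>GA2\<^esub> g \<in> affine_maps \<union> elementary_maps"
    using g subgroup.m_inv_closed[OF subgroup_affine] subgroup.m_inv_closed[OF subgroup_elementary] by blast
  from tame_mult[OF fg tame_generator[OF this]] have "tame (f \<otimes>\<^bsub>GA2\<^esub> g \<otimes>\<^bsub>GA2\<^esub> inv\<^bsub>GA2\<^esub> g)" .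
  moreover have "g \<in> carrier GA2"
    using g affine_carrier elementary_carrier by blast
  ultimately show ?thesis
    using f by (simp add: GA2.m_assoc)
qed

lemma carrier_GA2E:
  assumes "(P, Q) \<in> carrier GA2"
  obtains p q where "subst2 p P Q = X" "subst2 q P Q = Y" "subst2 P p q = X" "subst2 Q p q = Y"
  using assms by (auto simp: carrier_GA2 pmap_comp_def)

lemma swap_affine: "(Y, X) \<in> affine_maps"
  using affineI[of 0 0 1 1 0 0] by simp

text \<open>The second component is invertible under composition as a polynomial in y over K[x],
  hence linear in y with a unit of K[x], a constant, as leading coefficient. Conjugation with the
  swap relates the map to an elementary one.\<close>

lemma tame_fst_X:
  assumes "(X, Q) \<in> carrier GA2"
  shows "tame (X, Q)"
proof -
  obtain p q where pq: "subst2 p X Q = X" "subst2 q X Q = Y" "subst2 X p q = X" "subst2 Q p q = Y"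
    using assms by (rule carrier_GA2E)
  have comp: "subst2 r X s = pcompose r s" for r s :: "'a poly2"
    by (induction r) (simp_all add: in_x_X pcompose_pCons)
  have e: "pcompose Q q = [:0, 1:]"
    using pq by (simp add: comp Y_def)
  then have "degree Q * degree q = 1"
    by (metis degree_pcompose degree_pCons_eq degree_1 one_pCons One_nat_def pCons_eq_0_iff zero_neq_one)
  then have "degree Q = 1" "degree q = 1"
    by simp_all
  then obtain a b c d where ab: "Q = [:a, b:]" and cd: "q = [:c, d:]"
    using degree1_coeffs by metis
  have "b * d = 1"
    using e by (simp add: ab cd pcompose_pCons)
  then have "b dvd 1"
    by (metis dvd_triv_left)
  then obtain \<mu> where \<mu>: "b = [:\<mu>:]" "\<mu> dvd 1"
    using is_unit_poly_iff by blast
  then have "\<mu> \<noteq> 0"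
    by auto
  have Q: "Q = cst \<mu> * Y + in_x a X"
    by (simp add: ab \<mu> cst_def Y_def in_x_X)
  have "(cst \<mu> * X + in_x a Y, cst 1 * Y + cst 0) \<in> elementary_maps"
    using \<open>\<mu> \<noteq> 0\<close> by (intro elementaryI) auto
  then have "tame ((Y, X) \<otimes>\<^bsub>GA2\<^esub> ((cst \<mu> * X + in_x a Y, cst 1 * Y + cst 0) \<otimes>\<^bsub>GA2\<^esub> (Y, X)))"
    by (intro tame_mult tame_generator) (use swap_affine in auto)
  moreover have "(Y, X) \<otimes>\<^bsub>GA2\<^esub> ((cst \<mu> * X + in_x a Y, cst 1 * Y + cst 0) \<otimes>\<^bsub>GA2\<^esub> (Y, X)) = (X, Q)"
    unfolding mult_GA2 pmap_comp_def Q fst_conv snd_conv subst2_X subst2_Y subst2_add subst2_mult subst2_cst subst2_in_x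
    by simp
  ultimately show ?thesis
    by simp
qed

text \<open>P is not constant, so it is the first component of some affine map; cancelling that map
  on the right turns P into X.\<close>

lemma tame_fst_degree_1:
  assumes PQ: "(P, Q) \<in> carrier GA2" and P: "weight2 (\<le>) 1 1 1 P"
  shows "tame (P, Q)"
proof -
  have c: "coeff (coeff P j) i = 0" if "i + j > 1" for i j
  proof (rule ccontr)
    assume "coeff (coeff P j) i \<noteq> 0"
    with P have "1 * int i + 1 * int j \<le> 1"
      unfolding weight2_def by blast
    with that show False
      by simp
  qed
  define \<alpha> \<beta> \<gamma> where "\<alpha> = coeff (coeff P 0) 1" and "\<beta> = coeff (coeff P 1) 0" and "\<gamma> = coeff (coeff P 0) 0"
  have P_eq: "P = cst \<alpha> * X + cst \<beta> * Y + cst \<gamma>"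
  proof (rule poly_eqI, rule poly_eqI)
    fix j i
    show "coeff (coeff P j) i = coeff (coeff (cst \<alpha> * X + cst \<beta> * Y + cst \<gamma>) j) i"
      using coeff_monomial2[of \<alpha> 1 0 j i] coeff_monomial2[of \<beta> 0 1 j i] coeff_monomial2[of \<gamma> 0 0 j i]
        c[of i j]
      by (cases "i + j > 1"; cases i; cases j) (simp_all add: \<alpha>_def \<beta>_def \<gamma>_def)
  qed
  have nz: "\<alpha> \<noteq> 0 \<or> \<beta> \<noteq> 0"
  proof (rule ccontr)
    assume "\<not> ?thesis"
    then have "P = cst \<gamma>"
      by (simp add: P_eq)
    moreover obtain p q where "subst2 P p q = X"
      using PQ by (rule carrier_GA2E)
    ultimately show False
      by (simp add: cst_def X_def)
  qed
  obtain L where L: "(P, L) \<in> affine_maps"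
  proof (cases "\<alpha> = 0")
    case True
    with nz show ?thesis
      using affineI[of \<alpha> 0 \<beta> 1 \<gamma> 0] that[of X] by (simp add: P_eq)
  next
    case False
    then show ?thesis
      using affineI[of \<alpha> 1 \<beta> 0 \<gamma> 0] that[of Y] by (simp add: P_eq)
  qed
  define \<psi> where "\<psi> = inv\<^bsub>GA2\<^esub> (P, L)"
  have \<psi>: "\<psi> \<in> affine_maps"
    unfolding \<psi>_def by (rule subgroup.m_inv_closed[OF subgroup_affine L])
  have "pmap_comp (P, L) \<psi> = (X, Y)"
    unfolding \<psi>_def using GA2.r_inv[OF affine_carrier[OF L]] by (simp add: mult_GA2 one_GA2)
  then have X: "subst2 P (fst \<psi>) (snd \<psi>) = X"
    by (simp add: pmap_comp_def)
  have "(P, Q) \<otimes>\<^bsub>GA2\<^esub> \<psi> = (X, subst2 Q (fst \<psi>) (snd \<psi>))"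
    by (simp add: mult_GA2 pmap_comp_def X)
  moreover have "(P, Q) \<otimes>\<^bsub>GA2\<^esub> \<psi> \<in> carrier GA2"
    by (rule GA2.m_closed[OF PQ affine_carrier[OF \<psi>]])
  ultimately have "tame ((P, Q) \<otimes>\<^bsub>GA2\<^esub> \<psi>)"
    by (simp only: tame_fst_X)
  then show ?thesis
    by (rule tame_cancel_right[OF PQ, rotated]) (use \<psi> in simp)
qed

section \<open>The Jung--van der Kulk theorem\<close>

lemma coeff_cst_X_power: "coeff (coeff (cst c * X ^ r) j) i = (if i = r \<and> j = 0 then c else 0)"
  and coeff_cst_Y_power: "coeff (coeff (cst c * Y ^ r) j) i = (if i = 0 \<and> j = r then c else 0)"
  using coeff_monomial2[of c r 0 j i] coeff_monomial2[of c 0 r j i] by simp_all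

text \<open>If P = g(y), the inverse map gives g(q) = x, and comparing degrees leaves only linear
  g.\<close>

lemma degree_le_1_of_in_y:
  fixes P Q :: "'a::field poly2"
  assumes PQ: "(P, Q) \<in> carrier GA2" and P: "\<And>i j. i > 0 \<Longrightarrow> coeff (coeff P j) i = 0"
  shows "degree P \<le> 1"
proof -
  define g where "g = map_poly (\<lambda>c. coeff c 0) P"
  have "P = map_poly (\<lambda>k. [:k:]) g"
  proof (rule poly_eqI, rule poly_eqI)
    fix j i
    show "coeff (coeff P j) i = coeff (coeff (map_poly (\<lambda>k. [:k:]) g) j) i"
      by (cases i) (simp_all add: g_def coeff_map_poly P)
  qed
  then have g: "P = in_x g Y"
    by (simp only: map_poly_const_eq_in_x)
  obtain p q where "subst2 P p q = X"
    using PQ by (rule carrier_GA2E)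
  then have "in_x g q = X"
    by (simp add: g subst2_in_x)
  \<comment> \<open>The degree in y does not see x, so x is replaced by x y, which has degree
    1.\<close>
  then have "in_x g (subst2 q (X * Y) Y) = X * Y"
    by (metis subst2_in_x subst2_X)
  then have "degree g * degree (subst2 q (X * Y) Y) = degree (X * Y :: 'a poly2)"
    by (metis degree_in_x)
  also have "degree (X * Y :: 'a poly2) = 1"
    by (simp add: X_def Y_def)
  finally have "degree g = 1"
    by simp
  then show ?thesis
    using degree_in_x[of g Y] by (simp add: g Y_def)
qed

lemma leading_form_cases:
  fixes P Q :: "'a::field poly2"
  assumes PQ: "(P, Q) \<in> carrier GA2"
    and w: "weight2 (\<le>) (int a) (int b) n P" "\<not> weight2 (\<le>) (int a) (int b) (n - 1) P"
    and ab: "coprime a b" "a > 0" "b > 0"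
  obtains (X) c r where "top2 (int a) (int b) n P = cst c * X ^ r"
    | (Y) c r where "top2 (int a) (int b) n P = cst c * Y ^ r"
    | (XY) c r l where "top2 (int a) (int b) n P = cst c * (X ^ b - cst l * Y ^ a) ^ r"
        "r > 0" "l \<noteq> 0" "a = 1 \<or> b = 1"
proof -
  obtain p q where inv: "subst2 p P Q = X" "subst2 q P Q = Y" "subst2 P p q = X" "subst2 Q p q = Y"
    using PQ by (rule carrier_GA2E)
  let ?T = "top2 (int a) (int b) n P"
  obtain x y where xy: "coeff x 0 = X" "coeff y 0 = Y" "degree x > 0 \<or> degree y > 0" "subst3 ?T x y = [:?T:]"
    using leading_form_deformation[OF inv w(1)] by blast
  have "?T \<noteq> 0"
    using weight2_top2_eq_0 w by blast
  from leading_form_shape[OF this weight2_top2 ab xy] that show thesis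
    by blast
qed

text \<open>For the weights 1, 1 each possible leading form is a constant times a power of a linear
  form over K, and a linear change of coordinates takes that linear form to y.\<close>

lemma linear_normalization:
  fixes P Q :: "'a::field poly2"
  assumes PQ: "(P, Q) \<in> carrier GA2"
    and w: "weight2 (\<le>) 1 1 (int n) P" "\<not> weight2 (\<le>) 1 1 (int n - 1) P"
  shows "\<exists>\<phi>\<in>affine_maps. \<exists>c. c \<noteq> 0 \<and> weight2 (\<le>) 1 1 (int n - 1) (subst2 P (fst \<phi>) (snd \<phi>) - cst c * Y ^ n)"
proof -
  let ?T = "top2 1 1 (int n) P"
  have T0: "?T \<noteq> 0"
    using weight2_top2_eq_0 w by blast
  have wXY: "weight2 (=) 1 1 1 X" "weight2 (=) 1 1 1 Y"
    by (auto simp: weight2_def coeff_X coeff_Y split: if_splits)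
  have wl: "weight2 (=) 1 1 1 (cst l * X + Y)" for l :: 'a
  proof -
    have "weight3 (=) 1 1 0 (0 + 1) ([:cst l:] * [:X:])"
      by (intro weight3_mult) (simp_all add: weight3_const wXY weight2_cst)
    moreover have "weight3 (=) 1 1 0 1 [:Y:]"
      by (simp add: weight3_const wXY)
    ultimately have "weight3 (=) 1 1 0 1 ([:cst l:] * [:X:] + [:Y:])"
      by (intro weight3_add) simp_all
    then show ?thesis
      by (simp add: weight3_const mult.commute)
  qed
  have main: ?thesis
    if uv: "(u, v) \<in> affine_maps" "weight2 (=) 1 1 1 u" "weight2 (=) 1 1 1 v"
      and T: "subst2 ?T u v = cst c * Y ^ r" and c: "c \<noteq> 0" for u v c r
  proof -
    have "weight2 (=) 1 1 (int n) (cst c * Y ^ r)"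
      unfolding T[symmetric] by (intro weight2_subst2 weight2_top2 uv) auto
    from this[unfolded weight2_def, rule_format, of r 0] c have "r = n"
      by (simp add: coeff_cst_Y_power)
    moreover have "weight2 (\<le>) 1 1 (int n - 1) (subst2 P u v - subst2 ?T u v)"
      by (intro weight2_top2_subst2 w) (use uv in \<open>auto simp: weight2_def\<close>)
    ultimately show ?thesis
      using uv c T by (intro bexI[of _ "(u, v)"] exI[of _ c]) auto
  qed
  have id_affine: "(X, Y) \<in> affine_maps"
    using affineI[of 1 1 0 0 0 0] by simp
  \<comment> \<open>Substituting l x + y for x and x for y turns x - l y into y.\<close>
  have shear_affine: "(cst l * X + Y, X) \<in> affine_maps" for l :: 'a
    using affineI[of l 0 1 1 0 0] by simp
  have w': "weight2 (\<le>) (int 1) (int 1) (int n) P" "\<not> weight2 (\<le>) (int 1) (int 1) (int n - 1) P"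
    using w by simp_all
  have one: "coprime (1::nat) 1" "(1::nat) > 0"
    by simp_all
  show ?thesis
  proof (rule leading_form_cases[OF PQ w' one one(2)])
    fix c r
    assume "top2 (int 1) (int 1) (int n) P = cst c * X ^ r"
    then have T: "?T = cst c * X ^ r"
      by simp
    with T0 have "c \<noteq> 0"
      by auto
    with T show ?thesis
      by (intro main[OF swap_affine wXY(2,1)]) (simp_all add: subst2_mult subst2_power)
  next
    fix c r
    assume "top2 (int 1) (int 1) (int n) P = cst c * Y ^ r"
    then have T: "?T = cst c * Y ^ r"
      by simp
    with T0 have "c \<noteq> 0"
      by auto
    with T show ?thesis
      by (intro main[OF id_affine wXY]) simp_all
  next
    fix c r l
    assume "top2 (int 1) (int 1) (int n) P = cst c * (X ^ 1 - cst l * Y ^ 1) ^ r"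
    then have T: "?T = cst c * (X - cst l * Y) ^ r"
      by simp
    with T0 have "c \<noteq> 0"
      by auto
    with T show ?thesis
      by (intro main[OF shear_affine[of l] wl wXY(1)]) (simp_all add: subst2_mult subst2_power subst2_diff)
  qed
qed

text \<open>The weights a, b are normal to the edge of the Newton polygon that leaves y^n towards
  monomials containing x. The leading form along it is then a power of a binomial, and a > b leaves
  b = 1; substituting x + l y^a for x erases y^n without raising the weight.\<close>

lemma elementary_reduction:
  fixes P Q :: "'a::field poly2"
  assumes PQ: "(P, Q) \<in> carrier GA2" and n: "n \<ge> 2" and c: "c \<noteq> 0"
    and w: "weight2 (\<le>) 1 1 (int n - 1) (P - cst c * Y ^ n)"
  shows "\<exists>\<phi>\<in>elementary_maps. weight2 (\<le>) 1 1 (int n - 1) (subst2 P (fst \<phi>) (snd \<phi>))"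
proof -
  have cP: "coeff (coeff P n) 0 = c"
    using w[unfolded weight2_def, rule_format, of n 0] by (auto simp: coeff_cst_Y_power)
  have below: "i + j < n" if "coeff (coeff P j) i \<noteq> 0" "i > 0" for i j
    using w[unfolded weight2_def, rule_format, of j i] that by (auto simp: coeff_cst_Y_power)
  have below0: "j \<le> n" if "coeff (coeff P j) 0 \<noteq> 0" for j
    using w[unfolded weight2_def, rule_format, of j 0] that
    by (cases "j = n") (auto simp: coeff_cst_Y_power)
  \<comment> \<open>The pairs encode -(n - j) / i, so the maximum below is the smallest slope (n -
    j) / i, and no monomial of P lies beyond the edge.\<close>
  define M where "M = (\<lambda>(i, j, l). (- (int n - int j), i)) ` {(i, j, l). coeff3 [:P:] i j l \<noteq> 0} \<inter> {(e, i). i > 0}"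
  have M_mem: "(- (int n - int j), i) \<in> M" if "coeff (coeff P j) i \<noteq> 0" "i > 0" for i j
    unfolding M_def using that by (intro IntI image_eqI[of _ _ "(i, j, 0)"]) (simp_all add: coeff3_def)
  have "finite M"
    unfolding M_def by (intro finite_Int disjI1 finite_imageI finite_coeff3)
  \<comment> \<open>If P depended on y alone, its degree in y would be at most 1, but y^n occurs and
    n \<ge> 2.\<close>
  moreover have "M \<noteq> {}"
  proof
    assume "M = {}"
    then have "coeff (coeff P j) i = 0" if "i > 0" for i j
      using M_mem that by blast
    then have "degree P \<le> 1"
      by (rule degree_le_1_of_in_y[OF PQ])
    moreover have "n \<le> degree P"
      using cP c by (intro le_degree) auto
    ultimately show False
      using n by simp
  qed
  moreover have "i > 0" if "(e, i) \<in> M" for e i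
    using that by (simp add: M_def)
  ultimately have "\<exists>(e0, i0)\<in>M. \<forall>(e, i)\<in>M. e * int i0 \<le> e0 * int i"
    by (rule finite_ratio_max)
  then obtain e0 i0 where e0: "(e0, i0) \<in> M" and max: "\<And>e i. (e, i) \<in> M \<Longrightarrow> e * int i0 \<le> e0 * int i"
    by fast
  obtain j0 l where j0: "coeff3 [:P:] i0 j0 l \<noteq> 0" "i0 > 0" "e0 = - (int n - int j0)"
    using e0 by (auto simp: M_def)
  then have "l = 0"
    by (cases l) (simp_all add: coeff3_def)
  with j0 have ij0: "coeff (coeff P j0) i0 \<noteq> 0" "i0 > 0" "e0 = - (int n - int j0)"
    by (simp_all add: coeff3_def)
  define k where "k = n - j0"
  \<comment> \<open>Monomials containing x have total degree below n; this is the source of a >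
    b.\<close>
  have k: "k > i0" "int k = int n - int j0"
    using below[OF ij0(1,2)] by (auto simp: k_def)
  define g where "g = gcd k i0"
  have "g > 0"
    using ij0(2) by (simp add: g_def)
  define a b where "a = k div g" and "b = i0 div g"
  have ag: "k = a * g" and bg: "i0 = b * g"
    by (simp_all add: a_def b_def g_def)
  have ab: "coprime a b"
    unfolding a_def b_def g_def using ij0(2) by (intro div_gcd_coprime) simp
  have b: "b > 0" and a: "a > b"
    using k(1) ij0(2) by (auto simp: ag bg)
  have wP: "weight2 (\<le>) (int a) (int b) (int b * int n) P"
    unfolding weight2_def
  proof (intro allI impI)
    fix i j
    assume ij: "coeff (coeff P j) i \<noteq> 0"
    show "int a * int i + int b * int j \<le> int b * int n"
    proof (cases "i = 0")
      case True
      with below0[of j] ij have "j \<le> n"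
        by simp
      then show ?thesis
        using True by (simp flip: of_nat_mult)
    next
      case False
      with max[OF M_mem[OF ij]] have "int k * int i \<le> (int n - int j) * int i0"
        by (simp add: ij0(3) k(2) algebra_simps)
      then have "int g * (int a * int i) \<le> int g * ((int n - int j) * int b)"
        by (simp add: ag bg mult_ac)
      then have "int a * int i \<le> (int n - int j) * int b"
        using \<open>g > 0\<close> by simp
      then show ?thesis
        by (simp add: algebra_simps)
    qed
  qed
  let ?T = "top2 (int a) (int b) (int b * int n) P"
  have T1: "coeff (coeff ?T n) 0 \<noteq> 0"
    using cP c by (simp add: coeff_top2)
  have "int g * (int a * int i0) = int g * ((int n - int j0) * int b)"
    using k(2) ag bg by (simp add: mult_ac flip: k(2))
  then have "int a * int i0 = (int n - int j0) * int b"
    using \<open>g > 0\<close> by simp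
  then have "int a * int i0 + int b * int j0 = int b * int n"
    by (simp add: algebra_simps)
  then have T2: "coeff (coeff ?T j0) i0 \<noteq> 0"
    using ij0(1) by (simp add: coeff_top2)
  have nw: "\<not> weight2 (\<le>) (int a) (int b) (int b * int n - 1) P"
  proof
    assume "weight2 (\<le>) (int a) (int b) (int b * int n - 1) P"
    from this[unfolded weight2_def, rule_format, of n 0] cP c show False
      by simp
  qed
  have "a > 0"
    using a by simp
  \<comment> \<open>The leading form contains y^n by \<open>T1\<close> and a monomial with x by
    \<open>T2\<close>, so it is not a power of one variable.\<close>
  obtain d r l where T: "?T = cst d * (X ^ b - cst l * Y ^ a) ^ r" "r > 0" "l \<noteq> 0" "a = 1 \<or> b = 1"
  proof (rule leading_form_cases[OF PQ wP nw ab \<open>a > 0\<close> b])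
    fix d r
    assume "?T = cst d * X ^ r"
    then show ?thesis
      using T1 n by (simp add: coeff_cst_X_power split: if_splits)
  next
    fix d r
    assume "?T = cst d * Y ^ r"
    then show ?thesis
      using T2 ij0(2) by (simp add: coeff_cst_Y_power split: if_splits)
  qed blast
  with a b have b1: "b = 1" and a2: "a \<ge> 2"
    by auto
  let ?u = "X + cst l * Y ^ a"
  have "?u = cst 1 * X + in_x (monom l a) Y"
  proof -
    have "in_x (monom l a) Y = cst l * Y ^ a"
      by (induction a) (simp_all add: monom_0 monom_Suc mult_ac)
    then show ?thesis
      by simp
  qed
  then have \<phi>: "(?u, Y) \<in> elementary_maps"
    using elementaryI[of 1 1 "monom l a" 0] by simp
  have Tu: "subst2 ?T ?u Y = cst d * X ^ r"
    unfolding T(1) by (simp add: b1 subst2_mult subst2_power subst2_diff)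
  have wu: "weight2 (\<le>) (int a) (int b) (int a) ?u"
    by (auto simp: weight2_def coeff_X coeff_cst_Y_power b1 split: if_splits)
  have wY: "weight2 (\<le>) (int a) (int b) (int b) Y"
    by (auto simp: weight2_def coeff_Y split: if_splits)
  have w1: "weight2 (\<le>) (int a) 1 (int n - 1) (subst2 P ?u Y - cst d * X ^ r)"
    using weight2_top2_subst2[OF wP wu wY] unfolding Tu by (simp add: b1)
  have "weight2 (\<le>) (int a) (int b) (int b * int n) (subst2 P ?u Y)"
    by (rule weight2_subst2[OF wP wu wY]) auto
  then have w2: "weight2 (\<le>) (int a) 1 (int n) (subst2 P ?u Y)"
    by (simp add: b1)
  \<comment> \<open>A monomial x^i y^j satisfies a i + j \<le> n with a \<ge> 2, so i > 0 gives i +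
    j < n. For i = 0 the new leading form d x^r with r > 0 contains no pure power of y, hence j <
    n.\<close>
  have "weight2 (\<le>) 1 1 (int n - 1) (subst2 P ?u Y)"
    unfolding weight2_def
  proof (intro allI impI)
    fix i j
    assume ij: "coeff (coeff (subst2 P ?u Y) j) i \<noteq> 0"
    then have le: "int a * int i + int j \<le> int n"
      using w2 by (auto simp: weight2_def)
    show "1 * int i + 1 * int j \<le> int n - 1"
    proof (cases "i = 0")
      case True
      have "int j \<le> int n - 1"
        using w1[unfolded weight2_def, rule_format, of j i] ij True T(2)
        by (simp add: coeff_cst_X_power)
      with True show ?thesis
        by simp
    next
      case False
      have "2 * int i \<le> int a * int i"
        using a2 by (intro mult_right_mono) auto
      moreover have "int i > 0"
        using False by simp
      ultimately show ?thesis
        using le by linarith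
    qed
  qed
  with \<phi> show ?thesis
    by (intro bexI[of _ "(?u, Y)"]) simp_all
qed

text \<open>The induction is on a bound for the total degree of P, and Q is carried along.
  Generators are multiplied on the right, where they act on P as substitutions.\<close>

theorem jung_van_der_kulk:
  fixes f :: "'a::field pmap"
  assumes "f \<in> carrier GA2"
  shows "tame f"
proof -
  have "tame (P, Q)" if "(P, Q) \<in> carrier GA2" "weight2 (\<le>) 1 1 (int n) P" for P Q :: "'a poly2" and n
    using that
  proof (induction n arbitrary: P Q)
    case 0
    then show ?case
      by (intro tame_fst_degree_1) (auto intro: weight2_mono)
  next
    case (Suc n)
    note PQ = Suc.prems(1)
    consider "n = 0" | "weight2 (\<le>) 1 1 (int n) P" | "n > 0" "\<not> weight2 (\<le>) 1 1 (int n) P"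
      by blast
    then show ?case
    proof cases
      case 1
      then show ?thesis
        using Suc.prems by (intro tame_fst_degree_1) simp_all
    next
      case 2
      then show ?thesis
        using Suc by blast
    next
      case 3
      then have "\<not> weight2 (\<le>) 1 1 (int (Suc n) - 1) P"
        by simp
      from linear_normalization[OF Suc.prems this] obtain \<phi> c where \<phi>: "\<phi> \<in> affine_maps" "c \<noteq> 0"
          "weight2 (\<le>) 1 1 (int (Suc n) - 1) (subst2 P (fst \<phi>) (snd \<phi>) - cst c * Y ^ Suc n)"
        by blast
      define P1 Q1 where "P1 = subst2 P (fst \<phi>) (snd \<phi>)" and "Q1 = subst2 Q (fst \<phi>) (snd \<phi>)"
      have e1: "(P, Q) \<otimes>\<^bsub>GA2\<^esub> \<phi> = (P1, Q1)"
        by (simp add: mult_GA2 pmap_comp_def P1_def Q1_def)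
      have c1: "(P1, Q1) \<in> carrier GA2"
        unfolding e1[symmetric] by (rule GA2.m_closed[OF PQ affine_carrier[OF \<phi>(1)]])
      have "Suc n \<ge> 2"
        using 3 by simp
      from elementary_reduction[OF c1 this \<phi>(2)] \<phi>(3) obtain \<psi> where \<psi>: "\<psi> \<in> elementary_maps"
          "weight2 (\<le>) 1 1 (int n) (subst2 P1 (fst \<psi>) (snd \<psi>))"
        by (auto simp: P1_def)
      define P2 Q2 where "P2 = subst2 P1 (fst \<psi>) (snd \<psi>)" and "Q2 = subst2 Q1 (fst \<psi>) (snd \<psi>)"
      have e2: "(P1, Q1) \<otimes>\<^bsub>GA2\<^esub> \<psi> = (P2, Q2)"
        by (simp add: mult_GA2 pmap_comp_def P2_def Q2_def)
      have c2: "(P2, Q2) \<in> carrier GA2"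
        unfolding e2[symmetric] by (rule GA2.m_closed[OF c1 elementary_carrier[OF \<psi>(1)]])
      have "tame (P2, Q2)"
        using Suc.IH[OF c2] \<psi>(2) by (simp add: P2_def)
      then have "tame (P1, Q1)"
        unfolding e2[symmetric] using \<psi>(1) by (intro tame_cancel_right[OF c1, of \<psi>]) auto
      then show ?thesis
        unfolding e1[symmetric] using \<phi>(1) by (intro tame_cancel_right[OF PQ, of \<phi>]) auto
    qed
  qed
  moreover have "\<exists>n. weight2 (\<le>) 1 1 (int n) P" for P :: "'a poly2"
  proof -
    define S where "S = (\<lambda>(i, j, l). i + j) ` {(i, j, l). coeff3 [:P:] i j l \<noteq> 0}"
    have "finite S"
      unfolding S_def by (intro finite_imageI finite_coeff3)
    moreover have "i + j \<in> S" if "coeff (coeff P j) i \<noteq> 0" for i j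
      unfolding S_def using that by (intro image_eqI[of _ _ "(i, j, 0)"]) (simp_all add: coeff3_def)
    ultimately have "1 * int i + 1 * int j \<le> int (Max S)" if "coeff (coeff P j) i \<noteq> 0" for i j
      using that by (metis Max_ge mult_1 of_nat_add of_nat_le_iff)
    then show ?thesis
      unfolding weight2_def by blast
  qed
  ultimately show ?thesis
    using assms by (metis prod.collapse)
qed

section \<open>Normal forms\<close>

text \<open>Replacing x by x y sends x^i y^j to x^i y^(i + j): distinct monomials stay distinct and
  the outer degree becomes the total one.\<close>

definition total_degree :: "'a::field poly2 \<Rightarrow> nat" where
  "total_degree p = degree (subst2 p (X * Y) Y)"

lemma in_y_affine: "degree p \<le> 1 \<Longrightarrow> in_x p Y = cst (coeff p 1) * Y + cst (coeff p 0)"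
proof -
  assume "degree p \<le> 1"
  then have "p = [:coeff p 0, coeff p 1:]"
    by (intro poly_eqI) (auto simp: coeff_pCons coeff_eq_0 split: nat.splits)
  then have "in_x p Y = in_x [:coeff p 0, coeff p 1:] Y"
    by simp
  then show ?thesis
    by (simp add: mult.commute add.commute)
qed

lemma elementary_not_affineE:
  assumes "f \<in> elementary_maps" "f \<notin> affine_maps"
  obtains \<alpha> \<beta> p v where "\<alpha> \<noteq> 0" "\<beta> \<noteq> 0" "degree p \<ge> 2" "f = (cst \<alpha> * X + in_x p Y, cst \<beta> * Y + cst v)"
proof -
  obtain \<alpha> \<beta> p v where f: "\<alpha> \<noteq> 0" "\<beta> \<noteq> 0" "f = (cst \<alpha> * X + in_x p Y, cst \<beta> * Y + cst v)"
    using assms(1) by (rule elementaryE)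
  have "degree p \<ge> 2"
  proof (rule ccontr)
    assume "\<not> degree p \<ge> 2"
    then have "f \<in> affine_maps"
      using affineI[of \<alpha> \<beta> "coeff p 1" 0 "coeff p 0" v] f by (simp add: in_y_affine add.assoc)
    with assms show False
      by simp
  qed
  with f that show thesis
    by blast
qed

lemma affine_not_elementaryE:
  assumes "f \<in> affine_maps" "f \<notin> elementary_maps"
  obtains m11 m12 m21 m22 a1 a2 where "m21 \<noteq> 0" "m11 * m22 - m12 * m21 \<noteq> 0"
    "f = (cst m11 * X + cst m12 * Y + cst a1, cst m21 * X + cst m22 * Y + cst a2)"
proof -
  obtain m11 m12 m21 m22 a1 a2 where f: "m11 * m22 - m12 * m21 \<noteq> 0"
    "f = (cst m11 * X + cst m12 * Y + cst a1, cst m21 * X + cst m22 * Y + cst a2)"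
    using assms(1) by (rule affineE)
  have "m21 \<noteq> 0"
  proof
    assume "m21 = 0"
    then have "f \<in> elementary_maps"
      using elementaryI[of m11 m22 "[:a1, m12:]" a2] f by (simp add: algebra_simps)
    with assms show False
      by simp
  qed
  with f that show thesis
    by blast
qed

lemma coeff_in_y: "coeff (coeff (in_x p Y) j) i = (if i = 0 then coeff p j else 0)"
  by (simp add: coeff_map_poly coeff_pCons split: nat.splits flip: map_poly_const_eq_in_x)

lemma coeff_affine:
  "coeff (coeff (cst a * X) j) i = (if i = 1 \<and> j = 0 then a else 0)"
  "coeff (coeff (cst a * Y) j) i = (if i = 0 \<and> j = 1 then a else 0)"
  "coeff (coeff (cst a) j) i = (if i = 0 \<and> j = 0 then a else 0)"
  using coeff_cst_X_power[of a 1 j i] coeff_cst_Y_power[of a 1 j i] coeff_cst_X_power[of a 0 j i] by simp_all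

lemma base_mapsE:
  assumes "f \<in> base_maps"
  obtains \<alpha> \<beta> c \<delta> v where "\<alpha> \<noteq> 0" "\<delta> \<noteq> 0" "f = (cst \<alpha> * X + cst \<beta> * Y + cst c, cst \<delta> * Y + cst v)"
proof -
  from assms have fE: "f \<in> elementary_maps" and fA: "f \<in> affine_maps"
    by simp_all
  from fE obtain \<alpha> \<delta> p v where f: "\<alpha> \<noteq> 0" "\<delta> \<noteq> 0" "f = (cst \<alpha> * X + in_x p Y, cst \<delta> * Y + cst v)"
    by (rule elementaryE)
  from fA obtain m11 m12 m21 m22 a1 a2 where
    g: "f = (cst m11 * X + cst m12 * Y + cst a1, cst m21 * X + cst m22 * Y + cst a2)"
    by (rule affineE)
  have "degree p \<le> 1"
  proof (rule degree_le, intro allI impI)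
    fix j :: nat
    assume "1 < j"
    have "cst \<alpha> * X + in_x p Y = cst m11 * X + cst m12 * Y + cst a1"
      using f(3) g by simp
    then have "coeff (coeff (cst \<alpha> * X + in_x p Y) j) 0 = coeff (coeff (cst m11 * X + cst m12 * Y + cst a1) j) 0"
      by simp
    with \<open>1 < j\<close> show "coeff p j = 0"
      by (simp add: coeff_affine coeff_in_y)
  qed
  then have "f = (cst \<alpha> * X + cst (coeff p 1) * Y + cst (coeff p 0), cst \<delta> * Y + cst v)"
    by (simp add: f(3) in_y_affine add.assoc)
  with f(1,2) show thesis
    by (rule that)
qed

text \<open>The flag is True if the first letter is affine. With the starting side explicit, the
  condition for joining two words becomes a parity.\<close>

fun alternates :: "bool \<Rightarrow> 'a::field pmap list \<Rightarrow> bool" where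
  "alternates s [] = True"
| "alternates s (g # gs) =
     (g \<in> (if s then affine_maps else elementary_maps) - base_maps \<and> alternates (\<not> s) gs)"

lemma alternating_iff_alternates: "alternating gs \<longleftrightarrow> gs \<noteq> [] \<and> (\<exists>s. alternates s gs)"
proof -
  have *: "set gs \<subseteq> (affine_maps - base_maps) \<union> (elementary_maps - base_maps) \<and>
     successively (\<lambda>g h. g \<in> affine_maps - base_maps \<and> h \<in> elementary_maps - base_maps \<or>
       g \<in> elementary_maps - base_maps \<and> h \<in> affine_maps - base_maps) gs \<longleftrightarrow> alternates True gs \<or> alternates False gs"
    (is "?A gs \<longleftrightarrow> _") for gs :: "'a pmap list"
  proof (induction gs)
    case (Cons g gs)
    show ?case
    proof (cases gs)
      case Nil
      then show ?thesis
        by auto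
    next
      case [simp]: (Cons h hs)
      show ?thesis
        using Cons.IH by simp blast
    qed
  qed simp
  show ?thesis
    unfolding alternating_def * by (metis (full_types))
qed

lemma alternates_append:
  "alternates s (gs @ hs) \<longleftrightarrow> alternates s gs \<and> alternates (s \<noteq> odd (length gs)) hs"
  by (induction gs arbitrary: s) auto

lemma alternates_carrier: "alternates s gs \<Longrightarrow> set gs \<subseteq> carrier GA2"
  by (induction gs arbitrary: s) (auto simp: affine_carrier elementary_carrier split: if_splits)

section \<open>Degree growth along alternating words\<close>

lemma degree_add_const: "degree (p + cst c) = degree p"
  by (cases p) (simp add: cst_def)

lemma degree_cst_mult: "c \<noteq> 0 \<Longrightarrow> degree (cst c * p) = degree p"
  by (simp add: cst_def)

lemma degree_cst_mult_le: "degree (cst c * p) \<le> degree p"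
  by (simp add: cst_def)

text \<open>An elementary letter makes the first component the larger one, an affine letter makes the
  second component at least as large again.\<close>

lemma total_degree_alternates:
  assumes "alternates s gs" "gs \<noteq> []"
  shows "total_degree (snd (pmap_prod gs)) \<ge> 1 \<and>
    (if s then total_degree (fst (pmap_prod gs)) \<le> total_degree (snd (pmap_prod gs)) \<and>
       (length gs \<ge> 2 \<longrightarrow> total_degree (snd (pmap_prod gs)) \<ge> 2)
     else total_degree (snd (pmap_prod gs)) < total_degree (fst (pmap_prod gs)))"
  using assms
proof (induction gs arbitrary: s)
  case (Cons g gs)
  define P Q where "P = subst2 (fst (pmap_prod gs)) (X * Y) Y" and "Q = subst2 (snd (pmap_prod gs)) (X * Y) Y"
  have tP: "total_degree (fst (pmap_prod gs)) = degree P" and tQ: "total_degree (snd (pmap_prod gs)) = degree Q"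
    by (simp_all add: total_degree_def P_def Q_def)
  have comp: "fst (pmap_prod (g # gs)) = subst2 (fst g) (fst (pmap_prod gs)) (snd (pmap_prod gs))"
    "snd (pmap_prod (g # gs)) = subst2 (snd g) (fst (pmap_prod gs)) (snd (pmap_prod gs))"
    by (simp_all add: mult_GA2 pmap_comp_def)
  have t: "total_degree (fst (pmap_prod (g # gs))) = degree (subst2 (fst g) P Q)"
    "total_degree (snd (pmap_prod (g # gs))) = degree (subst2 (snd g) P Q)"
    unfolding comp total_degree_def subst2_subst2 P_def Q_def by simp_all
  have nil: "P = X * Y" "Q = Y" if "gs = []"
    using that by (simp_all add: P_def Q_def one_GA2)
  have dXY: "degree (X * Y :: 'a poly2) = 1" "degree (Y :: 'a poly2) = 1"
    by (simp_all add: X_def Y_def)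
  show ?case
  proof (cases s)
    case True
    then obtain m11 m12 m21 m22 a1 a2 where g: "m21 \<noteq> 0"
      "g = (cst m11 * X + cst m12 * Y + cst a1, cst m21 * X + cst m22 * Y + cst a2)"
      using Cons.prems by (auto elim: affine_not_elementaryE)
    have e: "degree (subst2 (fst g) P Q) = degree (cst m11 * P + cst m12 * Q)"
      "degree (subst2 (snd g) P Q) = degree (cst m21 * P + cst m22 * Q)"
      by (simp_all add: g(2) subst2_add subst2_mult degree_add_const)
    \<comment> \<open>For an empty tail P = x y and Q = y have the same degree, and the coefficient
      m21 of x y prevents cancellation. Otherwise the tail starts with an elementary letter and P
      dominates Q strictly.\<close>
    have PQ: "degree (cst m21 * P + cst m22 * Q) = degree P \<and> degree Q \<le> degree P \<and> degree P \<ge> 1 \<and> (gs \<noteq> [] \<longrightarrow> degree P \<ge> 2)"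
    proof (cases "gs = []")
      case nl: True
      have "coeff (coeff (cst m21 * (X * Y) + cst m22 * Y) 1) 1 = m21"
        using coeff_monomial2[of m21 1 1 1 1] coeff_cst_Y_power[of m22 1 1 1] by simp
      with g(1) have "coeff (cst m21 * (X * Y) + cst m22 * Y) 1 \<noteq> 0"
        by (metis coeff_0)
      then have "degree (cst m21 * (X * Y) + cst m22 * Y) \<ge> 1"
        by (rule le_degree)
      moreover have "degree (cst m21 * (X * Y) + cst m22 * Y) \<le> 1"
        by (rule degree_add_le) (use degree_cst_mult_le[of _ "X * Y :: 'a poly2"] degree_cst_mult_le[of _ "Y :: 'a poly2"] in \<open>simp_all add: dXY\<close>)
      ultimately show ?thesis
        by (simp add: nl nil dXY)
    next
      case False
      with Cons.IH[of False] Cons.prems True have IH: "degree Q \<ge> 1" "degree Q < degree P"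
        by (auto simp: tP tQ)
      have "degree (cst m21 * P + cst m22 * Q) = degree (cst m21 * P)"
        by (rule degree_add_eq_left) (use IH g(1) degree_cst_mult_le[of m22 Q] in \<open>simp add: degree_cst_mult\<close>)
      with IH g(1) show ?thesis
        by (simp add: degree_cst_mult)
    qed
    have "degree (cst m11 * P + cst m12 * Q) \<le> degree P"
      using PQ degree_cst_mult_le[of m11 P] degree_cst_mult_le[of m12 Q] by (intro degree_add_le) auto
    with PQ True show ?thesis
      unfolding t e by (cases gs) auto
  next
    case False
    then obtain \<alpha> \<beta> p v where g: "\<alpha> \<noteq> 0" "\<beta> \<noteq> 0" "degree p \<ge> 2" "g = (cst \<alpha> * X + in_x p Y, cst \<beta> * Y + cst v)"
      using Cons.prems by (auto elim: elementary_not_affineE)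
    have PQ: "degree P \<le> degree Q" "degree Q \<ge> 1"
      using Cons.IH[of True] Cons.prems False nil dXY by (cases "gs = []"; simp add: tP tQ)+
    \<comment> \<open>P has at most the degree of Q and p has degree at least 2, so p(Q) outgrows
      P.\<close>
    have "degree (cst \<alpha> * P + in_x p Q) = degree (in_x p Q)"
    proof (rule degree_add_eq_right)
      have "degree (cst \<alpha> * P) \<le> degree Q"
        using PQ degree_cst_mult_le[of \<alpha> P] by simp
      also have "\<dots> < degree p * degree Q"
        using PQ g(3) by simp
      finally show "degree (cst \<alpha> * P) < degree (in_x p Q)"
        by (simp add: degree_in_x)
    qed
    moreover have "degree Q < degree p * degree Q"
      using PQ g(3) by simp
    ultimately show ?thesis
      unfolding t using False PQ g by (simp add: subst2_add subst2_mult subst2_in_x degree_in_x degree_add_const degree_cst_mult)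
  qed
qed simp

lemma total_degree_affine:
  fixes f :: "'a::field pmap"
  assumes "f \<in> affine_maps"
  shows "total_degree (fst f) \<le> 1 \<and> total_degree (snd f) \<le> 1"
proof -
  have dXY: "degree (X * Y :: 'a poly2) = 1" "degree (Y :: 'a poly2) = 1"
    by (simp_all add: X_def Y_def)
  have "degree (cst b * (X * Y) + cst c * Y + cst d) \<le> 1" for b c d :: 'a
    unfolding degree_add_const by (rule degree_add_le) (use degree_cst_mult_le[of _ "X * Y :: 'a poly2"] degree_cst_mult_le[of _ "Y :: 'a poly2"] in \<open>simp_all add: dXY\<close>)
  then show ?thesis
    using assms by (auto elim!: affineE simp: total_degree_def subst2_add subst2_mult)
qed

text \<open>From two letters on, one component has total degree at least 2, which no affine map
  allows; a single letter is outside by definition. All later arguments about the amalgamated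
  product reduce to this.\<close>

lemma alternates_not_base:
  assumes "alternates s gs" "gs \<noteq> []"
  shows "pmap_prod gs \<notin> base_maps"
proof
  assume b: "pmap_prod gs \<in> base_maps"
  note t = total_degree_affine[of "pmap_prod gs"] total_degree_alternates[OF assms]
  show False
  proof (cases "length gs \<ge> 2")
    case True
    then show ?thesis
      using b t by (auto split: if_splits)
  next
    case False
    then obtain g where "gs = [g]"
      using assms(2) by (cases gs; cases "tl gs") auto
    moreover from this assms have "g \<in> carrier GA2"
      using alternates_carrier by fastforce
    ultimately show ?thesis
      using assms(1) b by (auto split: if_splits)
  qed
qed


section \<open>Reduced words in the amalgamated product\<close>

declare Int_iff [simp del]

abbreviation side :: "bool \<Rightarrow> 'a::field pmap set" where
  "side s \<equiv> if s then affine_maps else elementary_maps"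

lemma subgroup_side: "subgroup (side s) GA2"
  by (simp add: subgroup_affine subgroup_elementary)

lemma subgroup_base: "subgroup (base_maps :: 'a::field pmap set) GA2"
  by (rule GA2.subgroups_Inter_pair[OF subgroup_affine subgroup_elementary])

lemma base_one: "\<one>\<^bsub>GA2\<^esub> \<in> base_maps"
  by (rule subgroup.one_closed[OF subgroup_base])

lemma base_side: "b \<in> base_maps \<Longrightarrow> b \<in> side s"
  by auto

lemma side_carrier: "g \<in> side s \<Longrightarrow> g \<in> carrier GA2"
  by (rule subgroup.mem_carrier[OF subgroup_side])

lemma base_carrier: "g \<in> base_maps \<Longrightarrow> g \<in> carrier GA2"
  by (rule subgroup.mem_carrier[OF subgroup_base])

lemma side_mult: "g \<in> side s \<Longrightarrow> h \<in> side s \<Longrightarrow> g \<otimes>\<^bsub>GA2\<^esub> h \<in> side s"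
  by (rule subgroup.m_closed[OF subgroup_side])

lemma side_inv: "g \<in> side s \<Longrightarrow> inv\<^bsub>GA2\<^esub> g \<in> side s"
  by (rule subgroup.m_inv_closed[OF subgroup_side])

lemma letter_inv:
  assumes "g \<in> side s - base_maps"
  shows "inv\<^bsub>GA2\<^esub> g \<in> side s - base_maps"
proof -
  have "inv\<^bsub>GA2\<^esub> g \<notin> base_maps"
  proof
    assume "inv\<^bsub>GA2\<^esub> g \<in> base_maps"
    then have "inv\<^bsub>GA2\<^esub> (inv\<^bsub>GA2\<^esub> g) \<in> base_maps"
      by (rule subgroup.m_inv_closed[OF subgroup_base])
    with assms side_carrier[of g s] show False
      by simp
  qed
  with assms side_inv[of g s] show ?thesis
    by blast
qed

lemma base_mult_letter:
  assumes b: "b \<in> base_maps" and g: "g \<in> side s - base_maps"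
  shows "b \<otimes>\<^bsub>GA2\<^esub> g \<in> side s - base_maps"
proof -
  have c: "b \<in> carrier GA2" "g \<in> carrier GA2"
    using b g base_carrier side_carrier[of g s] by blast+
  have "b \<otimes>\<^bsub>GA2\<^esub> g \<notin> base_maps"
  proof
    assume "b \<otimes>\<^bsub>GA2\<^esub> g \<in> base_maps"
    then have "inv\<^bsub>GA2\<^esub> b \<otimes>\<^bsub>GA2\<^esub> (b \<otimes>\<^bsub>GA2\<^esub> g) \<in> base_maps"
      by (rule subgroup.m_closed[OF subgroup_base subgroup.m_inv_closed[OF subgroup_base b]])
    with c g show False
      by (simp flip: GA2.m_assoc)
  qed
  moreover have "b \<otimes>\<^bsub>GA2\<^esub> g \<in> side s"
    using side_mult[OF base_side[OF b]] g by blast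
  ultimately show ?thesis
    by blast
qed

definition inverse_word :: "'a::field pmap list \<Rightarrow> 'a pmap list" where
  "inverse_word gs = rev (map (\<lambda>g. inv\<^bsub>GA2\<^esub> g) gs)"

lemma length_inverse_word [simp]: "length (inverse_word gs) = length gs"
  by (simp add: inverse_word_def)

text \<open>The first letter is now the inverse of the old last one, whose side is s after length
  minus one flips.\<close>

lemma alternates_inverse_word:
  "alternates s gs \<Longrightarrow> alternates (s = odd (length gs)) (inverse_word gs)"
proof (induction gs arbitrary: s)
  case (Cons g gs)
  then have g: "g \<in> side s - base_maps" and "alternates (\<not> s) gs"
    by simp_all
  from Cons.IH[OF this(2)] letter_inv[OF g] show ?case
    by (auto simp: inverse_word_def alternates_append split: if_splits)
qed (simp add: inverse_word_def)

lemma inverse_word_carrier: "set gs \<subseteq> carrier GA2 \<Longrightarrow> set (inverse_word gs) \<subseteq> carrier GA2"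
  by (auto simp: inverse_word_def)

lemma pmap_prod_inverse_word:
  "set gs \<subseteq> carrier GA2 \<Longrightarrow> pmap_prod (inverse_word gs) = inv\<^bsub>GA2\<^esub> pmap_prod gs"
proof (induction gs)
  case (Cons g gs)
  have "inverse_word (g # gs) = inverse_word gs @ [inv\<^bsub>GA2\<^esub> g]"
    by (simp add: inverse_word_def)
  with Cons inverse_word_carrier[of gs] show ?case
    by (simp add: pmap_prod_append GA2.inv_mult_group pmap_prod_carrier)
qed (simp add: inverse_word_def)

text \<open>The first letters g and h are compared through k = g^(-1) h. If they lie on different
  sides, or k is outside the base, inverting one word and joining it to the other gives an
  alternating word with product 1, against \<open>alternates_not_base\<close>. A base element k is
  absorbed by the next letter and the induction continues.\<close>

lemma alternates_length_unique:
  fixes gs hs :: "'a::field pmap list"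
  assumes "alternates s gs" "alternates t hs" "pmap_prod gs = pmap_prod hs"
  shows "length gs = length hs"
  using assms
proof (induction gs arbitrary: s t hs)
  case Nil
  have "pmap_prod hs \<in> base_maps"
    unfolding Nil(3)[symmetric] pmap_prod_Nil by (rule base_one)
  then have "hs = []"
    using alternates_not_base[OF Nil(2)] by blast
  then show ?case
    by simp
next
  case (Cons g gs)
  have one: "(\<one>\<^bsub>GA2\<^esub> :: 'a pmap) \<in> base_maps"
    by (rule base_one)
  show ?case
  proof (cases hs)
    case Nil
    with Cons.prems one alternates_not_base[of s "g # gs"] show ?thesis
      by auto
  next
    case hs: (Cons h hs')
    have g: "g \<in> side s - base_maps" and gs: "alternates (\<not> s) gs"
      and h: "h \<in> side t - base_maps" and hs': "alternates (\<not> t) hs'"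
      using Cons.prems hs by simp_all
    have gc: "g \<in> carrier GA2" "h \<in> carrier GA2"
      using g h side_carrier[of g s] side_carrier[of h t] by blast+
    have c: "set gs \<subseteq> carrier GA2" "set hs' \<subseteq> carrier GA2"
      using gs hs' alternates_carrier by blast+
    note cc = gc pmap_prod_carrier[OF c(1)] pmap_prod_carrier[OF c(2)]
    have eq: "g \<otimes>\<^bsub>GA2\<^esub> pmap_prod gs = h \<otimes>\<^bsub>GA2\<^esub> pmap_prod hs'"
      using Cons.prems(3) hs by simp
    define k where "k = inv\<^bsub>GA2\<^esub> g \<otimes>\<^bsub>GA2\<^esub> h"
    have kc: "k \<in> carrier GA2"
      using gc by (simp add: k_def)
    have "pmap_prod gs = inv\<^bsub>GA2\<^esub> g \<otimes>\<^bsub>GA2\<^esub> (g \<otimes>\<^bsub>GA2\<^esub> pmap_prod gs)"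
      using cc by (simp flip: GA2.m_assoc)
    then have k: "pmap_prod gs = k \<otimes>\<^bsub>GA2\<^esub> pmap_prod hs'"
      unfolding eq k_def using cc by (simp add: GA2.m_assoc)
    have inv: "inv\<^bsub>GA2\<^esub> pmap_prod gs \<otimes>\<^bsub>GA2\<^esub> (k \<otimes>\<^bsub>GA2\<^esub> pmap_prod hs') = \<one>\<^bsub>GA2\<^esub>"
      using cc kc by (simp add: k)
    show ?thesis
    proof (cases "s = t")
      case False
      have "alternates (s = even (length gs)) (inverse_word (g # gs) @ hs)"
        using alternates_inverse_word[OF Cons.prems(1)] Cons.prems(2) False
        by (cases t; cases "even (length gs)") (simp_all add: alternates_append del: alternates.simps)
      from alternates_not_base[OF this] hs have "pmap_prod (inverse_word (g # gs) @ hs) \<notin> base_maps"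
        by simp
      moreover have "pmap_prod (inverse_word (g # gs) @ hs) = \<one>\<^bsub>GA2\<^esub>"
        unfolding pmap_prod_append[OF inverse_word_carrier[OF alternates_carrier[OF Cons.prems(1)]]
            alternates_carrier[OF Cons.prems(2)]] pmap_prod_inverse_word[OF alternates_carrier[OF Cons.prems(1)]]
          Cons.prems(3)[symmetric]
        by (rule GA2.l_inv[OF pmap_prod_carrier[OF alternates_carrier[OF Cons.prems(1)]]])
      ultimately show ?thesis
        using one by simp
    next
      case True
      have ks: "k \<in> side s"
        unfolding k_def using g h True side_inv[of g s] side_mult by blast
      show ?thesis
      proof (cases "k \<in> base_maps")
        case False
        have "alternates (s \<noteq> odd (length gs)) (inverse_word gs @ k # hs')"
          using alternates_inverse_word[OF gs] ks False hs' True
          by (auto simp: alternates_append)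
        from alternates_not_base[OF this] have "pmap_prod (inverse_word gs @ k # hs') \<notin> base_maps"
          by simp
        moreover have "pmap_prod (inverse_word gs @ k # hs') = \<one>\<^bsub>GA2\<^esub>"
          using inverse_word_carrier[OF c(1)] kc c inv
          by (simp add: pmap_prod_append pmap_prod_inverse_word)
        ultimately show ?thesis
          using one by simp
      next
        case kb: True
        show ?thesis
        proof (cases hs')
          case Nil
          with k kc kb alternates_not_base[OF gs] have "gs = []"
            by auto
          with hs Nil show ?thesis
            by simp
        next
          case hs'': (Cons l ls)
          have l: "l \<in> side (\<not> t) - base_maps" "alternates t ls"
            using hs' hs'' by simp_all
          have lc: "l \<in> carrier GA2" "pmap_prod ls \<in> carrier GA2"
            using c(2) hs'' pmap_prod_carrier[of ls] by auto
          have "alternates (\<not> t) ((k \<otimes>\<^bsub>GA2\<^esub> l) # ls)"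
            using base_mult_letter[OF kb l(1)] l(2) by simp
          from Cons.IH[OF gs this] have "length gs = length ((k \<otimes>\<^bsub>GA2\<^esub> l) # ls)"
            using k kc lc by (simp add: hs'' GA2.m_assoc)
          with hs hs'' show ?thesis
            by simp
        qed
      qed
    qed
  qed
qed

text \<open>A generator in front of a reduced word is absorbed, prepended, or merged with the first
  letter; a merged letter that lands in the base is absorbed by its successor.\<close>

lemma alternates_of_generators:
  assumes "set gs \<subseteq> affine_maps \<union> elementary_maps"
  shows "pmap_prod gs \<in> base_maps \<or> (\<exists>s hs. hs \<noteq> [] \<and> alternates s hs \<and> pmap_prod hs = pmap_prod gs)"
  using assms
proof (induction gs)
  case Nil
  show ?case
    by (intro disjI1) (simp only: pmap_prod_Nil base_one)
next
  case (Cons g gs)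
  obtain s where g: "g \<in> side s"
    using Cons.prems by (metis Un_iff insert_subset list.simps(15))
  then have gc: "g \<in> carrier GA2"
    by (rule side_carrier)
  have single: ?case if k: "k \<in> side r" "pmap_prod (g # gs) = k" for k r
  proof (cases "k \<in> base_maps")
    case True
    with k show ?thesis
      by simp
  next
    case False
    with k side_carrier[OF k(1)] show ?thesis
      by (intro disjI2 exI[of _ r] exI[of _ "[k]"]) simp
  qed
  from Cons.IH Cons.prems consider "pmap_prod gs \<in> base_maps"
    | t h hs where "alternates t (h # hs)" "pmap_prod (h # hs) = pmap_prod gs"
    by (metis insert_subset list.simps(15) neq_Nil_conv)
  then show ?case
  proof cases
    case 1
    then show ?thesis
      using side_mult[OF g base_side] by (intro single[of _ s]) simp_all
  next
    case 2
    have h: "h \<in> side t - base_maps" "alternates (\<not> t) hs"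
      using 2 by simp_all
    have hc: "h \<in> carrier GA2" "pmap_prod hs \<in> carrier GA2"
      using alternates_carrier[OF 2(1)] pmap_prod_carrier[of hs] by auto
    have p: "pmap_prod (g # gs) = (g \<otimes>\<^bsub>GA2\<^esub> h) \<otimes>\<^bsub>GA2\<^esub> pmap_prod hs"
      using gc hc by (simp add: GA2.m_assoc flip: 2(2))
    have absorb: ?thesis if "g \<otimes>\<^bsub>GA2\<^esub> h \<in> side t - base_maps"
      using that h(2) p by (intro disjI2 exI[of _ t] exI[of _ "(g \<otimes>\<^bsub>GA2\<^esub> h) # hs"]) simp
    show ?thesis
    proof (cases "g \<in> base_maps")
      case True
      then show ?thesis
        using absorb base_mult_letter h(1) by blast
    next
      case gb: False
      show ?thesis
      proof (cases "s = t")
        case False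
        then show ?thesis
          using g gb 2 by (intro disjI2 exI[of _ s] exI[of _ "g # h # hs"]) auto
      next
        case st: True
        then have gh: "g \<otimes>\<^bsub>GA2\<^esub> h \<in> side t"
          using side_mult g h(1) by blast
        show ?thesis
        proof (cases "g \<otimes>\<^bsub>GA2\<^esub> h \<in> base_maps")
          case False
          with gh show ?thesis
            by (intro absorb) blast
        next
          case ghb: True
          show ?thesis
          proof (cases hs)
            case Nil
            with gh p gc hc show ?thesis
              by (intro single[of _ t]) simp_all
          next
            case hs: (Cons k ks)
            have k: "k \<in> side (\<not> t) - base_maps" "alternates t ks"
              using h(2) hs by simp_all
            have kc: "k \<in> carrier GA2" "pmap_prod ks \<in> carrier GA2"
              using alternates_carrier[OF h(2)] hs pmap_prod_carrier[of ks] by auto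
            have "pmap_prod (g # gs) = pmap_prod ((g \<otimes>\<^bsub>GA2\<^esub> h \<otimes>\<^bsub>GA2\<^esub> k) # ks)"
              unfolding p using hs kc gc hc by (simp add: GA2.m_assoc)
            moreover have "alternates (\<not> t) ((g \<otimes>\<^bsub>GA2\<^esub> h \<otimes>\<^bsub>GA2\<^esub> k) # ks)"
              using base_mult_letter[OF ghb k(1)] k(2) by simp
            ultimately show ?thesis
              by (metis list.distinct(1))
          qed
        qed
      qed
    qed
  qed
qed

lemma len_eq_length:
  assumes "alternates s gs" "gs \<noteq> []"
  shows "len (pmap_prod gs) = length gs"
proof -
  have "(THE n. \<exists>hs. alternating hs \<and> pmap_prod hs = pmap_prod gs \<and> length hs = n) = length gs"
  proof (rule the_equality)
    show "\<exists>hs. alternating hs \<and> pmap_prod hs = pmap_prod gs \<and> length hs = length gs"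
      using assms by (auto simp: alternating_iff_alternates)
    show "n = length gs" if "\<exists>hs. alternating hs \<and> pmap_prod hs = pmap_prod gs \<and> length hs = n" for n
      using that alternates_length_unique[OF _ assms(1)] by (auto simp: alternating_iff_alternates)
  qed
  then show ?thesis
    using alternates_not_base[OF assms] by (simp add: len_def)
qed

lemma cyclically_reducedE:
  assumes "cyclically_reduced g"
  obtains s gs where "gs \<noteq> []" "alternates s gs" "pmap_prod gs = g" "even (length gs)"
proof -
  have g: "g \<in> carrier GA2" "even (len g)" "len g > 0"
    using assms by (simp_all add: cyclically_reduced_def)
  have "g \<notin> base_maps"
  proof
    assume "g \<in> base_maps"
    then have "len g = 0"
      by (simp add: len_def)
    with g show False
      by simp
  qed
  moreover obtain hs where "set hs \<subseteq> affine_maps \<union> elementary_maps" "pmap_prod hs = g"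
    using jung_van_der_kulk[OF g(1)] by (auto simp: tame_def)
  ultimately obtain s gs where gs: "gs \<noteq> []" "alternates s gs" "pmap_prod gs = g"
    using alternates_of_generators[of hs] by blast
  with len_eq_length[OF gs(2,1)] g that show thesis
    by simp
qed

section \<open>Involutions commuting with a cyclically reduced element\<close>

lemma two_neq_0: "CHAR('a::field) \<noteq> 2 \<Longrightarrow> (2 :: 'a) \<noteq> 0"
proof
  assume "CHAR('a) \<noteq> 2" "(2 :: 'a) = 0"
  then have "CHAR('a) dvd 2"
    using of_nat_eq_0_iff_char_dvd[where ?'a = 'a, of 2] by simp
  moreover from this have "CHAR('a) \<noteq> 0"
    by (intro notI) simp
  ultimately have "CHAR('a) \<le> 2" "CHAR('a) \<noteq> 0"
    by (simp_all add: dvd_imp_le)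
  with \<open>CHAR('a) \<noteq> 2\<close> show False
    using CHAR_not_1[where ?'a = 'a] by linarith
qed

lemma affine_eq_iff:
  "cst a * X + cst b * Y + cst c = cst a' * X + cst b' * Y + cst c' \<longleftrightarrow> a = a' \<and> b = b' \<and> c = c'"
proof
  assume eq: "cst a * X + cst b * Y + cst c = cst a' * X + cst b' * Y + cst c'"
  have "coeff (coeff (cst a * X + cst b * Y + cst c) j) i = coeff (coeff (cst a' * X + cst b' * Y + cst c') j) i" for i j
    by (simp only: eq)
  from this[of 0 1] this[of 1 0] this[of 0 0] show "a = a' \<and> b = b' \<and> c = c'"
    by (simp_all add: coeff_affine)
qed simp

text \<open>The linear part is triangular with square 1, so its diagonal entries are 1 or -1. As 2
  \<noteq> 0, diagonal (1, 1) leaves only the identity, and diagonal (-1, -1) forces the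
  off-diagonal entry to vanish. The mixed diagonals do occur among involutions, so only the letters
  of a word can exclude them.\<close>

lemma base_involution_cases:
  fixes x :: "'a::field pmap"
  assumes char: "CHAR('a) \<noteq> 2" and x: "x \<in> base_maps" "pmap_comp x x = (X, Y)" "x \<noteq> (X, Y)"
  obtains (central) u v where "x = point_reflection u v"
    | (X) \<beta> c where "x = (cst (- 1) * X + cst \<beta> * Y + cst c, Y)"
    | (Y) \<beta> c v where "x = (X + cst \<beta> * Y + cst c, cst (- 1) * Y + cst v)"
proof -
  note two = two_neq_0[OF char]
  have double: "z = 0" if "z + z = 0" for z :: 'a
    using that two by (metis mult_2 mult_eq_0_iff)
  from x(1) obtain \<alpha> \<beta> c \<delta> v where xe: "x = (cst \<alpha> * X + cst \<beta> * Y + cst c, cst \<delta> * Y + cst v)"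
    by (rule base_mapsE)
  then have xe': "x = (cst \<alpha> * X + cst \<beta> * Y + cst c, cst 0 * X + cst \<delta> * Y + cst v)"
    by simp
  have one: "(X, Y) = (cst 1 * X + cst 0 * Y + cst 0, cst 0 * X + cst 1 * Y + cst (0::'a))"
    by simp
  have eqs: "\<alpha> * \<alpha> = 1" "\<delta> * \<delta> = 1" "\<alpha> * \<beta> + \<beta> * \<delta> = 0" "\<alpha> * c + \<beta> * v + c = 0" "\<delta> * v + v = 0"
    using x(2) unfolding xe' pmap_comp_affine one prod.inject affine_eq_iff by simp_all
  then have ad: "\<alpha> = 1 \<or> \<alpha> = - 1" "\<delta> = 1 \<or> \<delta> = - 1"
    by (metis square_eq_1_iff)+
  consider "\<alpha> = 1" "\<delta> = 1" | "\<alpha> = - 1" "\<delta> = - 1" | "\<alpha> = - 1" "\<delta> = 1" | "\<alpha> = 1" "\<delta> = - 1"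
    using ad by blast
  then show thesis
  proof cases
    case 1
    with eqs double[of \<beta>] double[of v] double[of c] have "\<beta> = 0" "v = 0" "c = 0"
      by auto
    with 1 x(3) xe show thesis
      by simp
  next
    case 2
    with eqs have "- (\<beta> + \<beta>) = 0"
      by simp
    then have "\<beta> = 0"
      using double[of \<beta>] by (metis neg_equal_0_iff_equal)
    with 2 xe have "x = point_reflection c v"
      by (simp add: point_reflection_def cst_minus)
    then show thesis
      by (rule central)
  next
    case 3
    with eqs double[of v] have "v = 0"
      by simp
    with 3 xe have "x = (cst (- 1) * X + cst \<beta> * Y + cst c, Y)"
      by simp
    then show thesis
      by (rule X)
  next
    case 4
    with xe have "x = (X + cst \<beta> * Y + cst c, cst (- 1) * Y + cst v)"
      by simp
    then show thesis
      by (rule Y)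
  qed
qed

section \<open>Conjugating base involutions by letters\<close>

lemma commutes_imp_conjugate_eq:
  assumes "g \<in> carrier GA2" "x \<in> carrier GA2" "x \<otimes>\<^bsub>GA2\<^esub> g = g \<otimes>\<^bsub>GA2\<^esub> x"
  shows "g \<otimes>\<^bsub>GA2\<^esub> x \<otimes>\<^bsub>GA2\<^esub> inv\<^bsub>GA2\<^esub> g = x" "inv\<^bsub>GA2\<^esub> g \<otimes>\<^bsub>GA2\<^esub> x \<otimes>\<^bsub>GA2\<^esub> g = x"
proof -
  show "g \<otimes>\<^bsub>GA2\<^esub> x \<otimes>\<^bsub>GA2\<^esub> inv\<^bsub>GA2\<^esub> g = x"
    unfolding assms(3)[symmetric] using assms(1,2) by (simp add: GA2.m_assoc)
  have "inv\<^bsub>GA2\<^esub> g \<otimes>\<^bsub>GA2\<^esub> x \<otimes>\<^bsub>GA2\<^esub> g = inv\<^bsub>GA2\<^esub> g \<otimes>\<^bsub>GA2\<^esub> (g \<otimes>\<^bsub>GA2\<^esub> x)"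
    using assms by (simp add: GA2.m_assoc)
  also have "\<dots> = x"
    using assms(1,2) by (simp flip: GA2.m_assoc)
  finally show "inv\<^bsub>GA2\<^esub> g \<otimes>\<^bsub>GA2\<^esub> x \<otimes>\<^bsub>GA2\<^esub> g = x" .
qed

lemma conjugate_eq_one:
  assumes "h \<in> carrier GA2" "x \<in> carrier GA2" "h \<otimes>\<^bsub>GA2\<^esub> x \<otimes>\<^bsub>GA2\<^esub> inv\<^bsub>GA2\<^esub> h = \<one>\<^bsub>GA2\<^esub>"
  shows "x = \<one>\<^bsub>GA2\<^esub>"
proof -
  have "h \<otimes>\<^bsub>GA2\<^esub> x = (h \<otimes>\<^bsub>GA2\<^esub> x \<otimes>\<^bsub>GA2\<^esub> inv\<^bsub>GA2\<^esub> h) \<otimes>\<^bsub>GA2\<^esub> h"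
    using assms(1,2) by (simp add: GA2.m_assoc)
  with assms show ?thesis
    by simp
qed

lemma conjugate_eqD:
  assumes "e \<in> carrier GA2" "x \<in> carrier GA2" "y = e \<otimes>\<^bsub>GA2\<^esub> x \<otimes>\<^bsub>GA2\<^esub> inv\<^bsub>GA2\<^esub> e"
  shows "pmap_comp e x = pmap_comp y e"
proof -
  have "e \<otimes>\<^bsub>GA2\<^esub> x = y \<otimes>\<^bsub>GA2\<^esub> e"
    using assms by (simp add: GA2.m_assoc)
  then show ?thesis
    by (simp add: mult_GA2)
qed

text \<open>Conjugation by \<open>x \<mapsto> \<kappa> x + p(y)\<close> adds \<open>2 p(y)\<close> to the first component of such a map.\<close>

lemma elementary_conjugate_not_base:
  fixes e :: "'a::field pmap"
  assumes char: "CHAR('a) \<noteq> 2" and e: "e \<in> elementary_maps - base_maps"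
    and x: "x = (cst (- 1) * X + cst \<beta> * Y + cst c, Y)" "x \<in> carrier GA2"
  shows "e \<otimes>\<^bsub>GA2\<^esub> x \<otimes>\<^bsub>GA2\<^esub> inv\<^bsub>GA2\<^esub> e \<notin> base_maps"
proof
  define y where "y = e \<otimes>\<^bsub>GA2\<^esub> x \<otimes>\<^bsub>GA2\<^esub> inv\<^bsub>GA2\<^esub> e"
  assume "e \<otimes>\<^bsub>GA2\<^esub> x \<otimes>\<^bsub>GA2\<^esub> inv\<^bsub>GA2\<^esub> e \<in> base_maps"
  then have "y \<in> base_maps"
    by (simp add: y_def)
  then obtain \<alpha>' \<beta>' c' \<delta>' v' where y: "y = (cst \<alpha>' * X + cst \<beta>' * Y + cst c', cst \<delta>' * Y + cst v')"
    by (rule base_mapsE)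
  have eE: "e \<in> elementary_maps" "e \<notin> affine_maps"
    using e by (auto simp: Int_iff)
  then obtain \<kappa> \<mu> p \<nu> where p: "\<kappa> \<noteq> 0" "degree p \<ge> 2" "e = (cst \<kappa> * X + in_x p Y, cst \<mu> * Y + cst \<nu>)"
    by (rule elementary_not_affineE)
  have "pmap_comp e x = pmap_comp y e"
    by (rule conjugate_eqD[OF elementary_carrier[OF eE(1)] x(2) y_def])
  then have eq: "cst \<kappa> * (cst (- 1) * X + cst \<beta> * Y + cst c) + in_x p Y
      = cst \<alpha>' * (cst \<kappa> * X + in_x p Y) + cst \<beta>' * (cst \<mu> * Y + cst \<nu>) + cst c'"
    by (simp add: pmap_comp_def p(3) x(1) y subst2_add subst2_mult subst2_in_x)
  have "cst (- \<kappa>) * X + cst (\<kappa> * \<beta>) * Y + cst (\<kappa> * c) + in_x p Y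
      = cst (\<alpha>' * \<kappa>) * X + in_x (smult \<alpha>' p) Y + cst (\<beta>' * \<mu>) * Y + cst (\<beta>' * \<nu>) + cst c'"
    using eq by (simp add: in_x_smult cst_mult cst_minus algebra_simps)
  then have co: "coeff (coeff (cst (- \<kappa>) * X + cst (\<kappa> * \<beta>) * Y + cst (\<kappa> * c) + in_x p Y) j) i
      = coeff (coeff (cst (\<alpha>' * \<kappa>) * X + in_x (smult \<alpha>' p) Y + cst (\<beta>' * \<mu>) * Y + cst (\<beta>' * \<nu>) + cst c') j) i" for i j
    by simp
  \<comment> \<open>The coefficient of x forces \<alpha>' = -1. At the degree of p, which lies above
    the affine terms, this makes twice the leading coefficient vanish.\<close>
  from co[where i = 1 and j = 0] have "- \<kappa> = \<alpha>' * \<kappa>"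
    unfolding coeff_add coeff_affine coeff_in_y by simp
  then have "\<alpha>' = - 1"
    using p(1) by (metis mult_minus1 mult_right_cancel)
  moreover from co[where i = 0 and j = "degree p"] have "coeff p (degree p) = \<alpha>' * coeff p (degree p)"
    unfolding coeff_add coeff_affine coeff_in_y using p(2) by simp
  ultimately have "2 * coeff p (degree p) = 0"
    by simp
  with two_neq_0[OF char] p(2) show False
    by auto
qed

text \<open>The second row (m21, m22) of a is a left eigenvector of the linear part of x with
  eigenvalue \<delta>', and its nonzero first entry selects the diagonal entry 1.\<close>

lemma affine_conjugate_snd:
  assumes a: "a \<in> affine_maps - base_maps"
    and x: "x = (X + cst \<beta> * Y + cst c, cst (- 1) * Y + cst v)" "x \<in> carrier GA2"
    and y: "y = a \<otimes>\<^bsub>GA2\<^esub> x \<otimes>\<^bsub>GA2\<^esub> inv\<^bsub>GA2\<^esub> a" "snd y = cst \<delta>' * Y + cst v'"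
  shows "\<delta>' = 1"
proof -
  have aA: "a \<in> affine_maps" "a \<notin> elementary_maps"
    using a by (auto simp: Int_iff)
  then obtain m11 m12 m21 m22 a1 a2 where m: "m21 \<noteq> 0"
    "a = (cst m11 * X + cst m12 * Y + cst a1, cst m21 * X + cst m22 * Y + cst a2)"
    by (rule affine_not_elementaryE)
  have "pmap_comp a x = pmap_comp y a"
    by (rule conjugate_eqD[OF affine_carrier[OF aA(1)] x(2) y(1)])
  then have "cst m21 * (X + cst \<beta> * Y + cst c) + cst m22 * (cst (- 1) * Y + cst v) + cst a2
      = cst \<delta>' * (cst m21 * X + cst m22 * Y + cst a2) + cst v'"
    by (simp add: pmap_comp_def m(2) x(1) y(2) subst2_add subst2_mult)
  then have "cst m21 * X + cst (m21 * \<beta> - m22) * Y + cst (m21 * c + m22 * v + a2)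
      = cst (\<delta>' * m21) * X + cst (\<delta>' * m22) * Y + cst (\<delta>' * a2 + v')"
    by (simp add: cst_add cst_mult cst_diff cst_minus algebra_simps)
  with m(1) show ?thesis
    unfolding affine_eq_iff by simp
qed

text \<open>If the innermost conjugate left the base, it would be a letter on the side of h; between
  the remaining word and the inverse of that word it would form an alternating word, whose product
  is outside the base.\<close>

lemma conjugate_last_letter:
  assumes gs: "alternates s (gs @ [h])" and b: "b \<in> base_maps"
    and conj: "pmap_prod (gs @ [h]) \<otimes>\<^bsub>GA2\<^esub> b \<otimes>\<^bsub>GA2\<^esub> inv\<^bsub>GA2\<^esub> pmap_prod (gs @ [h]) \<in> base_maps"
  shows "h \<otimes>\<^bsub>GA2\<^esub> b \<otimes>\<^bsub>GA2\<^esub> inv\<^bsub>GA2\<^esub> h \<in> base_maps"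
proof (rule ccontr)
  define c where "c = h \<otimes>\<^bsub>GA2\<^esub> b \<otimes>\<^bsub>GA2\<^esub> inv\<^bsub>GA2\<^esub> h"
  assume "h \<otimes>\<^bsub>GA2\<^esub> b \<otimes>\<^bsub>GA2\<^esub> inv\<^bsub>GA2\<^esub> h \<notin> base_maps"
  then have cb: "c \<notin> base_maps"
    by (simp add: c_def)
  have h: "alternates s gs" "h \<in> side (s \<noteq> odd (length gs))"
    using gs by (simp_all add: alternates_append)
  have c: "c \<in> side (s \<noteq> odd (length gs))"
    unfolding c_def by (intro side_mult side_inv h base_side b)
  have "alternates s (gs @ c # inverse_word gs)"
    using alternates_inverse_word[OF h(1)] c cb h(1)
    by (cases s; cases "even (length gs)") (simp_all add: alternates_append)
  from alternates_not_base[OF this] have "pmap_prod (gs @ c # inverse_word gs) \<notin> base_maps"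
    by simp
  moreover have "pmap_prod (gs @ c # inverse_word gs)
      = pmap_prod (gs @ [h]) \<otimes>\<^bsub>GA2\<^esub> b \<otimes>\<^bsub>GA2\<^esub> inv\<^bsub>GA2\<^esub> pmap_prod (gs @ [h])"
    using alternates_carrier[OF h(1)] inverse_word_carrier[of gs] side_carrier[OF h(2)] side_carrier[OF c] base_carrier[OF b]
      pmap_prod_carrier[of gs]
    by (simp add: pmap_prod_append pmap_prod_inverse_word c_def GA2.m_assoc GA2.inv_mult_group)
  ultimately show False
    using conj by simp
qed

text \<open>A reduced word for x has odd length, so it begins and ends on the same side, while gs
  begins and ends on different sides. Conjugation by g or by its inverse therefore causes no
  cancellation and lengthens x, although it has to fix x.\<close>

lemma commuting_involution_base:
  assumes gs: "alternates s gs" "gs \<noteq> []" "even (length gs)" and x: "x \<in> carrier GA2"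
    and xx: "x \<otimes>\<^bsub>GA2\<^esub> x = \<one>\<^bsub>GA2\<^esub>" and comm: "x \<otimes>\<^bsub>GA2\<^esub> pmap_prod gs = pmap_prod gs \<otimes>\<^bsub>GA2\<^esub> x"
  shows "x \<in> base_maps"
proof (rule ccontr)
  assume xb: "x \<notin> base_maps"
  define g where "g = pmap_prod gs"
  have gsc: "set gs \<subseteq> carrier GA2"
    by (rule alternates_carrier[OF gs(1)])
  have g: "g \<in> carrier GA2"
    unfolding g_def by (rule pmap_prod_carrier[OF gsc])
  obtain ks where ks: "set ks \<subseteq> affine_maps \<union> elementary_maps" "pmap_prod ks = x"
    using jung_van_der_kulk[OF x] by (auto simp: tame_def)
  with xb obtain t hs where hs: "hs \<noteq> []" "alternates t hs" "pmap_prod hs = x"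
    using alternates_of_generators[of ks] by blast
  have hsc: "set hs \<subseteq> carrier GA2"
    by (rule alternates_carrier[OF hs(2)])
  \<comment> \<open>A word of even length could be repeated without cancellation, so x would not
    have square 1.\<close>
  have odd: "odd (length hs)"
  proof
    assume "even (length hs)"
    then have "alternates t (hs @ hs)"
      using hs(2) by (simp add: alternates_append)
    from alternates_not_base[OF this] hs(1) have "pmap_prod (hs @ hs) \<notin> base_maps"
      by simp
    moreover have "pmap_prod (hs @ hs) = \<one>\<^bsub>GA2\<^esub>"
      using hsc hs(3) xx by (simp add: pmap_prod_append)
    ultimately show False
      using base_one by metis
  qed
  have cgx: "x \<otimes>\<^bsub>GA2\<^esub> g = g \<otimes>\<^bsub>GA2\<^esub> x"
    using comm by (simp add: g_def)
  have conj: "g \<otimes>\<^bsub>GA2\<^esub> (x \<otimes>\<^bsub>GA2\<^esub> inv\<^bsub>GA2\<^esub> g) = x" "inv\<^bsub>GA2\<^esub> g \<otimes>\<^bsub>GA2\<^esub> (x \<otimes>\<^bsub>GA2\<^esub> g) = x"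
    using commutes_imp_conjugate_eq[OF g x cgx] g x by (simp_all add: GA2.m_assoc)
  show False
  proof (cases "s = t")
    case True
    have "alternates s (gs @ hs @ inverse_word gs)"
      using alternates_inverse_word[OF gs(1)] gs hs(2) odd True
      by (simp add: alternates_append)
    moreover have "pmap_prod (gs @ hs @ inverse_word gs) = pmap_prod hs"
      using gsc hsc inverse_word_carrier[OF gsc] conj(1) hs(3)
      by (simp add: pmap_prod_append pmap_prod_inverse_word flip: g_def)
    ultimately have "length (gs @ hs @ inverse_word gs) = length hs"
      using hs(2) alternates_length_unique by blast
    then show False
      using gs(2) by simp
  next
    case False
    have "alternates t (inverse_word gs @ hs @ gs)"
      using alternates_inverse_word[OF gs(1)] gs hs(2) odd False
      by (cases s) (simp_all add: alternates_append)
    moreover have "pmap_prod (inverse_word gs @ hs @ gs) = pmap_prod hs"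
      using gsc hsc inverse_word_carrier[OF gsc] conj(2) hs(3)
      by (simp add: pmap_prod_append pmap_prod_inverse_word flip: g_def)
    ultimately have "length (inverse_word gs @ hs @ gs) = length hs"
      using hs(2) alternates_length_unique by blast
    then show False
      using gs(2) by simp
  qed
qed

lemma commuting_involution_word:
  fixes x :: "'a::field pmap"
  assumes char: "CHAR('a) \<noteq> 2"
    and gs: "alternates False gs" "gs \<noteq> []" "even (length gs)" and x: "x \<in> carrier GA2" "x \<noteq> (X, Y)"
    and xx: "x \<otimes>\<^bsub>GA2\<^esub> x = \<one>\<^bsub>GA2\<^esub>" and comm: "x \<otimes>\<^bsub>GA2\<^esub> pmap_prod gs = pmap_prod gs \<otimes>\<^bsub>GA2\<^esub> x"
  shows "\<exists>u v. x = point_reflection u v"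
proof -
  have xb: "x \<in> base_maps"
    by (rule commuting_involution_base[OF gs x(1) xx comm])
  define g where "g = pmap_prod gs"
  have gsc: "set gs \<subseteq> carrier GA2"
    by (rule alternates_carrier[OF gs(1)])
  have g: "g \<in> carrier GA2"
    unfolding g_def by (rule pmap_prod_carrier[OF gsc])
  have cgx: "x \<otimes>\<^bsub>GA2\<^esub> g = g \<otimes>\<^bsub>GA2\<^esub> x"
    using comm by (simp add: g_def)
  note conj = commutes_imp_conjugate_eq[OF g x(1) cgx]
  obtain e ks where ks: "gs = e # ks"
    using gs(2) by (cases gs) auto
  \<comment> \<open>The word has the form e ... e' a, elementary in front and affine at the end; for
    length 2 the letters e and e' coincide.\<close>
  obtain ms e' a where ms: "gs = ms @ [e', a]"
  proof -
    have "ks \<noteq> []"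
      using gs(3) ks by auto
    then obtain a ls where a: "gs = (e # ls) @ [a]"
      using ks by (metis append_Cons rev_exhaust)
    then obtain e' ms where "e # ls = ms @ [e']"
      by (metis list.distinct(1) rev_exhaust)
    with a that show thesis
      by simp
  qed
  have ev: "even (length ms)"
    using gs(3) ms by simp
  have alt_ms: "alternates False (ms @ [e'])"
    and e': "e' \<in> elementary_maps - base_maps" and a: "a \<in> affine_maps - base_maps"
    using gs(1) ev unfolding ms by (simp_all add: alternates_append)
  have e: "e \<in> elementary_maps - base_maps"
    using gs(1) by (simp add: ks)
  have ac: "a \<in> carrier GA2"
    using gsc by (simp add: ms)
  from char xb xx[unfolded mult_GA2 one_GA2] x(2) show ?thesis
  proof (cases rule: base_involution_cases)
    case central
    then show ?thesis
      by blast
  next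
    case (X \<beta> c)
    \<comment> \<open>Diagonal (-1, 1): in the inverse word the letter next to x is the inverse of
      e, and conjugation by it already leaves the base.\<close>
    have alt: "alternates True (inverse_word ks @ [inv\<^bsub>GA2\<^esub> e])"
      using alternates_inverse_word[OF gs(1)] gs(3) by (simp add: ks inverse_word_def)
    have prod: "pmap_prod (inverse_word ks @ [inv\<^bsub>GA2\<^esub> e]) = inv\<^bsub>GA2\<^esub> g"
      using pmap_prod_inverse_word[OF gsc] by (simp add: ks inverse_word_def g_def)
    have "inv\<^bsub>GA2\<^esub> e \<otimes>\<^bsub>GA2\<^esub> x \<otimes>\<^bsub>GA2\<^esub> inv\<^bsub>GA2\<^esub> (inv\<^bsub>GA2\<^esub> e) \<in> base_maps"
      by (rule conjugate_last_letter[OF alt xb]) (simp only: prod GA2.inv_inv[OF g] conj(2) xb)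
    moreover have "inv\<^bsub>GA2\<^esub> e \<in> elementary_maps - base_maps"
      using letter_inv[of e False] e by simp
    ultimately show ?thesis
      using elementary_conjugate_not_base[OF char _ X x(1)] by blast
  next
    case (Y \<beta> c v)
    \<comment> \<open>Diagonal (1, -1): the last letter a carries x to a base involution y, whose
      diagonal can only be (-1, 1); the preceding letter e' then takes y out of the base.\<close>
    define y where "y = a \<otimes>\<^bsub>GA2\<^esub> x \<otimes>\<^bsub>GA2\<^esub> inv\<^bsub>GA2\<^esub> a"
    have yc: "y \<in> carrier GA2"
      using ac x(1) by (simp add: y_def)
    have gms: "(ms @ [e']) @ [a] = gs"
      by (simp add: ms)
    have yb: "y \<in> base_maps"
      unfolding y_def
      by (rule conjugate_last_letter[of False "ms @ [e']"]) (use gs(1) xb conj(1) in \<open>simp_all add: gms g_def del: append_assoc\<close>)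
    define k where "k = pmap_prod (ms @ [e'])"
    have kc: "k \<in> carrier GA2"
      unfolding k_def by (rule pmap_prod_carrier[OF alternates_carrier[OF alt_ms]])
    have gk: "g = k \<otimes>\<^bsub>GA2\<^esub> a"
      unfolding g_def gms[symmetric] k_def
      using pmap_prod_append[of "ms @ [e']" "[a]"] alternates_carrier[OF alt_ms] ac by simp
    have "k \<otimes>\<^bsub>GA2\<^esub> y \<otimes>\<^bsub>GA2\<^esub> inv\<^bsub>GA2\<^esub> k = g \<otimes>\<^bsub>GA2\<^esub> x \<otimes>\<^bsub>GA2\<^esub> inv\<^bsub>GA2\<^esub> g"
      unfolding gk y_def using kc ac x(1) by (simp add: GA2.m_assoc GA2.inv_mult_group)
    then have e'y: "e' \<otimes>\<^bsub>GA2\<^esub> y \<otimes>\<^bsub>GA2\<^esub> inv\<^bsub>GA2\<^esub> e' \<in> base_maps"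
      using conj(1) xb unfolding k_def by (simp only: conjugate_last_letter[OF alt_ms yb])
    have "y \<otimes>\<^bsub>GA2\<^esub> y = a \<otimes>\<^bsub>GA2\<^esub> (x \<otimes>\<^bsub>GA2\<^esub> x) \<otimes>\<^bsub>GA2\<^esub> inv\<^bsub>GA2\<^esub> a"
      unfolding y_def using ac x(1) by (simp add: GA2.m_assoc) (simp flip: GA2.m_assoc)
    then have yy: "pmap_comp y y = (X, Y)"
      using xx ac by (simp add: mult_GA2[symmetric] one_GA2[symmetric])
    have "y \<noteq> (X, Y)"
    proof
      assume "y = (X, Y)"
      then have "a \<otimes>\<^bsub>GA2\<^esub> x \<otimes>\<^bsub>GA2\<^esub> inv\<^bsub>GA2\<^esub> a = \<one>\<^bsub>GA2\<^esub>"
        by (simp add: y_def one_GA2)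
      then have "x = \<one>\<^bsub>GA2\<^esub>"
        by (rule conjugate_eq_one[OF ac x(1)])
      with x(2) show False
        by (simp add: one_GA2)
    qed
    note snd = affine_conjugate_snd[OF a Y x(1) y_def]
    have m1: "(- 1 :: 'a) \<noteq> 1"
      using two_neq_0[OF char] by (metis add.right_inverse one_add_one)
    from char yb yy \<open>y \<noteq> (X, Y)\<close> show ?thesis
    proof (cases rule: base_involution_cases)
      case (central u v)
      then have "snd y = cst (- 1) * Y + cst v"
        by (simp add: point_reflection_def cst_minus)
      from snd[OF this] m1 show ?thesis
        by blast
    next
      case X: (X \<beta> c)
      from elementary_conjugate_not_base[OF char e' X yc] e'y show ?thesis
        by blast
    next
      case (Y \<beta> c v)
      then have "snd y = cst (- 1) * Y + cst v"
        by simp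
      from snd[OF this] m1 show ?thesis
        by blast
    qed
  qed
qed

lemma commuting_involution:
  fixes x :: "'a::field pmap"
  assumes char: "CHAR('a) \<noteq> 2" and g: "cyclically_reduced g"
    and x: "symmetry g x" "involution x"
  shows "\<exists>u v. x = point_reflection u v"
proof -
  have xc: "x \<in> carrier GA2" "x \<otimes>\<^bsub>GA2\<^esub> x = \<one>\<^bsub>GA2\<^esub>" "x \<noteq> (X, Y)"
    using x(2) by (simp_all add: involution_def one_GA2)
  have comm: "x \<otimes>\<^bsub>GA2\<^esub> g = g \<otimes>\<^bsub>GA2\<^esub> x"
    using x(1) by (simp add: symmetry_def commutes_def)
  have gc: "g \<in> carrier GA2"
    using g by (simp add: cyclically_reduced_def)
  obtain s gs where gs: "gs \<noteq> []" "alternates s gs" "pmap_prod gs = g" "even (length gs)"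
    using g by (rule cyclically_reducedE)
  show ?thesis
  proof (cases s)
    case False
    with gs comm show ?thesis
      by (intro commuting_involution_word[OF char _ gs(1,4) xc(1,3,2)]) simp_all
  next
    case True
    \<comment> \<open>An even word that begins with an affine letter ends with an elementary one, so
      its inverse begins with an elementary letter; x commutes with the inverse of g too.\<close>
    have inv: "alternates False (inverse_word gs)"
      using alternates_inverse_word[OF gs(2)] True gs(4) by simp
    have "inverse_word gs \<noteq> []" "even (length (inverse_word gs))"
      using gs(1,4) by (auto simp: inverse_word_def)
    moreover have "x \<otimes>\<^bsub>GA2\<^esub> inv\<^bsub>GA2\<^esub> g = inv\<^bsub>GA2\<^esub> g \<otimes>\<^bsub>GA2\<^esub> x"
    proof -
      have "inv\<^bsub>GA2\<^esub> g \<otimes>\<^bsub>GA2\<^esub> x = (inv\<^bsub>GA2\<^esub> g \<otimes>\<^bsub>GA2\<^esub> x \<otimes>\<^bsub>GA2\<^esub> g) \<otimes>\<^bsub>GA2\<^esub> inv\<^bsub>GA2\<^esub> g"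
        using gc xc(1) by (simp add: GA2.m_assoc)
      then show ?thesis
        by (simp add: commutes_imp_conjugate_eq(2)[OF gc xc(1) comm])
    qed
    ultimately show ?thesis
      using pmap_prod_inverse_word[OF alternates_carrier[OF gs(2)]] gs(3)
      by (intro commuting_involution_word[OF char inv _ _ xc(1,3,2)]) simp_all
  qed
qed

section \<open>Transport of symmetries along conjugation\<close>

lemma symmetry_involution_conjugate:
  assumes h: "h \<in> carrier GA2" and f: "f \<in> carrier GA2" and s: "symmetry f s" "involution s"
  defines "t \<equiv> h \<otimes>\<^bsub>GA2\<^esub> s \<otimes>\<^bsub>GA2\<^esub> inv\<^bsub>GA2\<^esub> h"
  shows "symmetry (h \<otimes>\<^bsub>GA2\<^esub> f \<otimes>\<^bsub>GA2\<^esub> inv\<^bsub>GA2\<^esub> h) t \<and> involution t"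
proof -
  have sc: "s \<in> carrier GA2" "s \<otimes>\<^bsub>GA2\<^esub> s = \<one>\<^bsub>GA2\<^esub>" "s \<noteq> \<one>\<^bsub>GA2\<^esub>" "s \<otimes>\<^bsub>GA2\<^esub> f = f \<otimes>\<^bsub>GA2\<^esub> s"
    using s by (simp_all add: symmetry_def involution_def commutes_def)
  have prod: "(h \<otimes>\<^bsub>GA2\<^esub> p \<otimes>\<^bsub>GA2\<^esub> inv\<^bsub>GA2\<^esub> h) \<otimes>\<^bsub>GA2\<^esub> (h \<otimes>\<^bsub>GA2\<^esub> q \<otimes>\<^bsub>GA2\<^esub> inv\<^bsub>GA2\<^esub> h)
      = h \<otimes>\<^bsub>GA2\<^esub> (p \<otimes>\<^bsub>GA2\<^esub> q) \<otimes>\<^bsub>GA2\<^esub> inv\<^bsub>GA2\<^esub> h" if "p \<in> carrier GA2" "q \<in> carrier GA2" for p q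
  proof -
    have "inv\<^bsub>GA2\<^esub> h \<otimes>\<^bsub>GA2\<^esub> (h \<otimes>\<^bsub>GA2\<^esub> (q \<otimes>\<^bsub>GA2\<^esub> inv\<^bsub>GA2\<^esub> h)) = q \<otimes>\<^bsub>GA2\<^esub> inv\<^bsub>GA2\<^esub> h"
      using h that by (simp flip: GA2.m_assoc)
    with h that show ?thesis
      by (simp add: GA2.m_assoc)
  qed
  have "t \<noteq> \<one>\<^bsub>GA2\<^esub>"
  proof
    assume "t = \<one>\<^bsub>GA2\<^esub>"
    from conjugate_eq_one[OF h sc(1) this[unfolded t_def]] sc(3) show False
      by simp
  qed
  with h f sc show ?thesis
    by (simp add: symmetry_def involution_def commutes_def t_def prod)
qed

lemma point_reflection_involution:
  assumes "CHAR('a::field) \<noteq> 2"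
  shows "involution (point_reflection u v :: 'a pmap)"
proof -
  have sq: "pmap_comp (point_reflection u v) (point_reflection u v) = (X, Y :: 'a poly2)"
    by (simp add: pmap_comp_def point_reflection_def subst2_add subst2_diff subst2_minus)
  then have "point_reflection u v \<in> carrier (GA2 :: 'a pmap monoid)"
    unfolding carrier_GA2 by blast
  moreover have "point_reflection u v \<noteq> (X, Y :: 'a poly2)"
  proof
    assume "point_reflection u v = (X, Y :: 'a poly2)"
    then have "- X + cst u = (X :: 'a poly2)"
      by (simp add: point_reflection_def)
    then have "coeff (coeff (- X + cst u) 0) 1 = coeff (coeff (X :: 'a poly2) 0) 1"
      by simp
    then have "(- 1 :: 'a) = 1"
      by (simp add: coeff_X coeff_affine)
    with two_neq_0[OF assms] show False
      by (metis add.right_inverse one_add_one)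
  qed
  ultimately show ?thesis
    using sq by (simp add: involution_def mult_GA2 one_GA2)
qed

lemma commutes_point_reflection_iff:
  "commutes (P, Q) (point_reflection u v) \<longleftrightarrow>
    subst2 P (- X + cst u) (- Y + cst v) + P = cst u \<and> subst2 Q (- X + cst u) (- Y + cst v) + Q = cst v"
proof -
  have *: "p = c - q \<longleftrightarrow> p + q = c" for p q c :: "'a poly2"
    by (auto simp: algebra_simps)
  show ?thesis
    by (simp add: commutes_def mult_GA2 pmap_comp_def point_reflection_def subst2_add subst2_diff subst2_minus *)
qed

theorem corollary2:
  fixes f :: "'a::field pmap"
  assumes char: "CHAR('a) \<noteq> 2"
    and f: "f \<in> carrier GA2" "CR f"
  shows "((\<exists>s. symmetry f s \<and> involution s) \<longleftrightarrow>
            (\<forall>g. cyclically_reduced g \<and> conjugate f g \<longrightarrow>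
                (\<exists>u v. commutes g (point_reflection u v))))
       \<and> (\<forall>P Q u v. cyclically_reduced (P, Q) \<and> conjugate f (P, Q) \<longrightarrow>
            (commutes (P, Q) (point_reflection u v) \<longleftrightarrow>
               subst2 P (- X + cst u) (- Y + cst v) + P = cst u \<and>
               subst2 Q (- X + cst u) (- Y + cst v) + Q = cst v))"
proof (intro conjI)
  show "(\<exists>s. symmetry f s \<and> involution s) \<longleftrightarrow>
    (\<forall>g. cyclically_reduced g \<and> conjugate f g \<longrightarrow> (\<exists>u v. commutes g (point_reflection u v)))"
  proof (intro iffI allI impI)
    fix g
    assume "\<exists>s. symmetry f s \<and> involution s" and g: "cyclically_reduced g \<and> conjugate f g"
    then obtain s where s: "symmetry f s" "involution s"
      by blast
    from g obtain h where h: "h \<in> carrier GA2" "g = h \<otimes>\<^bsub>GA2\<^esub> f \<otimes>\<^bsub>GA2\<^esub> inv\<^bsub>GA2\<^esub> h"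
      by (auto simp: conjugate_def)
    from symmetry_involution_conjugate[OF h(1) f(1) s] obtain t where t: "symmetry g t" "involution t"
      unfolding h(2) by blast
    obtain u v where "t = point_reflection u v"
      using commuting_involution[OF char _ t] g by blast
    with t(1) have "commutes g (point_reflection u v)"
      by (simp add: symmetry_def commutes_def)
    then show "\<exists>u v. commutes g (point_reflection u v)"
      by blast
  next
    assume all: "\<forall>g. cyclically_reduced g \<and> conjugate f g \<longrightarrow> (\<exists>u v. commutes g (point_reflection u v))"
    \<comment> \<open>\<open>CR f\<close> supplies at least one conjugate to which the assumption
      applies.\<close>
    obtain g where g: "cyclically_reduced g" "conjugate f g"
      using f(2) by (auto simp: CR_def)
    with all obtain u v where uv: "commutes g (point_reflection u v)"
      by blast
    from g(2) obtain h where h: "h \<in> carrier GA2" "g = h \<otimes>\<^bsub>GA2\<^esub> f \<otimes>\<^bsub>GA2\<^esub> inv\<^bsub>GA2\<^esub> h"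
      by (auto simp: conjugate_def)
    have inv: "involution (point_reflection u v)"
      by (rule point_reflection_involution[OF char])
    then have "symmetry g (point_reflection u v)"
      using uv by (simp add: symmetry_def involution_def commutes_def)
    moreover have gc: "g \<in> carrier GA2"
      using g(1) by (simp add: cyclically_reduced_def)
    \<comment> \<open>Conjugating back by the inverse of h carries the reflection to a symmetry of
      f.\<close>
    moreover have "f = inv\<^bsub>GA2\<^esub> h \<otimes>\<^bsub>GA2\<^esub> g \<otimes>\<^bsub>GA2\<^esub> inv\<^bsub>GA2\<^esub> (inv\<^bsub>GA2\<^esub> h)"
      using h(1) f(1) by (simp add: h(2) GA2.m_assoc) (simp flip: GA2.m_assoc)
    ultimately show "\<exists>s. symmetry f s \<and> involution s"
      using symmetry_involution_conjugate[OF GA2.inv_closed[OF h(1)] gc _ inv] by metis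
  qed
qed (simp add: commutes_point_reflection_iff)

end
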